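(* Consider the Gaussian white noise model $dY_x=f(x)\,dx+n^{-1/2}\,dW_x$, $x\in[0,1]$, with parameter space $S^\beta(R)$ and $\beta$ a positive integer. If $R>2\Gamma_\beta$ and $0\cdot(+\infty)$ is assigned the value $+\infty$, then $$\inf_{\widehat f\in T}\ \sup_{f\in S^\beta(R)}\big|\mathrm{IBias}_f(\widehat f)\big|^{1/\beta}\ \sup_{f\in S^\beta(R)}\mathrm{IVar}_f\big(\widehat f\big)\ \geq\ \frac{1}{8n},$$ with $T:=\{\widehat f:\ \sup_{f\in S^\beta(R)}\mathrm{IBias}^2_f(\widehat f)<2^{-\beta}\}$.
   Context: Model: one observes $Y=(Y_x)_{x\in[0,1]}$ with $dY_x=f(x)\,dx+n^{-1/2}dW_x$, $W$ an unobserved standard Brownian motion; $E_f,\mathrm{Var}_f$ are expectation and variance under the law of $Y$. An estimator $\widehat f=(\widehat f(x))_{x\in[0,1]}$ is a (jointly measurable) function of the data $Y$ with values in the real-valued functions on $[0,1]$ such that $E_f[\widehat f(x)]$ exists and is finite for all $f$ in the parameter space. Non-square-integrable variables have variance $+\infty$. Define $$\mathrm{IBias}^2_f(\widehat f):=\int_0^1\big(E_f[\widehat f(x)]-f(x)\big)^2dx,\qquad |\mathrm{IBias}_f(\widehat f)|:=\sqrt{\mathrm{IBias}^2_f(\widehat f)},\qquad \mathrm{IVar}_f(\widehat f):=\int_0^1\mathrm{Var}_f(\widehat f(x))\,dx.$$ For a domain $D$, $\|f\|_{S^\beta(D)}^2:=\|f\|_{L^2(D)}^2+\|f^{(\beta)}\|_{L^2(D)}^2$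 ($L^2$-Sobolev norm, $f^{(\beta)}$ the $\beta$-th derivative), and $S^\beta(R)$ is the set of $f\in L^2([0,1])$ in the $L^2$-Sobolev space of index $\beta$ with $\|f\|_{S^\beta([0,1])}\le R$. Moreover $$\Gamma_\beta:=\inf\big\{\|K\|_{S^\beta(\mathbb R)}:\ \|K\|_{L^2(\mathbb R)}=1,\ \mathrm{supp}\,K\subset[-1/2,1/2]\big\}.$$ *)

theory Defs
  imports "HOL-Probability.Probability"
begin

section \<open>\<open>L\<^sup>2\<close>-Sobolev spaces on subsets of the real line\<close>

definition L2_on :: "real set \<Rightarrow> (real \<Rightarrow> real) \<Rightarrow> bool" where
  "L2_on D f \<longleftrightarrow> set_borel_measurable lborel D f \<and> set_integrable lborel D (\<lambda>x. (f x)\<^sup>2)"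

definition L2_norm_on :: "real set \<Rightarrow> (real \<Rightarrow> real) \<Rightarrow> real" where
  "L2_norm_on D f = sqrt (LINT x:D|lborel. (f x)\<^sup>2)"

definition test_function :: "real set \<Rightarrow> (real \<Rightarrow> real) \<Rightarrow> bool" where
  "test_function U \<phi> \<longleftrightarrow>
     (\<forall>k x. (deriv ^^ k) \<phi> differentiable (at x)) \<and>
     compact (closure {x. \<phi> x \<noteq> 0}) \<and> closure {x. \<phi> x \<noteq> 0} \<subseteq> U"

text \<open>The derivatives are weak derivatives, tested on the interior of the domain, so that the
  domain \<open>[0,1]\<close> stands for the usual Sobolev space on \<open>(0,1)\<close>. The predicate is meant for
  locally integrable \<open>f\<close> and \<open>g\<close>.\<close>

definition is_weak_derivative ::
    "real set \<Rightarrow> nat \<Rightarrow> (real \<Rightarrow> real) \<Rightarrow> (real \<Rightarrow> real) \<Rightarrow> bool" where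
  "is_weak_derivative D k f g \<longleftrightarrow>
     (\<forall>\<phi>. test_function (interior D) \<phi> \<longrightarrow>
        (LINT x:D|lborel. f x * (deriv ^^ k) \<phi> x) = (-1) ^ k * (LINT x:D|lborel. g x * \<phi> x))"

definition sobolev_space :: "nat \<Rightarrow> real set \<Rightarrow> (real \<Rightarrow> real) set" where
  "sobolev_space \<beta> D =
     {f. L2_on D f \<and> (\<forall>k\<in>{1..\<beta>}. \<exists>g. L2_on D g \<and> is_weak_derivative D k f g)}"

text \<open>For \<open>D = [0,1]\<close> and \<open>D = \<real>\<close>, a weak derivative in \<open>L\<^sup>2\<close> is unique up to a null set, so the
  choice below does not affect the norm.\<close>

definition weak_derivative :: "real set \<Rightarrow> nat \<Rightarrow> (real \<Rightarrow> real) \<Rightarrow> real \<Rightarrow> real" where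
  "weak_derivative D k f = (SOME g. L2_on D g \<and> is_weak_derivative D k f g)"

definition sobolev_norm :: "nat \<Rightarrow> real set \<Rightarrow> (real \<Rightarrow> real) \<Rightarrow> real" where
  "sobolev_norm \<beta> D f =
     sqrt ((L2_norm_on D f)\<^sup>2 + (L2_norm_on D (weak_derivative D \<beta> f))\<^sup>2)"

definition sobolev_ball :: "nat \<Rightarrow> real \<Rightarrow> (real \<Rightarrow> real) set" where
  "sobolev_ball \<beta> R = {f \<in> sobolev_space \<beta> {0..1}. sobolev_norm \<beta> {0..1} f \<le> R}"

definition Gamma_const :: "nat \<Rightarrow> real" where
  "Gamma_const \<beta> = Inf {sobolev_norm \<beta> UNIV K | K.
     K \<in> sobolev_space \<beta> UNIV \<and> L2_norm_on UNIV K = 1 \<and>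
     closure {x. K x \<noteq> 0} \<subseteq> {-1/2..1/2}}"


section \<open>The Gaussian white noise model\<close>

definition standard_brownian_motion :: "'w measure \<Rightarrow> (real \<Rightarrow> 'w \<Rightarrow> real) \<Rightarrow> bool" where
  "standard_brownian_motion M W \<longleftrightarrow>
     prob_space M \<and>
     (\<forall>t\<in>{0..1}. W t \<in> borel_measurable M) \<and>
     (\<forall>\<omega>\<in>space M. W 0 \<omega> = 0) \<and>
     (\<forall>\<omega>\<in>space M. continuous_on {0..1} (\<lambda>t. W t \<omega>)) \<and>
     (\<forall>s t. 0 \<le> s \<and> s < t \<and> t \<le> 1 \<longrightarrow>
        distributed M lborel (\<lambda>\<omega>. W t \<omega> - W s \<omega>) (normal_density 0 (sqrt (t - s)))) \<and>
     (\<forall>(\<tau> :: nat \<Rightarrow> real) k. 0 \<le> \<tau> 0 \<and> (\<forall>i<k. \<tau> i \<le> \<tau> (Suc i)) \<and> \<tau> k \<le> 1 \<longrightarrow>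
        prob_space.indep_vars M (\<lambda>_. borel) (\<lambda>i \<omega>. W (\<tau> (Suc i)) \<omega> - W (\<tau> i) \<omega>) {..<k})"

text \<open>The sample space of the data: continuous functions on \<open>[0,1]\<close> with the \<open>\<sigma>\<close>-algebra generated
  by the evaluations, which is the Borel \<open>\<sigma>\<close>-algebra of \<open>C[0,1]\<close>. Paths are extensional, i.e.
  \<open>undefined\<close> outside \<open>[0,1]\<close>.\<close>

definition path_space :: "(real \<Rightarrow> real) measure" where
  "path_space =
     restrict_space (\<Pi>\<^sub>M x\<in>{0..1}. (borel :: real measure)) {y. continuous_on {0..1} y}"

definition white_noise_data ::
    "(real \<Rightarrow> 'w \<Rightarrow> real) \<Rightarrow> nat \<Rightarrow> (real \<Rightarrow> real) \<Rightarrow> 'w \<Rightarrow> real \<Rightarrow> real" where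
  "white_noise_data W n f \<omega> =
     (\<lambda>x\<in>{0..1}. (LINT t:{0..x}|lborel. f t) + real n powr (-1/2) * W x \<omega>)"

definition white_noise_law ::
    "'w measure \<Rightarrow> (real \<Rightarrow> 'w \<Rightarrow> real) \<Rightarrow> nat \<Rightarrow> (real \<Rightarrow> real) \<Rightarrow> (real \<Rightarrow> real) measure" where
  "white_noise_law M W n f = distr M path_space (white_noise_data W n f)"


section \<open>Estimators, integrated bias and integrated variance\<close>

text \<open>A statistical model is given by a family \<open>P\<close> of laws of the data, indexed by the regression
  function \<open>f\<close>.\<close>

definition estimators ::
    "(real \<Rightarrow> real) set \<Rightarrow> ((real \<Rightarrow> real) \<Rightarrow> (real \<Rightarrow> real) measure)
      \<Rightarrow> ((real \<Rightarrow> real) \<Rightarrow> real \<Rightarrow> real) set" where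
  "estimators \<Theta> P = {fhat.
     (\<lambda>(y, x). fhat y x) \<in> borel_measurable (path_space \<Otimes>\<^sub>M restrict_space borel {0..1}) \<and>
     (\<forall>f\<in>\<Theta>. \<forall>x\<in>{0..1}. integrable (P f) (\<lambda>y. fhat y x))}"

text \<open>As a nonnegative extended integral, the variance of a variable with finite expectation is
  \<open>\<infinity>\<close> exactly when the variable is not square-integrable.\<close>

definition ext_variance :: "'a measure \<Rightarrow> ('a \<Rightarrow> real) \<Rightarrow> ennreal" where
  "ext_variance Q X = (\<integral>\<^sup>+ y. ennreal ((X y - (\<integral>z. X z \<partial>Q))\<^sup>2) \<partial>Q)"

text \<open>Powers with exponent \<open>p > 0\<close>.\<close>

definition ennreal_powr :: "ennreal \<Rightarrow> real \<Rightarrow> ennreal" where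
  "ennreal_powr a p = (if a = \<infinity> then \<infinity> else ennreal (enn2real a powr p))"

definition IBias_sq ::
    "((real \<Rightarrow> real) \<Rightarrow> (real \<Rightarrow> real) measure) \<Rightarrow> (real \<Rightarrow> real)
      \<Rightarrow> ((real \<Rightarrow> real) \<Rightarrow> real \<Rightarrow> real) \<Rightarrow> ennreal" where
  "IBias_sq P f fhat = (\<integral>\<^sup>+ x\<in>{0..1}. ennreal (((\<integral>y. fhat y x \<partial>(P f)) - f x)\<^sup>2) \<partial>lborel)"

definition abs_IBias ::
    "((real \<Rightarrow> real) \<Rightarrow> (real \<Rightarrow> real) measure) \<Rightarrow> (real \<Rightarrow> real)
      \<Rightarrow> ((real \<Rightarrow> real) \<Rightarrow> real \<Rightarrow> real) \<Rightarrow> ennreal" where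
  "abs_IBias P f fhat = ennreal_powr (IBias_sq P f fhat) (1/2)"

definition IVar ::
    "((real \<Rightarrow> real) \<Rightarrow> (real \<Rightarrow> real) measure) \<Rightarrow> (real \<Rightarrow> real)
      \<Rightarrow> ((real \<Rightarrow> real) \<Rightarrow> real \<Rightarrow> real) \<Rightarrow> ennreal" where
  "IVar P f fhat = (\<integral>\<^sup>+ x\<in>{0..1}. ext_variance (P f) (\<lambda>y. fhat y x) \<partial>lborel)"

definition small_bias_estimators ::
    "nat \<Rightarrow> real \<Rightarrow> ((real \<Rightarrow> real) \<Rightarrow> (real \<Rightarrow> real) measure)
      \<Rightarrow> ((real \<Rightarrow> real) \<Rightarrow> real \<Rightarrow> real) set" where
  "small_bias_estimators \<beta> R P =
     {fhat \<in> estimators (sobolev_ball \<beta> R) P.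
        (SUP f\<in>sobolev_ball \<beta> R. IBias_sq P f fhat) < ennreal (2 powr (- real \<beta>))}"

text \<open>Multiplication on \<open>[0,\<infinity>]\<close> with \<open>0 \<cdot> \<infinity> = \<infinity>\<close>, in contrast to \<^typ>\<open>ennreal\<close>, where
  \<open>0 * \<infinity> = 0\<close>.\<close>

definition mult_inf :: "ennreal \<Rightarrow> ennreal \<Rightarrow> ennreal" where
  "mult_inf a b = (if a = \<infinity> \<or> b = \<infinity> then \<infinity> else a * b)"

end

(*
  Fix m with 1/m at least the normalised worst-case bias s, where s^beta = sup |IBias|. A kernel K that is
  almost optimal for Gamma_beta, rescaled to m disjoint cells, gives orthonormal bumps psi_1, ..., psi_m, and
  f_theta = sum theta_i psi_i stays in the Sobolev ball for |theta| <= rho, where rho > 2r and r = m^(-beta)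
  bounds the bias. For g_i(theta) = <E_theta fhat, psi_i> we have |g(theta) - theta| <= r, and the information
  inequality bounds div g by sqrt(n m IVar). Averaging div g against a radial cutoff w that is constant on the
  ball of radius 2r and integrating by parts,
    - int g . grad w >= - int (|theta|^2 - r |theta|) w'(|theta|)/|theta| >= (1/2) m int w,
  because |theta| >= 2r wherever w' is nonzero. Hence IVar >= m/(4n), and m = floor(1/s) gives the constant 1/8.

  Instead of a likelihood for the white noise model we use the chi-square inequality
  (E_Q F)^2 <= exp(n |f - f'|^2) E_P F^2 for F >= 0. It holds for finitely many Gaussian increments and passes to
  the path space by approximating measurable sets by cylinders. It controls differences of g only, so the
  divergence argument runs on a lattice, with summation by parts, and the mesh is sent to 0.
*)
theory Submission
  imports Defs "HOL-Computational_Algebra.Polynomial"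
begin

section \<open>A divergence inequality on lattices\<close>

text \<open>The bias bound keeps \<open>g\<close> within distance \<open>r\<close> of the identity
  but says nothing about its derivative at any single point; hence the averaging, which moves the
  derivative onto the weight. The weight must decay somewhere: beyond radius \<open>2 * r\<close>,
  so that the bias cancels at most half of the radial flux, yet inside the ball of admissible
  \<theta>. A kernel of Sobolev norm \<kappa> admits the radius
  \<open>R / (m ^ \<beta> * \<kappa>)\<close>, and this exceeds \<open>2 * r\<close> exactly when
  \<open>\<kappa> < R / 2\<close>. That is the origin of the condition
  \<open>R > 2 * Gamma_const \<beta>\<close>. The factor sqrt(n m IVar) comes from treating all m
  directions together. Pointwise in x, a step \<delta> in one direction moves the mean by about
  \<delta> sqrt(n Var) at most. Integrating against |psi_i| and summing over i leaves the integral
  of sqrt(n Var) against the sum of all |psi_i|, a function of squared norm m because the cells are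
  disjoint. Cauchy-Schwarz in each direction separately would only give m sqrt(n IVar), too weak by
  a factor sqrt(m).\<close>

definition hinge_sq :: "real \<Rightarrow> real" where
  "hinge_sq x = (max 0 x)\<^sup>2 / 2"

text \<open>\<open>hinge_sq\<close> is an antiderivative of the positive part, which is 1-Lipschitz;
  so the remainder is of second order although \<open>hinge_sq\<close> has no second derivative at
  0.\<close>

lemma hinge_sq_taylor: "\<bar>hinge_sq y - hinge_sq x - max 0 x * (y - x)\<bar> \<le> (y - x)\<^sup>2 / 2"
proof -
  consider "0 \<le> x" "0 \<le> y" | "x < 0" "y < 0" | "0 \<le> x" "y < 0" | "x < 0" "0 \<le> y" by linarith
  then show ?thesis
  proof cases
    case 1
    have "y\<^sup>2 / 2 - x\<^sup>2 / 2 - x * (y - x) = (y - x)\<^sup>2 / 2" by (simp add: power2_eq_square field_simps)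
    with 1 have "hinge_sq y - hinge_sq x - max 0 x * (y - x) = (y - x)\<^sup>2 / 2"
      by (simp only: hinge_sq_def max.absorb2)
    then show ?thesis by (simp only: abs_of_nonneg zero_le_divide_iff zero_le_power2 order_refl simp_thms zero_le_numeral)
  next
    case 2 then show ?thesis by (simp add: hinge_sq_def)
  next
    case 3
    have "- (x\<^sup>2 / 2) - x * (y - x) = x\<^sup>2 / 2 + x * (-y)" by (simp add: power2_eq_square field_simps)
    moreover have "(y - x)\<^sup>2 / 2 = x\<^sup>2 / 2 + x * (-y) + y\<^sup>2 / 2" by (simp add: power2_eq_square field_simps)
    moreover have "0 \<le> x * (-y)" using 3 by (intro mult_nonneg_nonneg) auto
    moreover have "hinge_sq y - hinge_sq x - max 0 x * (y - x) = - (x\<^sup>2 / 2) - x * (y - x)"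
      using 3 by (simp add: hinge_sq_def)
    ultimately show ?thesis by (simp only:) (simp only: abs_of_nonneg add_nonneg_nonneg zero_le_power2 zero_le_divide_iff zero_le_numeral simp_thms le_add_same_cancel1)
  next
    case 4
    have "y\<^sup>2 \<le> (y - x)\<^sup>2" using 4 by (intro power_mono) auto
    with 4 show ?thesis by (simp add: hinge_sq_def)
  qed
qed

text \<open>A quadratic spline in \<open>q = |\<theta>|\<^sup>2\<close>, so that its gradient in \<open>\<theta>\<close> is Lipschitz and the Taylor error
  on a mesh of size \<open>\<delta>\<close> is \<open>O(\<delta>\<^sup>2)\<close>. Its derivative is \<open>- cutoff_slope\<close>.\<close>

definition cutoff :: "real \<Rightarrow> real \<Rightarrow> real \<Rightarrow> real" where
  "cutoff a d q = hinge_sq (a + 2 * d - q) - 2 * hinge_sq (a + d - q) + hinge_sq (a - q)"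

definition cutoff_slope :: "real \<Rightarrow> real \<Rightarrow> real \<Rightarrow> real" where
  "cutoff_slope a d q = max 0 (a + 2 * d - q) - 2 * max 0 (a + d - q) + max 0 (a - q)"

lemma cutoff_eq_0: "d \<ge> 0 \<Longrightarrow> q \<ge> a + 2 * d \<Longrightarrow> cutoff a d q = 0"
  by (simp add: cutoff_def hinge_sq_def)

text \<open>\<open>cutoff\<close> is the second difference of \<open>hinge_sq\<close> with step
  \<open>d\<close>. For \<open>q \<le> a\<close> all three hinges are on their quadratic branch,
  where the second difference of \<open>x\<^sup>2 / 2\<close> is constant.\<close>

lemma cutoff_eq: "d \<ge> 0 \<Longrightarrow> q \<le> a \<Longrightarrow> cutoff a d q = d\<^sup>2"
  by (simp add: cutoff_def hinge_sq_def power2_eq_square field_simps)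

lemma cutoff_nonneg:
  assumes "d \<ge> 0" shows "cutoff a d q \<ge> 0"
proof -
  consider "q \<le> a" | "a < q" "q \<le> a + d" | "a + d < q" by linarith
  then show ?thesis
  proof cases
    case 1 then show ?thesis using cutoff_eq[OF assms] by simp
  next
    case 2
    have "(a + d - q) * (a + d - q) \<le> d * d" using 2 by (intro mult_mono) auto
    moreover have "0 \<le> d * (a + d - q)" using 2 assms by (intro mult_nonneg_nonneg) auto
    ultimately show ?thesis using 2 assms
      by (simp add: cutoff_def hinge_sq_def power2_eq_square field_simps)
  next
    case 3 then show ?thesis using assms by (simp add: cutoff_def hinge_sq_def)
  qed
qed

text \<open>The slope is the hat function on \<open>{a..a + 2 * d}\<close> with peak
  \<open>d\<close> at \<open>a + d\<close>.\<close>

lemma cutoff_slope_bounds: "d \<ge> 0 \<Longrightarrow> 0 \<le> cutoff_slope a d q \<and> cutoff_slope a d q \<le> d"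
  by (auto simp: cutoff_slope_def max_def)

lemma cutoff_slope_eq_0: "d \<ge> 0 \<Longrightarrow> q \<le> a \<Longrightarrow> cutoff_slope a d q = 0"
  by (auto simp: cutoff_slope_def max_def)

text \<open>The three hinge remainders enter with weights 1, 2, 1, so their constants 1/2 add up to
  2.\<close>

lemma cutoff_taylor:
  "\<bar>cutoff a d p - cutoff a d q + cutoff_slope a d q * (p - q)\<bar> \<le> 2 * (p - q)\<^sup>2"
proof -
  have *: "\<bar>hinge_sq (c - p) - hinge_sq (c - q) + max 0 (c - q) * (p - q)\<bar> \<le> (p - q)\<^sup>2 / 2" for c
    using hinge_sq_taylor[of "c - p" "c - q"] by (simp add: algebra_simps power2_eq_square)
  define A where "A c = hinge_sq (c - p) - hinge_sq (c - q) + max 0 (c - q) * (p - q)" for c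
  have "cutoff a d p - cutoff a d q + cutoff_slope a d q * (p - q)
      = A (a + 2 * d) - 2 * A (a + d) + A a"
    unfolding A_def cutoff_def cutoff_slope_def by (simp add: algebra_simps)
  then show ?thesis
    using *[of "a + 2 * d", folded A_def] *[of "a + d", folded A_def] *[of a, folded A_def] by linarith
qed

section \<open>Summation by parts on a box of lattice points\<close>

text \<open>This moves a difference in direction \<open>i\<close> from \<open>G\<close> to
  \<open>w\<close>. The slabs \<open>k i < N\<close> and \<open>k i > -N\<close> are in bijection
  under the shift, and \<open>w\<close> kills the faces left over, so no boundary term
  appears.\<close>

lemma sum_box_shift:
  fixes w :: "(nat \<Rightarrow> int) \<Rightarrow> real"
  assumes i: "i < m" and w: "\<And>k. \<bar>k i\<bar> \<ge> N \<Longrightarrow> w k = 0"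
  shows "(\<Sum>k\<in>({..<m} \<rightarrow>\<^sub>E {-N..N}). G (k(i := k i + 1)) * w k)
       = (\<Sum>k\<in>({..<m} \<rightarrow>\<^sub>E {-N..N}). G k * w (k(i := k i - 1)))"
proof -
  define Box where "Box = ({..<m} \<rightarrow>\<^sub>E {-N..N})"
  have fin: "finite Box" unfolding Box_def by (intro finite_PiE) auto
  have "(\<Sum>k\<in>Box. G (k(i := k i + 1)) * w k) = (\<Sum>k\<in>{k\<in>Box. k i < N}. G (k(i := k i + 1)) * w k)"
  proof (rule sum.mono_neutral_right[OF fin])
    show "\<forall>k\<in>Box - {k\<in>Box. k i < N}. G (k(i := k i + 1)) * w k = 0"
    proof
      fix k assume "k \<in> Box - {k\<in>Box. k i < N}"
      then have "\<bar>k i\<bar> \<ge> N" by auto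
      then show "G (k(i := k i + 1)) * w k = 0" using w by simp
    qed
  qed blast
  also have "\<dots> = (\<Sum>k\<in>{k\<in>Box. k i > -N}. G k * w (k(i := k i - 1)))"
  proof (rule sum.reindex_bij_witness[of _ "\<lambda>k. k(i := k i - 1)" "\<lambda>k. k(i := k i + 1)"])
    fix k assume k: "k \<in> {k\<in>Box. k i < N}"
    have "-N \<le> k i" "k i \<le> N"
      using k i PiE_mem[of k "{..<m}" "\<lambda>_. {-N..N}" i] unfolding Box_def by auto
    then have "-N \<le> k i + 1 \<and> k i + 1 \<le> N \<and> -N < k i + 1" using k by auto
    then show "k(i := k i + 1) \<in> {k\<in>Box. k i > -N}"
      using k i unfolding Box_def PiE_iff extensional_def by simp
  next
    fix k assume k: "k \<in> {k\<in>Box. k i > -N}"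
    have "-N \<le> k i" "k i \<le> N"
      using k i PiE_mem[of k "{..<m}" "\<lambda>_. {-N..N}" i] unfolding Box_def by auto
    then have "-N \<le> k i - 1 \<and> k i - 1 \<le> N \<and> k i - 1 < N" using k by auto
    then show "k(i := k i - 1) \<in> {k\<in>Box. k i < N}"
      using k i unfolding Box_def PiE_iff extensional_def by simp
  qed simp_all
  also have "\<dots> = (\<Sum>k\<in>Box. G k * w (k(i := k i - 1)))"
  proof (rule sum.mono_neutral_left[OF fin])
    show "\<forall>k\<in>Box - {k\<in>Box. k i > -N}. G k * w (k(i := k i - 1)) = 0"
    proof
      fix k assume "k \<in> Box - {k\<in>Box. k i > -N}"
      \<comment> \<open>Here \<open>k i \<le> -N\<close>, so the shifted index has left the box; the
        hypothesis on \<open>w\<close> covers such indices as well.\<close>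
      then have "\<bar>(k(i := k i - 1)) i\<bar> \<ge> N" by auto
      then show "G k * w (k(i := k i - 1)) = 0" using w by (metis mult_zero_right)
    qed
  qed blast
  finally show ?thesis unfolding Box_def .
qed

lemma card_box: "N \<ge> 0 \<Longrightarrow> card ({..<m::nat} \<rightarrow>\<^sub>E {-N..N::int}) = (2 * nat N + 1) ^ m"
  by (simp add: card_PiE nat_add_distrib nat_mult_distrib algebra_simps)

lemma sum_sq_upd:
  fixes \<theta> :: "nat \<Rightarrow> real"
  assumes "i < m"
  shows "(\<Sum>j<m. ((\<theta>(i := x)) j)\<^sup>2) = (\<Sum>j<m. (\<theta> j)\<^sup>2) - (\<theta> i)\<^sup>2 + x\<^sup>2"
proof -
  have "(\<Sum>j<m. ((\<theta>(i := x)) j)\<^sup>2) = x\<^sup>2 + (\<Sum>j\<in>{..<m}-{i}. (\<theta> j)\<^sup>2)"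
    using assms by (subst sum.remove[of _ i]) (auto intro!: sum.cong)
  moreover have "(\<Sum>j<m. (\<theta> j)\<^sup>2) = (\<theta> i)\<^sup>2 + (\<Sum>j\<in>{..<m}-{i}. (\<theta> j)\<^sup>2)"
    using assms by (subst sum.remove[of _ i]) auto
  ultimately show ?thesis by simp
qed

lemma abs_le_of_sum_sq_le:
  fixes a :: "nat \<Rightarrow> real"
  assumes "(\<Sum>j<m. (a j)\<^sup>2) \<le> c\<^sup>2" "c \<ge> 0" "i < m"
  shows "\<bar>a i\<bar> \<le> c"
proof -
  have "(a i)\<^sup>2 \<le> (\<Sum>j<m. (a j)\<^sup>2)" using assms(3) by (intro member_le_sum) auto
  then show ?thesis using assms by (metis abs_le_square_iff abs_of_nonneg order_trans)
qed

text \<open>To first order the backward difference \<open>D i\<close> is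
  \<open>2 * \<delta> * s * \<theta> i\<close>, with \<open>s\<close> the slope at
  \<open>|\<theta>|\<^sup>2\<close>. The bias \<open>b\<close> can cancel at most half of the radial
  flux of the identity field, because the slope vanishes for \<open>|\<theta>| \<le> 2 * r\<close>.
  The subtracted term is the Taylor error.\<close>

lemma cutoff_gradient_bound:
  fixes \<theta> b :: "nat \<Rightarrow> real"
  assumes d: "d \<ge> 0" and r: "r \<ge> 0" and \<delta>: "0 < \<delta>" "\<delta> \<le> 1" and \<rho>: "\<rho> \<ge> 0"
    and norm: "(\<Sum>i<m. (\<theta> i)\<^sup>2) \<le> \<rho>\<^sup>2" and bias: "(\<Sum>i<m. (b i)\<^sup>2) \<le> r\<^sup>2"
  defines "D \<equiv> \<lambda>i. cutoff (4 * r\<^sup>2) d (\<Sum>j<m. ((\<theta>(i := \<theta> i - \<delta>)) j)\<^sup>2) - cutoff (4 * r\<^sup>2) d (\<Sum>j<m. (\<theta> j)\<^sup>2)"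
  shows "(\<Sum>i<m. \<theta> i * D i) / 2 - real m * (r + \<rho> / 2) * (d + 2 * (2 * \<rho> + 1)\<^sup>2) * \<delta>\<^sup>2
      \<le> (\<Sum>i<m. (\<theta> i + b i) * D i)"
proof -
  define q where "q = (\<Sum>j<m. (\<theta> j)\<^sup>2)"
  define s where "s = cutoff_slope (4 * r\<^sup>2) d q"
  \<comment> \<open>Per coordinate there are two errors: replacing \<open>p - q\<close> by its part
    linear in \<open>\<delta>\<close> costs \<open>d * \<delta>\<^sup>2\<close>, and the Taylor
    remainder costs \<open>2 * (p - q)\<^sup>2\<close> with
    \<open>|p - q| \<le> (2 * \<rho> + 1) * \<delta>\<close>.\<close>
  define e where "e = d + 2 * (2 * \<rho> + 1)\<^sup>2"
  define E where "E i = D i - 2 * \<delta> * s * \<theta> i" for i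
  have s: "0 \<le> s" "s \<le> d" using cutoff_slope_bounds[OF d] by (auto simp: s_def)
  have e: "e \<ge> 0" using d by (simp add: e_def)
  have q0: "q \<ge> 0" by (auto simp: q_def intro: sum_nonneg)
  have E: "\<bar>E i\<bar> \<le> e * \<delta>\<^sup>2" if i: "i < m" for i
  proof -
    define p where "p = (\<Sum>j<m. ((\<theta>(i := \<theta> i - \<delta>)) j)\<^sup>2)"
    have p: "p - q = - 2 * \<delta> * \<theta> i + \<delta>\<^sup>2"
      unfolding p_def q_def sum_sq_upd[OF i] by (simp add: power2_eq_square algebra_simps)
    have Dq: "D i = cutoff (4 * r\<^sup>2) d p - cutoff (4 * r\<^sup>2) d q"
      by (simp add: D_def p_def q_def)
    have t: "\<bar>D i + s * (p - q)\<bar> \<le> 2 * (p - q)\<^sup>2"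
      using cutoff_taylor[of "4 * r\<^sup>2" d p q] by (simp add: Dq s_def)
    have eq: "D i + s * (p - q) = E i + s * \<delta>\<^sup>2"
      by (simp add: E_def p algebra_simps)
    have \<theta>i: "\<bar>\<theta> i\<bar> \<le> \<rho>" by (rule abs_le_of_sum_sq_le[OF norm \<rho> i])
    have "\<bar>p - q\<bar> \<le> 2 * \<delta> * \<bar>\<theta> i\<bar> + \<delta>\<^sup>2"
      unfolding p using \<delta> by (intro order_trans[OF abs_triangle_ineq]) (simp add: abs_mult)
    also have "\<dots> \<le> 2 * \<delta> * \<rho> + \<delta> * 1"
      unfolding power2_eq_square using \<delta> \<theta>i by (intro add_mono mult_left_mono) auto
    also have "\<dots> = (2 * \<rho> + 1) * \<delta>" by (simp add: algebra_simps)
    finally have "\<bar>p - q\<bar>\<^sup>2 \<le> ((2 * \<rho> + 1) * \<delta>)\<^sup>2" by (intro power_mono) auto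
    then have "2 * (p - q)\<^sup>2 \<le> 2 * (2 * \<rho> + 1)\<^sup>2 * \<delta>\<^sup>2" by (simp add: power_mult_distrib)
    moreover have "s * \<delta>\<^sup>2 \<le> d * \<delta>\<^sup>2" "0 \<le> s * \<delta>\<^sup>2" using s by (auto intro: mult_right_mono)
    ultimately show ?thesis using t unfolding eq e_def by (simp add: algebra_simps)
  qed
  have th: "\<bar>\<Sum>i<m. \<theta> i * E i\<bar> \<le> real m * \<rho> * (e * \<delta>\<^sup>2)"
  proof -
    have "\<bar>\<Sum>i<m. \<theta> i * E i\<bar> \<le> (\<Sum>i<m. \<bar>\<theta> i * E i\<bar>)" by (rule sum_abs)
    also have "\<dots> \<le> (\<Sum>i<m. \<rho> * (e * \<delta>\<^sup>2))"
      using E abs_le_of_sum_sq_le[OF norm \<rho>] \<rho> unfolding abs_mult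
      by (intro sum_mono mult_mono) auto
    finally show ?thesis by simp
  qed
  have bE: "\<bar>\<Sum>i<m. b i * E i\<bar> \<le> real m * r * (e * \<delta>\<^sup>2)"
  proof -
    have "\<bar>\<Sum>i<m. b i * E i\<bar> \<le> (\<Sum>i<m. \<bar>b i * E i\<bar>)" by (rule sum_abs)
    also have "\<dots> \<le> (\<Sum>i<m. r * (e * \<delta>\<^sup>2))"
      using E abs_le_of_sum_sq_le[OF bias r] r unfolding abs_mult
      by (intro sum_mono mult_mono) auto
    finally show ?thesis by simp
  qed
  \<comment> \<open>Off the inner ball \<open>r\<^sup>2 \<le> q / 4\<close>, so Cauchy-Schwarz
    bounds the inner product by \<open>q / 2\<close>; on it the slope is 0. This is why the first
    knot of the cutoff sits at \<open>4 * r\<^sup>2\<close>.\<close>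
  have bt: "s * (2 * \<bar>\<Sum>i<m. b i * \<theta> i\<bar>) \<le> s * q"
  proof (cases "q \<le> 4 * r\<^sup>2")
    case True
    then show ?thesis using cutoff_slope_eq_0[OF d] by (simp add: s_def)
  next
    case False
    have "(\<Sum>i<m. b i * \<theta> i)\<^sup>2 \<le> (\<Sum>i<m. (b i)\<^sup>2) * (\<Sum>i<m. (\<theta> i)\<^sup>2)"
      by (rule Cauchy_Schwarz_ineq_sum)
    also have "\<dots> \<le> r\<^sup>2 * q" unfolding q_def[symmetric] using bias q0 by (intro mult_right_mono) auto
    also have "\<dots> \<le> (q / 4) * q" using False q0 by (intro mult_right_mono) auto
    also have "\<dots> = (q / 2)\<^sup>2" by (simp add: power2_eq_square)
    finally have "\<bar>\<Sum>i<m. b i * \<theta> i\<bar> \<le> q / 2" using q0 by (metis abs_le_square_iff abs_of_nonneg divide_nonneg_nonneg zero_le_numeral)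
    then show ?thesis using s by (intro mult_left_mono) auto
  qed
  have D: "D i = 2 * \<delta> * s * \<theta> i + E i" for i by (simp add: E_def)
  have TD: "(\<Sum>i<m. \<theta> i * D i) = 2 * \<delta> * (s * q) + (\<Sum>i<m. \<theta> i * E i)"
    unfolding D q_def by (simp add: algebra_simps sum.distrib sum_distrib_left power2_eq_square)
  have BD: "(\<Sum>i<m. b i * D i) = 2 * \<delta> * (s * (\<Sum>i<m. b i * \<theta> i)) + (\<Sum>i<m. b i * E i)"
    unfolding D by (simp add: algebra_simps sum.distrib sum_distrib_left)
  have "- (s * (\<Sum>i<m. b i * \<theta> i)) \<le> s * \<bar>\<Sum>i<m. b i * \<theta> i\<bar>"
    using s by (metis abs_ge_minus_self mult_left_mono mult_minus_right)
  then have "- 2 * (s * (\<Sum>i<m. b i * \<theta> i)) \<le> s * q" using bt by linarith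
  then have "\<delta> * (- 2 * (s * (\<Sum>i<m. b i * \<theta> i))) \<le> \<delta> * (s * q)" using \<delta> by (intro mult_left_mono) auto
  moreover have "(\<Sum>i<m. (\<theta> i + b i) * D i) = (\<Sum>i<m. \<theta> i * D i) + (\<Sum>i<m. b i * D i)"
    by (simp add: algebra_simps sum.distrib)
  \<comment> \<open>Half of the sum of \<open>\<theta> i * D i\<close> is kept in the lower bound,
    so only half of its error counts: \<open>\<rho> / 2\<close>, but the full
    \<open>r\<close>.\<close>
  moreover have "real m * (r + \<rho> / 2) * e * \<delta>\<^sup>2 = real m * r * (e * \<delta>\<^sup>2) + real m * \<rho> * (e * \<delta>\<^sup>2) / 2"
    by (simp add: field_simps)
  moreover have "\<delta> * (- 2 * (s * (\<Sum>i<m. b i * \<theta> i))) = - (2 * \<delta> * (s * (\<Sum>i<m. b i * \<theta> i)))"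
    "2 * \<delta> * (s * q) = 2 * (\<delta> * (s * q))"
    by simp_all
  moreover have "- (real m * \<rho> * (e * \<delta>\<^sup>2)) \<le> (\<Sum>i<m. \<theta> i * E i)"
    "- (real m * r * (e * \<delta>\<^sup>2)) \<le> (\<Sum>i<m. b i * E i)"
    using th bE by (simp_all only: abs_le_iff) linarith+
  ultimately show ?thesis using TD BD unfolding e_def[symmetric] by argo
qed

lemma sum_sq_upd_add_le:
  fixes \<theta> :: "nat \<Rightarrow> real"
  assumes "(\<Sum>j<m. (\<theta> j)\<^sup>2) \<le> c\<^sup>2" "c \<ge> 0" "i < m"
  shows "(\<Sum>j<m. ((\<theta>(i := \<theta> i + x)) j)\<^sup>2) \<le> (c + \<bar>x\<bar>)\<^sup>2"
proof -
  have "\<theta> i * x \<le> \<bar>\<theta> i\<bar> * \<bar>x\<bar>" by (metis abs_ge_self abs_mult)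
  also have "\<dots> \<le> c * \<bar>x\<bar>" by (intro mult_right_mono abs_le_of_sum_sq_le[OF assms]) simp
  finally have "\<theta> i * x \<le> c * \<bar>x\<bar>" .
  then have "- (\<theta> i)\<^sup>2 + (\<theta> i + x)\<^sup>2 \<le> 2 * c * \<bar>x\<bar> + \<bar>x\<bar>\<^sup>2"
    by (simp add: power2_sum)
  moreover have "(c + \<bar>x\<bar>)\<^sup>2 = c\<^sup>2 + (2 * c * \<bar>x\<bar> + \<bar>x\<bar>\<^sup>2)" by (simp add: power2_sum)
  ultimately show ?thesis using assms(1) unfolding sum_sq_upd[OF assms(3)] by linarith
qed

text \<open>Weighting the increments of \<open>g\<close> with the cutoff and summing over the
  lattice gives at most \<open>T * W\<close>. After summation by parts the same sum is at least half
  of the value \<open>real m * \<delta> * W\<close> of the identity field, minus an error of order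
  \<open>\<delta>\<^sup>2\<close> per lattice point. The mesh is tied to \<open>J\<close> so that
  the cube of indices up to \<open>J\<close> just fits into the ball of radius \<open>2 * r\<close>,
  where the weight is \<open>d\<^sup>2\<close>; the number of lattice points is then at most
  \<open>c ^ m / d\<^sup>2\<close> times \<open>W\<close>, uniformly in \<open>J\<close>.\<close>

lemma lattice_step:
  fixes g :: "(nat \<Rightarrow> real) \<Rightarrow> nat \<Rightarrow> real" and J c m :: nat and r \<rho> \<rho>1 \<delta> T :: real
  assumes m: "m \<ge> 1" and r: "r > 0" and \<rho>1: "2 * r < \<rho>1" and J: "J \<ge> 1"
    and c: "c \<ge> 1" "\<rho>1 * sqrt m \<le> 2 * r * c" and \<delta>: "\<delta> = 2 * r / (sqrt m * J)" "\<delta> \<le> 1" "\<rho>1 + \<delta> \<le> \<rho>"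
    and bias: "\<And>\<theta>. (\<Sum>i<m. (\<theta> i)\<^sup>2) \<le> \<rho>\<^sup>2 \<Longrightarrow> (\<Sum>i<m. (g \<theta> i - \<theta> i)\<^sup>2) \<le> r\<^sup>2"
    and incr: "\<And>\<theta>. (\<Sum>i<m. (\<theta> i)\<^sup>2) \<le> \<rho>\<^sup>2 \<Longrightarrow>
      (\<And>i. i < m \<Longrightarrow> (\<Sum>j<m. ((\<theta>(i := \<theta> i + \<delta>)) j)\<^sup>2) \<le> \<rho>\<^sup>2) \<Longrightarrow>
      (\<Sum>i<m. g (\<theta>(i := \<theta> i + \<delta>)) i - g \<theta> i) \<le> T"
  defines "d \<equiv> (\<rho>1\<^sup>2 - 4 * r\<^sup>2) / 2"
  shows "real m / 2 * \<delta> - real m * (r + \<rho> / 2) * (d + 2 * (2 * \<rho> + 1)\<^sup>2) * (c ^ m / d\<^sup>2) * \<delta>\<^sup>2 \<le> T"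
proof -
  define \<theta> where "\<theta> k = (\<lambda>i. \<delta> * real_of_int (k i))" for k :: "nat \<Rightarrow> int"
  define w where "w k = cutoff (4 * r\<^sup>2) d (\<Sum>j<m. (\<theta> k j)\<^sup>2)" for k
  define N where "N = int (c * J)"
  define Box where "Box = ({..<m} \<rightarrow>\<^sub>E {-N..N})"
  define C where "C = real m * (r + \<rho> / 2) * (d + 2 * (2 * \<rho> + 1)\<^sup>2)"
  define D where "D i k = w (k(i := k i - 1)) - w k" for i k
  define W where "W = (\<Sum>k\<in>Box. w k)"
  have sm: "sqrt m > 0" using m by simp
  have \<delta>0: "\<delta> > 0" using r J sm by (simp add: \<delta>)
  have \<rho>: "\<rho>1 < \<rho>" "\<rho>1 > 0" "\<rho> > 0" using \<delta>0 \<delta>(3) \<rho>1 r by linarith+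
  have "(2 * r)\<^sup>2 < \<rho>1\<^sup>2" using \<rho>1 r by (intro power_strict_mono) auto
  then have d: "d > 0" by (simp add: d_def power_mult_distrib)
  \<comment> \<open>With this \<open>d\<close> the last knot of the cutoff is exactly
    \<open>\<rho>1\<^sup>2\<close>.\<close>
  have ad: "4 * r\<^sup>2 + 2 * d = \<rho>1\<^sup>2" by (simp add: d_def field_simps)
  have C: "C \<ge> 0" using r \<rho> d by (auto simp: C_def)
  have up: "\<theta> (k(i := k i + 1)) = (\<theta> k)(i := \<theta> k i + \<delta>)" for k i
    by (auto simp: \<theta>_def algebra_simps)
  have dn: "\<theta> (k(i := k i - 1)) = (\<theta> k)(i := \<theta> k i - \<delta>)" for k i
    by (auto simp: \<theta>_def algebra_simps)
  have wn: "w k \<ge> 0" for k using cutoff_nonneg d by (simp add: w_def)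
  have wz: "w k = 0" if "(\<Sum>j<m. (\<theta> k j)\<^sup>2) \<ge> \<rho>1\<^sup>2" for k
    using that cutoff_eq_0 d ad by (simp add: w_def)
  have wN: "w k = 0" if "i < m" "\<bar>k i\<bar> \<ge> N" for k i
  proof (rule wz)
    \<comment> \<open>An index on a face of the box has a single coordinate of size at least
      \<open>\<rho>1\<close> already; the lower bound on \<open>c\<close> is made for this.\<close>
    have "\<rho>1 \<le> 2 * r * c / sqrt m" using c(2) sm by (simp add: pos_le_divide_eq)
    also have "\<dots> = \<delta> * real_of_int N" using J sm by (simp add: \<delta> N_def)
    also have "\<dots> \<le> \<delta> * real_of_int \<bar>k i\<bar>" using that \<delta>0 by (intro mult_left_mono) auto
    finally have "\<rho>1\<^sup>2 \<le> (\<delta> * real_of_int \<bar>k i\<bar>)\<^sup>2" using \<rho> by (intro power_mono) auto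
    also have "\<dots> = (\<theta> k i)\<^sup>2" by (simp add: \<theta>_def power_mult_distrib)
    also have "\<dots> \<le> (\<Sum>j<m. (\<theta> k j)\<^sup>2)" using that by (intro member_le_sum) auto
    finally show "\<rho>1\<^sup>2 \<le> (\<Sum>j<m. (\<theta> k j)\<^sup>2)" .
  qed
  have shift: "(\<Sum>k\<in>Box. w k * (G (k(i := k i + 1)) - G k)) = (\<Sum>k\<in>Box. G k * D i k)"
    if "i < m" for G i
    using sum_box_shift[OF that, of N w G] wN[OF that]
    by (simp add: Box_def[symmetric] D_def algebra_simps sum_subtractf)
  have finB: "finite Box" unfolding Box_def by (intro finite_PiE) auto

  \<comment> \<open>\<open>bias\<close> is only available in the ball of radius
    \<open>\<rho>\<close>. Outside it both \<open>k\<close> and its lower neighbours lie beyond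
    \<open>\<rho>1\<close>, since one step has length
    \<open>\<delta> \<le> \<rho> - \<rho>1\<close>, and all differences vanish.\<close>
  have pointwise: "(\<Sum>i<m. \<theta> k i * D i k) / 2 - C * \<delta>\<^sup>2 \<le> (\<Sum>i<m. g (\<theta> k) i * D i k)" for k
  proof (cases "(\<Sum>j<m. (\<theta> k j)\<^sup>2) \<le> \<rho>\<^sup>2")
    case True
    have "(\<Sum>i<m. \<theta> k i * D i k) / 2 - C * \<delta>\<^sup>2 \<le> (\<Sum>i<m. (\<theta> k i + (g (\<theta> k) i - \<theta> k i)) * D i k)"
      unfolding D_def w_def dn C_def
      using d r \<delta>0 \<delta> \<rho> True bias[OF True]
      by (intro cutoff_gradient_bound) auto
    then show ?thesis by simp
  next
    case False
    have D0: "D i k = 0" if i: "i < m" for i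
    proof -
      have "\<rho>1\<^sup>2 \<le> \<rho>\<^sup>2" using \<rho> by (intro power_mono) auto
      then have "w k = 0" using False by (intro wz) simp
      moreover have "w (k(i := k i - 1)) = 0"
      proof (rule wz, rule ccontr)
        assume "\<not> \<rho>1\<^sup>2 \<le> (\<Sum>j<m. (\<theta> (k(i := k i - 1)) j)\<^sup>2)"
        then have "(\<Sum>j<m. (\<theta> (k(i := k i - 1)) j)\<^sup>2) \<le> \<rho>1\<^sup>2" by simp
        moreover have "((\<theta> (k(i := k i - 1)))(i := \<theta> (k(i := k i - 1)) i + \<delta>)) = \<theta> k"
          by (auto simp: dn)
        ultimately have "(\<Sum>j<m. ((\<theta> k) j)\<^sup>2) \<le> (\<rho>1 + \<delta>)\<^sup>2"
          using sum_sq_upd_add_le[where m = m and \<theta> = "\<theta> (k(i := k i - 1))" and c = \<rho>1 and i = i and x = \<delta>] i \<rho> \<delta>0 by simp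
        also have "\<dots> \<le> \<rho>\<^sup>2" using \<rho> \<delta>0 \<delta> by (intro power_mono) auto
        finally show False using False by simp
      qed
      ultimately show ?thesis by (simp add: D_def)
    qed
    then have "(\<Sum>i<m. \<theta> k i * D i k) = 0" "(\<Sum>i<m. g (\<theta> k) i * D i k) = 0" by auto
    moreover have "C * \<delta>\<^sup>2 \<ge> 0" using C by simp
    ultimately show ?thesis by simp
  qed

  \<comment> \<open>Summation by parts for the identity field, whose forward difference in each of
    the \<open>m\<close> directions is exactly \<open>\<delta>\<close>.\<close>
  have "(\<Sum>k\<in>Box. \<Sum>i<m. \<theta> k i * D i k) = (\<Sum>i<m. \<Sum>k\<in>Box. \<theta> k i * D i k)"
    by (rule sum.swap)
  also have "\<dots> = (\<Sum>i<m. \<Sum>k\<in>Box. w k * (\<theta> (k(i := k i + 1)) i - \<theta> k i))"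
  proof (rule sum.cong[OF refl])
    fix i assume "i \<in> {..<m}"
    then show "(\<Sum>k\<in>Box. \<theta> k i * D i k) = (\<Sum>k\<in>Box. w k * (\<theta> (k(i := k i + 1)) i - \<theta> k i))"
      using shift[of i "\<lambda>k. \<theta> k i"] by simp
  qed
  also have "\<dots> = real m * \<delta> * W"
  proof -
    have "\<theta> (k(i := k i + 1)) i - \<theta> k i = \<delta>" for k i by (simp add: up)
    then show ?thesis by (simp add: W_def sum_distrib_right[symmetric])
  qed
  finally have 1: "(\<Sum>k\<in>Box. \<Sum>i<m. \<theta> k i * D i k) = real m * \<delta> * W" .

  have "real m * \<delta> * W / 2 - C * \<delta>\<^sup>2 * card Box = (\<Sum>k\<in>Box. (\<Sum>i<m. \<theta> k i * D i k) / 2 - C * \<delta>\<^sup>2)"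
    using 1 by (simp add: sum_subtractf sum_divide_distrib[symmetric])
  also have "\<dots> \<le> (\<Sum>k\<in>Box. \<Sum>i<m. g (\<theta> k) i * D i k)"
    by (intro sum_mono pointwise)
  also have "\<dots> = (\<Sum>i<m. \<Sum>k\<in>Box. g (\<theta> k) i * D i k)" by (rule sum.swap)
  also have "\<dots> = (\<Sum>i<m. \<Sum>k\<in>Box. w k * (g (\<theta> (k(i := k i + 1))) i - g (\<theta> k) i))"
  proof (rule sum.cong[OF refl])
    fix i assume "i \<in> {..<m}"
    then show "(\<Sum>k\<in>Box. g (\<theta> k) i * D i k) = (\<Sum>k\<in>Box. w k * (g (\<theta> (k(i := k i + 1))) i - g (\<theta> k) i))"
      using shift[of i "\<lambda>k. g (\<theta> k) i"] by simp
  qed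
  also have "\<dots> = (\<Sum>k\<in>Box. \<Sum>i<m. w k * (g (\<theta> (k(i := k i + 1))) i - g (\<theta> k) i))"
    by (rule sum.swap)
  also have "\<dots> \<le> (\<Sum>k\<in>Box. w k * T)"
  proof (rule sum_mono)
    fix k
    \<comment> \<open>Where the weight is nonzero the point lies within \<open>\<rho>1\<close>, so
      every forward neighbour stays within \<open>\<rho>\<close> and \<open>incr\<close>
      applies.\<close>
    show "(\<Sum>i<m. w k * (g (\<theta> (k(i := k i + 1))) i - g (\<theta> k) i)) \<le> w k * T"
    proof (cases "(\<Sum>j<m. (\<theta> k j)\<^sup>2) \<le> \<rho>1\<^sup>2")
      case True
      have "\<rho>1\<^sup>2 \<le> \<rho>\<^sup>2" using \<rho> by (intro power_mono) auto
      moreover have "(\<Sum>j<m. (((\<theta> k)(i := \<theta> k i + \<delta>)) j)\<^sup>2) \<le> \<rho>\<^sup>2" if "i < m" for i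
        using \<rho> \<delta>0 \<delta>(3)
        by (intro order_trans[OF sum_sq_upd_add_le[OF True _ that]] power_mono) auto
      ultimately have "(\<Sum>i<m. g (\<theta> (k(i := k i + 1))) i - g (\<theta> k) i) \<le> T"
        unfolding up using True by (intro incr) auto
      then show ?thesis using wn by (simp add: sum_distrib_left[symmetric] mult_left_mono)
    next
      case False
      then have "w k = 0" by (intro wz) simp
      then show ?thesis by simp
    qed
  qed
  also have "\<dots> = T * W" by (simp add: W_def sum_distrib_left mult.commute)
  finally have 2: "real m * \<delta> * W / 2 - C * \<delta>\<^sup>2 * card Box \<le> T * W" .

  have "card Box \<le> (c * (2 * J + 1)) ^ m"
  proof -
    have "card Box = (2 * (c * J) + 1) ^ m"
      unfolding Box_def by (subst card_box) (simp_all add: N_def del: of_nat_mult)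
    \<comment> \<open>Since \<open>c \<ge> 1\<close>. The bound now shares the factor
      \<open>(2 * J + 1) ^ m\<close> with the lower bound on \<open>W\<close>.\<close>
    also have "\<dots> \<le> (c * (2 * J + 1)) ^ m" using c by (intro power_mono) (auto simp: algebra_simps)
    finally show ?thesis .
  qed
  then have cB: "real (card Box) \<le> real c ^ m * (2 * real J + 1) ^ m"
    unfolding of_nat_le_iff[where ?'a = real, symmetric] power_mult_distrib by (simp add: add.commute)
  have "W \<ge> d\<^sup>2 * (2 * real J + 1) ^ m"
  proof -
    define B0 where "B0 = ({..<m} \<rightarrow>\<^sub>E {-int J..int J})"
    have "1 * J \<le> c * J" using c by (intro mult_right_mono) auto
    then have JN: "int J \<le> N" by (simp add: N_def del: of_nat_mult)
    have "card B0 = (2 * J + 1) ^ m" unfolding B0_def by (subst card_box) simp_all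
    then have "real (card B0) = (2 * real J + 1) ^ m" by (simp add: add.commute)
    then have "d\<^sup>2 * (2 * real J + 1) ^ m = (\<Sum>k\<in>B0. d\<^sup>2)" by simp
    also have "\<dots> \<le> (\<Sum>k\<in>B0. w k)"
    proof (rule sum_mono)
      fix k assume k: "k \<in> B0"
      \<comment> \<open>A corner of the cube has norm \<open>sqrt m * \<delta> * J = 2 * r\<close>,
        so the whole cube lies where the cutoff is constant.\<close>
      have "(\<Sum>j<m. (\<theta> k j)\<^sup>2) \<le> (\<Sum>j<m. (\<delta> * J)\<^sup>2)"
      proof (rule sum_mono)
        fix j assume "j \<in> {..<m}"
        then have "k j \<in> {-int J..int J}" by (rule PiE_mem[OF k[unfolded B0_def]])
        then have "\<bar>real_of_int (k j)\<bar> \<le> real J" unfolding atLeastAtMost_iff by linarith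
        then have "\<bar>\<theta> k j\<bar> \<le> \<bar>\<delta> * J\<bar>" using \<delta>0 by (auto simp: \<theta>_def abs_mult intro: mult_left_mono)
        then show "(\<theta> k j)\<^sup>2 \<le> (\<delta> * J)\<^sup>2" by (simp add: abs_le_square_iff)
      qed
      also have "\<dots> = 4 * r\<^sup>2" using J m by (simp add: \<delta> power_mult_distrib power_divide)
      finally show "d\<^sup>2 \<le> w k" using cutoff_eq d by (simp add: w_def)
    qed
    also have "\<dots> \<le> W" unfolding W_def
    proof (rule sum_mono2[OF finB])
      show "B0 \<subseteq> Box" unfolding B0_def Box_def using JN by (intro PiE_mono) auto
    qed (rule wn)
    finally show ?thesis .
  qed
  moreover have "d\<^sup>2 * (2 * real J + 1) ^ m > 0" using d by simp
  ultimately have W: "W > 0" "(2 * real J + 1) ^ m \<le> W / d\<^sup>2"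
    using d by (linarith, simp add: pos_le_divide_eq mult.commute)
  have "real (card Box) \<le> real c ^ m * (W / d\<^sup>2)"
    using cB W by (intro order_trans[OF cB] mult_left_mono) auto
  then have "C * \<delta>\<^sup>2 * card Box \<le> C * \<delta>\<^sup>2 * (real c ^ m * (W / d\<^sup>2))"
    using C by (intro mult_left_mono) auto
  with 2 have "real m * \<delta> * W / 2 - C * \<delta>\<^sup>2 * (real c ^ m * (W / d\<^sup>2)) \<le> T * W" by linarith
  then have "(real m / 2 * \<delta> - C * (c ^ m / d\<^sup>2) * \<delta>\<^sup>2) * W \<le> T * W"
    by (simp add: algebra_simps)
  then show ?thesis using W by (simp add: C_def)
qed

text \<open>Dividing \<open>lattice_step\<close> by \<open>\<delta>\<close> and letting
  \<open>J\<close> tend to infinity removes the quadratic error, while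
  \<open>sqrt (exp (\<kappa> * \<delta>\<^sup>2) - 1) / \<delta>\<close> tends to
  \<open>sqrt \<kappa>\<close>. The result has the strength of an information inequality without
  \<open>g\<close> ever being differentiated.\<close>

lemma lattice_information_bound:
  fixes g :: "(nat \<Rightarrow> real) \<Rightarrow> nat \<Rightarrow> real"  and m :: nat and r \<rho> S \<kappa> :: real
  assumes m: "m \<ge> 1" and r: "r > 0" and \<rho>: "2 * r < \<rho>" and S: "S \<ge> 0" and \<kappa>: "\<kappa> \<ge> 0"
    and bias: "\<And>\<theta>. (\<Sum>i<m. (\<theta> i)\<^sup>2) \<le> \<rho>\<^sup>2 \<Longrightarrow> (\<Sum>i<m. (g \<theta> i - \<theta> i)\<^sup>2) \<le> r\<^sup>2"
    and incr: "\<And>\<theta> \<delta>. \<delta> > 0 \<Longrightarrow> (\<Sum>i<m. (\<theta> i)\<^sup>2) \<le> \<rho>\<^sup>2 \<Longrightarrow>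
      (\<And>i. i < m \<Longrightarrow> (\<Sum>j<m. ((\<theta>(i := \<theta> i + \<delta>)) j)\<^sup>2) \<le> \<rho>\<^sup>2) \<Longrightarrow>
      (\<Sum>i<m. g (\<theta>(i := \<theta> i + \<delta>)) i - g \<theta> i) \<le> sqrt (exp (\<kappa> * \<delta>\<^sup>2) - 1) * S"
  shows "real m / 2 \<le> sqrt \<kappa> * S"
proof -
  \<comment> \<open>The weight needs room to decay between \<open>2 * r\<close> and
    \<open>\<rho>1\<close>, and lattice steps need room between \<open>\<rho>1\<close> and
    \<open>\<rho>\<close>; the midpoint leaves both.\<close>
  define \<rho>1 where "\<rho>1 = (2 * r + \<rho>) / 2"
  define c where "c = nat \<lceil>\<rho>1 * sqrt m / (2 * r)\<rceil>"
  define \<delta> where "\<delta> J = 2 * r / (sqrt m * real J)" for J :: nat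
  define d where "d = (\<rho>1\<^sup>2 - 4 * r\<^sup>2) / 2"
  define K where "K = real m * (r + \<rho> / 2) * (d + 2 * (2 * \<rho> + 1)\<^sup>2) * (c ^ m / d\<^sup>2)"
  have \<rho>1: "2 * r < \<rho>1" "\<rho>1 < \<rho>" using \<rho> by (auto simp: \<rho>1_def)
  have sm: "sqrt m > 0" using m by simp
  have q: "\<rho>1 * sqrt m / (2 * r) > 0" using \<rho>1 r sm by simp
  then have c: "c \<ge> 1" unfolding c_def by linarith
  have "\<rho>1 * sqrt m / (2 * r) \<le> c" unfolding c_def using q by linarith
  then have c2: "\<rho>1 * sqrt m \<le> 2 * r * c" using r by (simp add: field_simps)
  have lim: "\<delta> \<longlonglongrightarrow> 0"
  proof -
    have "(\<lambda>J. (2 * r / sqrt m) * (1 / real J)) \<longlonglongrightarrow> (2 * r / sqrt m) * 0"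
      by (intro tendsto_mult tendsto_const lim_1_over_n)
    then show ?thesis by (simp add: \<delta>_def[abs_def])
  qed
  have limk: "(\<lambda>J. \<kappa> * (\<delta> J)\<^sup>2) \<longlonglongrightarrow> \<kappa> * 0\<^sup>2" by (intro tendsto_intros lim)
  have ev: "eventually (\<lambda>J. \<delta> J < 1) sequentially" "eventually (\<lambda>J. \<delta> J < \<rho> - \<rho>1) sequentially"
    "eventually (\<lambda>J. \<kappa> * (\<delta> J)\<^sup>2 < 1) sequentially"
    using order_tendstoD(2)[OF lim] order_tendstoD(2)[OF limk] \<rho>1 by auto
  have "eventually (\<lambda>J. real m / 2 - K * \<delta> J \<le> sqrt (\<kappa> + \<kappa>\<^sup>2 * (\<delta> J)\<^sup>2) * S) sequentially"
    using ev eventually_ge_at_top[of 1]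
  proof eventually_elim
    case (elim J)
    have \<delta>0: "\<delta> J > 0" using elim r sm by (simp add: \<delta>_def)
    define x where "x = \<kappa> * (\<delta> J)\<^sup>2"
    have x: "0 \<le> x" "x \<le> 1" using \<kappa> elim by (auto simp: x_def)
    \<comment> \<open>This bound on \<open>[0, 1]\<close> is sharp enough in the limit and lets
      \<open>\<delta>\<close> be factored out of the square root.\<close>
    have "exp x - 1 \<le> x + x\<^sup>2" using exp_bound[OF x] by simp
    also have "\<dots> = (\<delta> J)\<^sup>2 * (\<kappa> + \<kappa>\<^sup>2 * (\<delta> J)\<^sup>2)" by (simp add: x_def power2_eq_square algebra_simps)
    finally have "sqrt (exp x - 1) \<le> sqrt ((\<delta> J)\<^sup>2 * (\<kappa> + \<kappa>\<^sup>2 * (\<delta> J)\<^sup>2))"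
      by (rule real_sqrt_le_mono)
    then have "sqrt (exp x - 1) \<le> \<delta> J * sqrt (\<kappa> + \<kappa>\<^sup>2 * (\<delta> J)\<^sup>2)"
      using \<delta>0 by (simp add: real_sqrt_mult)
    then have e: "sqrt (exp x - 1) * S \<le> \<delta> J * sqrt (\<kappa> + \<kappa>\<^sup>2 * (\<delta> J)\<^sup>2) * S"
      using S by (intro mult_right_mono)
    have "real m / 2 * \<delta> J - K * (\<delta> J)\<^sup>2 \<le> sqrt (exp x - 1) * S"
      unfolding K_def d_def
    proof (rule lattice_step[OF m r \<rho>1(1) _ c c2 _ _ _ bias])
      show "(\<Sum>i<m. g (\<theta>(i := \<theta> i + \<delta> J)) i - g \<theta> i) \<le> sqrt (exp x - 1) * S"
        if "(\<Sum>i<m. (\<theta> i)\<^sup>2) \<le> \<rho>\<^sup>2"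
          "\<And>i. i < m \<Longrightarrow> (\<Sum>j<m. ((\<theta>(i := \<theta> i + \<delta> J)) j)\<^sup>2) \<le> \<rho>\<^sup>2" for \<theta>
        unfolding x_def using that by (rule incr[OF \<delta>0])
    qed (use elim in \<open>auto simp: \<delta>_def\<close>)
    with e have "\<delta> J * (real m / 2 - K * \<delta> J) \<le> \<delta> J * (sqrt (\<kappa> + \<kappa>\<^sup>2 * (\<delta> J)\<^sup>2) * S)"
      by (simp add: algebra_simps power2_eq_square)
    then show ?case using \<delta>0 by simp
  qed
  moreover have "(\<lambda>J. real m / 2 - K * \<delta> J) \<longlonglongrightarrow> real m / 2 - K * 0"
    by (intro tendsto_intros lim)
  moreover have "(\<lambda>J. sqrt (\<kappa> + \<kappa>\<^sup>2 * (\<delta> J)\<^sup>2) * S) \<longlonglongrightarrow> sqrt (\<kappa> + \<kappa>\<^sup>2 * 0\<^sup>2) * S"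
    by (intro tendsto_intros lim)
  ultimately have "real m / 2 - K * 0 \<le> sqrt (\<kappa> + \<kappa>\<^sup>2 * 0\<^sup>2) * S"
    by (intro tendsto_le[OF sequentially_bot]) auto
  then show ?thesis by simp
qed

section \<open>Chi-square domination of measures\<close>

text \<open>Equivalently, \<open>Q\<close> has a density with respect to \<open>P\<close> and the chi-square divergence of \<open>Q\<close>
  from \<open>P\<close> is at most \<open>C - 1\<close>.\<close>

definition chi_dominated :: "'a measure \<Rightarrow> 'a measure \<Rightarrow> real \<Rightarrow> bool" where
  "chi_dominated P Q C \<longleftrightarrow> sets P = sets Q \<and> C \<ge> 0 \<and>
     (\<forall>F\<in>borel_measurable P. (\<integral>\<^sup>+x. F x \<partial>Q)\<^sup>2 \<le> ennreal C * (\<integral>\<^sup>+x. (F x)\<^sup>2 \<partial>P))"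

lemma chi_dominatedD:
  "chi_dominated P Q C \<Longrightarrow> F \<in> borel_measurable P \<Longrightarrow> (\<integral>\<^sup>+x. F x \<partial>Q)\<^sup>2 \<le> ennreal C * (\<integral>\<^sup>+x. (F x)\<^sup>2 \<partial>P)"
  by (auto simp: chi_dominated_def)

lemma chi_dominated_mono:
  assumes "chi_dominated P Q C" "C \<le> D"
  shows "chi_dominated P Q D"
  unfolding chi_dominated_def
proof (intro conjI ballI)
  fix F :: "_ \<Rightarrow> ennreal" assume "F \<in> borel_measurable P"
  then have "(\<integral>\<^sup>+x. F x \<partial>Q)\<^sup>2 \<le> ennreal C * (\<integral>\<^sup>+x. (F x)\<^sup>2 \<partial>P)" by (rule chi_dominatedD[OF assms(1)])
  also have "\<dots> \<le> ennreal D * (\<integral>\<^sup>+x. (F x)\<^sup>2 \<partial>P)" by (intro mult_right_mono ennreal_leI assms) simp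
  finally show "(\<integral>\<^sup>+x. F x \<partial>Q)\<^sup>2 \<le> ennreal D * (\<integral>\<^sup>+x. (F x)\<^sup>2 \<partial>P)" .
qed (use assms in \<open>auto simp: chi_dominated_def\<close>)

text \<open>Completing the square: \<open>2 * (x - \<nu>)\<^sup>2 - (x - \<mu>)\<^sup>2\<close>
  equals \<open>(x - (2 * \<nu> - \<mu>))\<^sup>2 - 2 * (\<nu> - \<mu>)\<^sup>2\<close>. The density
  with the reflected mean has integral 1, so the exponential factor is the second moment of the
  likelihood ratio.\<close>

lemma normal_density_sq_over:
  assumes "\<sigma> > 0"
  shows "(normal_density \<nu> \<sigma> x)\<^sup>2 / normal_density \<mu> \<sigma> x = exp ((\<nu> - \<mu>)\<^sup>2 / \<sigma>\<^sup>2) * normal_density (2 * \<nu> - \<mu>) \<sigma> x"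
proof -
  have e: "2 * (-(x - \<nu>)\<^sup>2 / (2 * \<sigma>\<^sup>2)) - (-(x - \<mu>)\<^sup>2 / (2 * \<sigma>\<^sup>2))
      = (\<nu> - \<mu>)\<^sup>2 / \<sigma>\<^sup>2 + (-(x - (2 * \<nu> - \<mu>))\<^sup>2 / (2 * \<sigma>\<^sup>2))"
    using assms by (simp add: field_simps power2_eq_square)
  define s where "s = sqrt (2 * pi * \<sigma>\<^sup>2)"
  have s: "s > 0" using assms by (simp add: s_def)
  have "(normal_density \<nu> \<sigma> x)\<^sup>2 / normal_density \<mu> \<sigma> x
    = 1 / s * (exp (2 * (-(x - \<nu>)\<^sup>2 / (2 * \<sigma>\<^sup>2))) / exp (-(x - \<mu>)\<^sup>2 / (2 * \<sigma>\<^sup>2)))"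
  proof -
    have "(1 / s * exp u)\<^sup>2 / (1 / s * exp v) = 1 / s * (exp (2 * u) / exp v)" for u v
      using s by (simp add: exp_double power_mult_distrib power_divide power2_eq_square)
    then show ?thesis unfolding normal_density_def s_def[symmetric] .
  qed
  also have "\<dots> = exp ((\<nu> - \<mu>)\<^sup>2 / \<sigma>\<^sup>2) * normal_density (2 * \<nu> - \<mu>) \<sigma> x"
    unfolding normal_density_def s_def[symmetric] exp_diff[symmetric] e exp_add by simp
  finally show ?thesis .
qed

text \<open>Cauchy-Schwarz after writing the density as \<open>q = sqrt p * (q / sqrt p)\<close>;
  the square of the second factor is what \<open>normal_density_sq_over\<close> computes.\<close>

lemma chi_dominated_normal:
  assumes \<sigma>: "\<sigma> > 0"
  shows "chi_dominated (density lborel (normal_density \<mu> \<sigma>)) (density lborel (normal_density \<nu> \<sigma>))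
           (exp ((\<nu> - \<mu>)\<^sup>2 / \<sigma>\<^sup>2))"
  unfolding chi_dominated_def
proof (intro conjI ballI)
  fix F :: "real \<Rightarrow> ennreal"
  assume "F \<in> borel_measurable (density lborel (\<lambda>x. ennreal (normal_density \<mu> \<sigma> x)))"
  then have F [measurable]: "F \<in> borel_measurable borel" by simp
  define p q where "p = normal_density \<mu> \<sigma>" and "q = normal_density \<nu> \<sigma>"
  have [measurable]: "p \<in> borel_measurable borel" "q \<in> borel_measurable borel" by (auto simp: p_def q_def)
  have p: "p x > 0" and q: "q x > 0" for x using normal_density_pos[OF \<sigma>] by (auto simp: p_def q_def)
  have "(\<integral>\<^sup>+x. F x \<partial>density lborel q)\<^sup>2 = (\<integral>\<^sup>+x. (F x * ennreal (sqrt (p x))) * ennreal (q x / sqrt (p x)) \<partial>lborel)\<^sup>2"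
  proof -
    have "ennreal (q x) = ennreal (sqrt (p x)) * ennreal (q x / sqrt (p x))" for x
      using p[of x] q[of x] by (simp add: ennreal_mult[symmetric] less_imp_le)
    then show ?thesis by (subst nn_integral_density) (auto simp: mult_ac)
  qed
  also have "\<dots> \<le> (\<integral>\<^sup>+x. (F x * ennreal (sqrt (p x)))\<^sup>2 \<partial>lborel) * (\<integral>\<^sup>+x. (ennreal (q x / sqrt (p x)))\<^sup>2 \<partial>lborel)"
    by (intro Cauchy_Schwarz_nn_integral) auto
  also have "(\<integral>\<^sup>+x. (F x * ennreal (sqrt (p x)))\<^sup>2 \<partial>lborel) = (\<integral>\<^sup>+x. (F x)\<^sup>2 \<partial>density lborel p)"
    using p by (subst nn_integral_density)
      (auto simp: power_mult_distrib ennreal_power less_imp_le mult.commute)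
  also have "(\<integral>\<^sup>+x. (ennreal (q x / sqrt (p x)))\<^sup>2 \<partial>lborel)
     = (\<integral>\<^sup>+x. ennreal (exp ((\<nu> - \<mu>)\<^sup>2 / \<sigma>\<^sup>2)) * ennreal (normal_density (2 * \<nu> - \<mu>) \<sigma> x) \<partial>lborel)"
    using p q normal_density_sq_over[OF \<sigma>, of \<nu> _ \<mu>]
    by (intro nn_integral_cong) (simp add: ennreal_power power_divide less_imp_le ennreal_mult[symmetric] p_def q_def)
  also have "\<dots> = ennreal (exp ((\<nu> - \<mu>)\<^sup>2 / \<sigma>\<^sup>2)) * (\<integral>\<^sup>+x. ennreal (normal_density (2 * \<nu> - \<mu>) \<sigma> x) \<partial>lborel)"
    by (rule nn_integral_cmult) auto
  also have "(\<integral>\<^sup>+x. ennreal (normal_density (2 * \<nu> - \<mu>) \<sigma> x) \<partial>lborel) = 1"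
    using \<sigma> by (subst nn_integral_eq_integral) (auto)
  finally show "(\<integral>\<^sup>+x. F x \<partial>density lborel (normal_density \<nu> \<sigma>))\<^sup>2
      \<le> ennreal (exp ((\<nu> - \<mu>)\<^sup>2 / \<sigma>\<^sup>2)) * (\<integral>\<^sup>+x. (F x)\<^sup>2 \<partial>density lborel (normal_density \<mu> \<sigma>))"
    by (simp add: p_def q_def mult.commute)
qed auto

lemma chi_dominated_distr:
  assumes "chi_dominated P Q C" and f: "f \<in> measurable P N"
  shows "chi_dominated (distr P N f) (distr Q N f) C"
  unfolding chi_dominated_def
proof (intro conjI ballI)
  have fQ: "f \<in> measurable Q N" using assms by (simp add: chi_dominated_def cong: measurable_cong_sets)
  fix F :: "_ \<Rightarrow> ennreal" assume "F \<in> borel_measurable (distr P N f)"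
  then have F [measurable]: "F \<in> borel_measurable N" by simp
  show "(\<integral>\<^sup>+x. F x \<partial>distr Q N f)\<^sup>2 \<le> ennreal C * (\<integral>\<^sup>+x. (F x)\<^sup>2 \<partial>distr P N f)"
    using chi_dominatedD[OF assms(1) measurable_compose[OF f F]] f fQ by (simp add: nn_integral_distr)
qed (use assms in \<open>auto simp: chi_dominated_def\<close>)

text \<open>Tensorisation, one coordinate at a time: the induction hypothesis is applied to the
  partial integral \<open>G\<close> and the one-coordinate inequality to its square. Constants
  multiply, so Gaussian exponents add up over the coordinates.\<close>

lemma chi_dominated_PiM:
  fixes P Q :: "'i \<Rightarrow> 'a measure"
  assumes I: "finite I" and P: "\<And>i. prob_space (P i)" and Q: "\<And>i. prob_space (Q i)"
    and C: "\<And>i. i \<in> I \<Longrightarrow> chi_dominated (P i) (Q i) (C i)"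
    and s: "\<And>i. sets (P i) = sets (Q i)"
  shows "chi_dominated (PiM I P) (PiM I Q) (\<Prod>i\<in>I. C i)"
  using I C
proof (induction I rule: finite_induct)
  case empty
  show ?case by (simp add: chi_dominated_def PiM_empty nn_integral_count_space_finite)
next
  case (insert i I)
  interpret P: product_sigma_finite P
    by (intro product_sigma_finite.intro prob_space_imp_sigma_finite P)
  interpret Q: product_sigma_finite Q
    by (intro product_sigma_finite.intro prob_space_imp_sigma_finite Q)
  have IH: "chi_dominated (PiM I P) (PiM I Q) (\<Prod>i\<in>I. C i)" using insert by auto
  have Ci: "chi_dominated (P i) (Q i) (C i)" using insert by auto
  have sI: "sets (PiM J P) = sets (PiM J Q)" for J using s by (intro sets_PiM_cong) auto
  have C0: "C i \<ge> 0" "(\<Prod>i\<in>I. C i) \<ge> 0" using IH Ci by (auto simp: chi_dominated_def)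
  show ?case unfolding chi_dominated_def
  proof (intro conjI ballI)
    show "sets (PiM (insert i I) P) = sets (PiM (insert i I) Q)" by (rule sI)
    show "(\<Prod>i\<in>insert i I. C i) \<ge> 0" using insert C0 by simp
    fix F :: "_ \<Rightarrow> ennreal" assume F: "F \<in> borel_measurable (PiM (insert i I) P)"
    then have FQ: "F \<in> borel_measurable (PiM (insert i I) Q)" using sI by (simp cong: measurable_cong_sets)
    have upd: "(\<lambda>(x, y). x(i := y)) \<in> PiM I P \<Otimes>\<^sub>M P i \<rightarrow>\<^sub>M PiM (insert i I) P"
      by measurable
    have meas: "(\<lambda>(x, y). F (x(i := y))) \<in> borel_measurable (PiM I P \<Otimes>\<^sub>M P i)"
      using measurable_compose[OF upd F] by (simp add: case_prod_beta)
    then have measQ: "(\<lambda>(x, y). F (x(i := y))) \<in> borel_measurable (PiM I P \<Otimes>\<^sub>M Q i)"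
      using s by (simp cong: measurable_cong_sets sets_pair_measure_cong)
    have meas2: "(\<lambda>(x, y). (F (x(i := y)))\<^sup>2) \<in> borel_measurable (PiM I P \<Otimes>\<^sub>M P i)"
      using meas by (simp add: case_prod_beta)
    define G where "G x = (\<integral>\<^sup>+y. F (x(i := y)) \<partial>Q i)" for x
    have G: "G \<in> borel_measurable (PiM I P)"
      unfolding G_def using sigma_finite_measure.borel_measurable_nn_integral[OF prob_space_imp_sigma_finite[OF Q] measQ] by simp
    have Gx: "(G x)\<^sup>2 \<le> ennreal (C i) * (\<integral>\<^sup>+y. (F (x(i := y)))\<^sup>2 \<partial>P i)" if "x \<in> space (PiM I P)" for x
      unfolding G_def using that meas
      by (intro chi_dominatedD[OF Ci]) (auto dest: measurable_Pair2)
    have "(\<integral>\<^sup>+x. F x \<partial>PiM (insert i I) Q)\<^sup>2 = (\<integral>\<^sup>+x. G x \<partial>PiM I Q)\<^sup>2"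
      unfolding G_def using insert FQ by (subst Q.product_nn_integral_insert) auto
    also have "\<dots> \<le> ennreal (\<Prod>i\<in>I. C i) * (\<integral>\<^sup>+x. (G x)\<^sup>2 \<partial>PiM I P)"
      by (rule chi_dominatedD[OF IH G])
    also have "\<dots> \<le> ennreal (\<Prod>i\<in>I. C i) * (\<integral>\<^sup>+x. ennreal (C i) * (\<integral>\<^sup>+y. (F (x(i := y)))\<^sup>2 \<partial>P i) \<partial>PiM I P)"
      by (intro mult_left_mono nn_integral_mono Gx) auto
    also have "\<dots> = ennreal (\<Prod>i\<in>I. C i) * (ennreal (C i) * (\<integral>\<^sup>+x. (\<integral>\<^sup>+y. (F (x(i := y)))\<^sup>2 \<partial>P i) \<partial>PiM I P))"
      using sigma_finite_measure.borel_measurable_nn_integral[OF prob_space_imp_sigma_finite[OF P] meas2] by (subst nn_integral_cmult) auto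
    also have "(\<integral>\<^sup>+x. (\<integral>\<^sup>+y. (F (x(i := y)))\<^sup>2 \<partial>P i) \<partial>PiM I P) = (\<integral>\<^sup>+x. (F x)\<^sup>2 \<partial>PiM (insert i I) P)"
      using insert F by (subst P.product_nn_integral_insert) auto
    finally show "(\<integral>\<^sup>+x. F x \<partial>PiM (insert i I) Q)\<^sup>2
        \<le> ennreal (\<Prod>i\<in>insert i I. C i) * (\<integral>\<^sup>+x. (F x)\<^sup>2 \<partial>PiM (insert i I) P)"
      using insert C0 by (simp add: ennreal_mult mult_ac)
  qed
qed

section \<open>From a generating algebra to the \<sigma>-algebra\<close>

lemma finite_measure_UN_tail:
  assumes "finite_measure P" and A: "range A \<subseteq> sets P" and e: "(e::real) > 0"
  shows "eventually (\<lambda>N. measure P ((\<Union>i. A i) - (\<Union>i<N. A i)) < e) sequentially"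
proof -
  interpret finite_measure P by fact
  define B where "B N = (\<Union>i<N. A i)" for N
  have B: "range B \<subseteq> sets P" "incseq B" "(\<Union>N. B N) = (\<Union>i. A i)"
    using A unfolding B_def incseq_def by (blast intro: sets.finite_UN, force, blast)
  have "(\<lambda>N. measure P (B N)) \<longlonglongrightarrow> measure P (\<Union>i. A i)"
    using finite_Lim_measure_incseq[OF B(1,2)] B(3) by simp
  then have "eventually (\<lambda>N. measure P (\<Union>i. A i) - e < measure P (B N)) sequentially"
    using e by (intro order_tendstoD) auto
  moreover have "measure P ((\<Union>i. A i) - B N) = measure P (\<Union>i. A i) - measure P (B N)" for N
    using B A by (intro finite_measure_Diff) auto
  ultimately show ?thesis by (auto simp: B_def[symmetric] elim: eventually_mono)
qed

text \<open>Induction over the generation of the \<sigma>-algebra. One set \<open>B\<close> has to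
  serve both measures, as the inequality to be transferred evaluates the same set under
  \<open>P\<close> and under \<open>Q\<close>.\<close>

lemma approximate_by_algebra:
  assumes alg: "algebra \<Omega> \<A>" and P: "finite_measure P" and Q: "finite_measure Q"
    and sP: "sets P = sigma_sets \<Omega> \<A>" and sQ: "sets Q = sigma_sets \<Omega> \<A>"
    and A: "A \<in> sets P" and e: "(e::real) > 0"
  shows "\<exists>B\<in>\<A>. measure P (A - B \<union> (B - A)) < e \<and> measure Q (A - B \<union> (B - A)) < e"
proof -
  interpret algebra \<Omega> \<A> by fact
  interpret P: finite_measure P by fact
  interpret Q: finite_measure Q by fact
  have "A \<in> sigma_sets \<Omega> \<A>" using A sP by simp
  then show ?thesis using e
  proof (induction arbitrary: e rule: sigma_sets.induct)
    case (Basic a)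
    then show ?case by (intro bexI[of _ a]) auto
  next
    case Empty
    then show ?case by (intro bexI[of _ "{}"]) auto
  next
    case (Compl a)
    then obtain B where B: "B \<in> \<A>" "measure P (a - B \<union> (B - a)) < e" "measure Q (a - B \<union> (B - a)) < e"
      by blast
    have "a \<subseteq> \<Omega>" using sigma_sets_into_sp[OF space_closed Compl.hyps] .
    moreover have "B \<subseteq> \<Omega>" using B space_closed by auto
    ultimately have "\<Omega> - a - (\<Omega> - B) \<union> (\<Omega> - B - (\<Omega> - a)) = a - B \<union> (B - a)" by auto
    with B show ?case by (intro bexI[of _ "\<Omega> - B"]) auto
  next
    case (Union a)
    have ra: "range a \<subseteq> sets P" "range a \<subseteq> sets Q" using Union.hyps sP sQ by auto
    have "eventually (\<lambda>N. measure P ((\<Union>i. a i) - (\<Union>i<N. a i)) < e / 2 \<and>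
        measure Q ((\<Union>i. a i) - (\<Union>i<N. a i)) < e / 2) sequentially"
      using Union.prems by (intro eventually_conj finite_measure_UN_tail P Q ra) auto
    then obtain N where N: "measure P ((\<Union>i. a i) - (\<Union>i<N. a i)) < e / 2"
        "measure Q ((\<Union>i. a i) - (\<Union>i<N. a i)) < e / 2"
      by (auto simp: eventually_sequentially)
    \<comment> \<open>Half of the tolerance is shared among the first \<open>N\<close> sets;
      \<open>N + 1\<close> keeps the quotient meaningful for \<open>N = 0\<close>.\<close>
    define c where "c = e / (2 * (real N + 1))"
    have c: "c > 0" using Union.prems by (simp add: c_def)
    have "\<exists>B\<in>\<A>. measure P (a i - B \<union> (B - a i)) < c \<and> measure Q (a i - B \<union> (B - a i)) < c" for i
      using Union.IH c by blast
    then obtain B where B: "\<And>i. B i \<in> \<A>" "\<And>i. measure P (a i - B i \<union> (B i - a i)) < c"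
       "\<And>i. measure Q (a i - B i \<union> (B i - a i)) < c"
      by metis
    have BU: "(\<Union>i<N. B i) \<in> \<A>" using B by (intro finite_UN) auto
    have mB: "B i \<in> sigma_sets \<Omega> \<A>" for i using B by auto
    have *: "measure R ((\<Union>i. a i) - (\<Union>i<N. B i) \<union> ((\<Union>i<N. B i) - (\<Union>i. a i))) < e"
      if "finite_measure R" "sets R = sigma_sets \<Omega> \<A>"
        "measure R ((\<Union>i. a i) - (\<Union>i<N. a i)) < e / 2" "\<And>i. measure R (a i - B i \<union> (B i - a i)) < c" for R
    proof -
      interpret R: finite_measure R by fact
      have ma: "a i \<in> sets R" "B i \<in> sets R" for i using Union.hyps mB that(2) by auto
      \<comment> \<open>The discarded tail and the \<open>N\<close> individual errors together cover
        the symmetric difference of the two unions.\<close>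
      have "measure R ((\<Union>i. a i) - (\<Union>i<N. B i) \<union> ((\<Union>i<N. B i) - (\<Union>i. a i)))
         \<le> measure R (((\<Union>i. a i) - (\<Union>i<N. a i)) \<union> (\<Union>i<N. a i - B i \<union> (B i - a i)))"
        using ma by (intro R.finite_measure_mono) (auto intro!: sets.Un sets.Diff sets.countable_UN)
      also have "\<dots> \<le> measure R ((\<Union>i. a i) - (\<Union>i<N. a i)) + measure R (\<Union>i<N. a i - B i \<union> (B i - a i))"
        using ma by (intro measure_Un_le) (auto intro!: sets.Un sets.Diff sets.countable_UN)
      also have "measure R (\<Union>i<N. a i - B i \<union> (B i - a i)) \<le> (\<Sum>i<N. measure R (a i - B i \<union> (B i - a i)))"
        using ma by (intro R.finite_measure_subadditive_finite) auto
      also have "\<dots> \<le> (\<Sum>i<N. c)" using that(4) by (intro sum_mono less_imp_le)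
      also have "\<dots> \<le> e / 2" using Union.prems by (simp add: c_def field_simps)
      finally show ?thesis using that(3) by simp
    qed
    show ?case
      using *[OF P sP N(1) B(2)] *[OF Q sQ N(2) B(3)] BU by blast
  qed
qed

text \<open>Each \<open>A v\<close> is replaced by a nearby set of the algebra. The functions are
  bounded by the sum \<open>S\<close> of the coefficients, so an error \<open>e\<close> in the sets
  changes the integral of the function and that of its square by at most a multiple of
  \<open>e\<close>, and \<open>e\<close> tends to 0.\<close>

lemma chi_dominated_sets:
  assumes alg: "algebra \<Omega> \<A>" and P: "prob_space P" and Q: "prob_space Q"
    and sP: "sets P = sigma_sets \<Omega> \<A>" and sQ: "sets Q = sigma_sets \<Omega> \<A>" and C: "C \<ge> 0"
    and cyl: "\<And>B. (\<And>v. v \<in> V \<Longrightarrow> B v \<in> \<A>) \<Longrightarrow>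
      (\<integral>\<^sup>+x. (\<Sum>v\<in>V. ennreal v * indicator (B v) x) \<partial>Q)\<^sup>2
        \<le> ennreal C * (\<integral>\<^sup>+x. (\<Sum>v\<in>V. ennreal v * indicator (B v) x)\<^sup>2 \<partial>P)"
    and V: "finite V" "\<And>v. v \<in> V \<Longrightarrow> 0 \<le> v" and A: "\<And>v. v \<in> V \<Longrightarrow> A v \<in> sets P"
  shows "(\<integral>\<^sup>+x. (\<Sum>v\<in>V. ennreal v * indicator (A v) x) \<partial>Q)\<^sup>2
        \<le> ennreal C * (\<integral>\<^sup>+x. (\<Sum>v\<in>V. ennreal v * indicator (A v) x)\<^sup>2 \<partial>P)"
proof -
  interpret algebra \<Omega> \<A> by fact
  interpret P: prob_space P by fact
  interpret Q: prob_space Q by fact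
  define S where "S = (\<Sum>v\<in>V. v)"
  define Fr where "Fr B x = (\<Sum>v\<in>V. v * indicator (B v) x)" for B :: "real \<Rightarrow> 'a set" and x
  have S: "S \<ge> 0" using V by (auto simp: S_def intro: sum_nonneg)
  have sPQ: "sets Q = sets P" using sP sQ by simp
  have F_bounds: "0 \<le> Fr B x" "Fr B x \<le> S" for B x
  proof -
    show "0 \<le> Fr B x" unfolding Fr_def using V by (intro sum_nonneg mult_nonneg_nonneg) auto
    show "Fr B x \<le> S" unfolding Fr_def S_def
    proof (rule sum_mono)
      fix v assume "v \<in> V"
      then show "v * indicator (B v) x \<le> v" using V(2) by (cases "x \<in> B v") auto
    qed
  qed
  have F_enn: "(\<Sum>v\<in>V. ennreal v * indicator (B v) x) = ennreal (Fr B x)" for B x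
  proof -
    have "ennreal v * indicator (B v) x = ennreal (v * indicator (B v) x)" for v
      by (cases "x \<in> B v") auto
    then show ?thesis unfolding Fr_def using V by (subst sum_ennreal[symmetric]) auto
  qed
  have Fm: "Fr B \<in> borel_measurable P" "Fr B \<in> borel_measurable Q" if "\<And>v. v \<in> V \<Longrightarrow> B v \<in> sets P" for B
    unfolding Fr_def[abs_def] using that sPQ by (auto intro!: borel_measurable_sum borel_measurable_times borel_measurable_indicator)
  have intQ: "integrable Q (Fr B)" "(\<integral>x. Fr B x \<partial>Q) = (\<Sum>v\<in>V. v * measure Q (B v))"
    if B: "\<And>v. v \<in> V \<Longrightarrow> B v \<in> sets P" for B
    unfolding Fr_def[abs_def] using B sPQ sets.sets_into_space[of _ Q] by (auto simp: Q.emeasure_finite less_top[symmetric] Int_absorb2 intro!: sum.cong)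
  have intP: "integrable P (\<lambda>x. (Fr B x)\<^sup>2)" if B: "\<And>v. v \<in> V \<Longrightarrow> B v \<in> sets P" for B
  proof (rule P.integrable_const_bound[of _ "S\<^sup>2"])
    show "AE x in P. norm ((Fr B x)\<^sup>2) \<le> S\<^sup>2" using F_bounds by (auto intro!: power_mono)
    show "(\<lambda>x. (Fr B x)\<^sup>2) \<in> borel_measurable P" using Fm(1)[OF B] by simp
  qed
  have lhs: "(\<integral>\<^sup>+x. (\<Sum>v\<in>V. ennreal v * indicator (B v) x) \<partial>Q)\<^sup>2 = ennreal ((\<integral>x. Fr B x \<partial>Q)\<^sup>2)"
    if B: "\<And>v. v \<in> V \<Longrightarrow> B v \<in> sets P" for B
    using F_bounds by (simp add: F_enn nn_integral_eq_integral[OF intQ(1)[OF B]] ennreal_power)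
  have rhs: "(\<integral>\<^sup>+x. (\<Sum>v\<in>V. ennreal v * indicator (B v) x)\<^sup>2 \<partial>P) = ennreal (\<integral>x. (Fr B x)\<^sup>2 \<partial>P)"
    if B: "\<And>v. v \<in> V \<Longrightarrow> B v \<in> sets P" for B
    using F_bounds by (simp add: F_enn ennreal_power nn_integral_eq_integral[OF intP[OF B]])
  define X where "X = (\<integral>x. Fr A x \<partial>Q)"
  define I where "I = (\<integral>x. (Fr A x)\<^sup>2 \<partial>P)"
  have I: "I \<ge> 0" by (simp add: I_def)
  have X: "X \<ge> 0" using F_bounds by (simp add: X_def)
  have bound: "X \<le> S * e + sqrt (C * (I + 2 * S\<^sup>2 * e))" if e: "e > 0" for e
  proof -
    have "\<forall>v\<in>V. \<exists>B\<in>\<A>. measure P (A v - B \<union> (B - A v)) < e \<and> measure Q (A v - B \<union> (B - A v)) < e"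
      using approximate_by_algebra[OF alg P.finite_measure_axioms Q.finite_measure_axioms sP sQ A e] by blast
    then obtain B where B: "\<And>v. v \<in> V \<Longrightarrow> B v \<in> \<A>"
      "\<And>v. v \<in> V \<Longrightarrow> measure P (A v - B v \<union> (B v - A v)) < e"
      "\<And>v. v \<in> V \<Longrightarrow> measure Q (A v - B v \<union> (B v - A v)) < e" by metis
    have BP: "B v \<in> sets P" if "v \<in> V" for v using B(1)[OF that] sP by auto
    define E where "E v = A v - B v \<union> (B v - A v)" for v
    have EP: "E v \<in> sets P" if "v \<in> V" for v using A[OF that] BP[OF that] by (auto simp: E_def)
    have diff: "\<bar>Fr A x - Fr B x\<bar> \<le> Fr E x" for x
    proof -
      have "\<bar>Fr A x - Fr B x\<bar> = \<bar>\<Sum>v\<in>V. v * (indicator (A v) x - indicator (B v) x)\<bar>"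
        by (simp add: Fr_def sum_subtractf right_diff_distrib)
      also have "\<dots> \<le> (\<Sum>v\<in>V. \<bar>v * (indicator (A v) x - indicator (B v) x)\<bar>)" by (rule sum_abs)
      also have "\<dots> \<le> Fr E x" unfolding Fr_def using V
        by (intro sum_mono) (auto simp: E_def abs_mult indicator_def)
      finally show ?thesis .
    qed
    have EE: "(\<Sum>v\<in>V. v * measure R (E v)) \<le> S * e" if "\<And>v. v \<in> V \<Longrightarrow> measure R (E v) < e" for R
      unfolding S_def sum_distrib_right using V that
      by (intro sum_mono mult_left_mono) (auto intro: less_imp_le)
    have "X \<le> (\<integral>x. Fr B x + Fr E x \<partial>Q)"
      unfolding X_def using diff intQ A BP EP
      by (intro integral_mono Bochner_Integration.integrable_add) (auto simp: abs_le_iff algebra_simps)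
    also have "\<dots> = (\<integral>x. Fr B x \<partial>Q) + (\<Sum>v\<in>V. v * measure Q (E v))"
      using intQ BP EP by simp
    also have "\<dots> \<le> (\<integral>x. Fr B x \<partial>Q) + S * e" using EE[of Q] B(3) by (simp add: E_def)
    finally have 1: "X \<le> (\<integral>x. Fr B x \<partial>Q) + S * e" .
    have "(\<integral>x. (Fr B x)\<^sup>2 \<partial>P) \<le> (\<integral>x. (Fr A x)\<^sup>2 + 2 * S * Fr E x \<partial>P)"
    proof (intro integral_mono Bochner_Integration.integrable_add intP A BP integrable_mult_right)
      show "integrable P (Fr E)"
        using Fm(1)[of E] EP F_bounds by (intro P.integrable_const_bound[of _ S]) auto
      fix x
      \<comment> \<open>On values between 0 and \<open>S\<close> squaring is Lipschitz with constant
        \<open>2 * S\<close>.\<close>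
      have "(Fr B x)\<^sup>2 - (Fr A x)\<^sup>2 = (Fr B x - Fr A x) * (Fr B x + Fr A x)"
        by (simp add: power2_eq_square algebra_simps)
      also have "\<dots> \<le> \<bar>Fr B x - Fr A x\<bar> * \<bar>Fr B x + Fr A x\<bar>" by (metis abs_ge_self abs_mult)
      also have "\<dots> \<le> Fr E x * (2 * S)"
        using diff[of x] F_bounds[of A x] F_bounds[of B x] F_bounds[of E x] by (intro mult_mono) auto
      finally show "(Fr B x)\<^sup>2 \<le> (Fr A x)\<^sup>2 + 2 * S * Fr E x" by (simp add: algebra_simps)
    qed
    also have "\<dots> = I + 2 * S * (\<integral>x. Fr E x \<partial>P)"
    proof -
      have "integrable P (Fr E)"
        using Fm(1)[of E] EP F_bounds by (intro P.integrable_const_bound[of _ S]) auto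
      then show ?thesis using intP[OF A] by (simp add: I_def)
    qed
    also have "(\<integral>x. Fr E x \<partial>P) = (\<Sum>v\<in>V. v * measure P (E v))"
      unfolding Fr_def[abs_def] using EP sets.sets_into_space[of _ P]
      by (auto simp: P.emeasure_finite less_top[symmetric] Int_absorb2 intro!: sum.cong)
    also have "I + 2 * S * (\<Sum>v\<in>V. v * measure P (E v)) \<le> I + 2 * S * (S * e)"
      using EE[of P] B(2) S by (intro add_left_mono mult_left_mono) (auto simp: E_def)
    finally have 2: "(\<integral>x. (Fr B x)\<^sup>2 \<partial>P) \<le> I + 2 * S\<^sup>2 * e" by (simp add: power2_eq_square mult_ac)
    have "ennreal ((\<integral>x. Fr B x \<partial>Q)\<^sup>2) \<le> ennreal C * ennreal (\<integral>x. (Fr B x)\<^sup>2 \<partial>P)"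
      using cyl[of B] B(1) lhs[OF BP] rhs[OF BP] by simp
    then have "(\<integral>x. Fr B x \<partial>Q)\<^sup>2 \<le> C * (\<integral>x. (Fr B x)\<^sup>2 \<partial>P)"
      using C by (simp add: ennreal_mult'[symmetric] ennreal_le_iff)
    also have "\<dots> \<le> C * (I + 2 * S\<^sup>2 * e)" using C 2 by (rule mult_left_mono[rotated])
    finally have "(\<integral>x. Fr B x \<partial>Q) \<le> sqrt (C * (I + 2 * S\<^sup>2 * e))" by (rule real_le_rsqrt)
    with 1 show ?thesis by simp
  qed
  have "((\<lambda>e. S * e + sqrt (C * (I + 2 * S\<^sup>2 * e))) \<longlongrightarrow> S * 0 + sqrt (C * (I + 2 * S\<^sup>2 * 0))) (at_right 0)"
    by (intro tendsto_intros)
  moreover have "eventually (\<lambda>e. X \<le> S * e + sqrt (C * (I + 2 * S\<^sup>2 * e))) (at_right 0)"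
    using eventually_at_right_less[of "0::real"] by (rule eventually_mono) (rule bound)
  ultimately have "X \<le> S * 0 + sqrt (C * (I + 2 * S\<^sup>2 * 0))"
    by (rule tendsto_lowerbound) simp
  then have "X \<le> sqrt (C * I)" by simp
  then have "X\<^sup>2 \<le> (sqrt (C * I))\<^sup>2" using X by (intro power_mono)
  then have "X\<^sup>2 \<le> C * I" using I C by simp
  then have "ennreal (X\<^sup>2) \<le> ennreal C * ennreal I" using C by (simp add: ennreal_mult'[symmetric] ennreal_leI)
  then show ?thesis using lhs[of A] rhs[of A] A by (simp add: X_def I_def)
qed

text \<open>Monotone approximation by finite-valued simple functions, whose level sets fall under
  \<open>chi_dominated_sets\<close>. The level sets are indexed by the values themselves.\<close>

lemma chi_dominated_generator:
  assumes alg: "algebra \<Omega> \<A>" and P: "prob_space P" and Q: "prob_space Q"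
    and sP: "sets P = sigma_sets \<Omega> \<A>" and sQ: "sets Q = sigma_sets \<Omega> \<A>" and C: "C \<ge> 0"
    and cyl: "\<And>V B. finite V \<Longrightarrow> (\<And>v. v \<in> V \<Longrightarrow> 0 \<le> v \<and> B v \<in> \<A>) \<Longrightarrow>
      (\<integral>\<^sup>+x. (\<Sum>v\<in>V. ennreal v * indicator (B v) x) \<partial>Q)\<^sup>2
        \<le> ennreal C * (\<integral>\<^sup>+x. (\<Sum>v\<in>V. ennreal v * indicator (B v) x)\<^sup>2 \<partial>P)"
  shows "chi_dominated P Q C"
  unfolding chi_dominated_def
proof (intro conjI ballI)
  have sPQ: "sets Q = sets P" using sP sQ by simp
  fix F :: "'a \<Rightarrow> ennreal" assume F: "F \<in> borel_measurable P"
  obtain U where U: "\<And>i. simple_function P (U i)" "incseq U" "\<And>i x. U i x < top" "\<And>x. (SUP i. U i x) = F x"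
    using borel_measurable_implies_simple_function_sequence'[OF F] by (metis top.not_eq_extremum)
  have step: "(\<integral>\<^sup>+x. U i x \<partial>Q)\<^sup>2 \<le> ennreal C * (\<integral>\<^sup>+x. (F x)\<^sup>2 \<partial>P)" for i
  proof -
    define V where "V = enn2real ` U i ` space P"
    define A where "A v = U i -` {ennreal v} \<inter> space P" for v
    \<comment> \<open>All values are finite, so \<open>enn2real\<close> loses nothing and the sum
      over the range can be reindexed by reals.\<close>
    have inj: "inj_on enn2real (U i ` space P)"
      using U(3)[of i] by (intro inj_onI) (metis ennreal_enn2real imageE)
    have V: "finite V" "\<And>v. v \<in> V \<Longrightarrow> 0 \<le> v"
      using U(1)[of i] by (auto simp: V_def simple_function_def)
    have A: "A v \<in> sets P" for v
      unfolding A_def using U(1)[of i] by (rule simple_functionD)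
    have rep: "U i x = (\<Sum>v\<in>V. ennreal v * indicator (A v) x)" if "x \<in> space P" for x
    proof -
      have "U i x = (\<Sum>y\<in>U i ` space P. y * indicator (U i -` {y} \<inter> space P) x)"
        by (rule simple_function_indicator_representation[OF U(1) that])
      also have "\<dots> = (\<Sum>y\<in>U i ` space P. ennreal (enn2real y) * indicator (A (enn2real y)) x)"
        using U(3)[of i] by (intro sum.cong) (auto simp: A_def)
      also have "\<dots> = (\<Sum>v\<in>V. ennreal v * indicator (A v) x)"
        unfolding V_def by (subst sum.reindex[OF inj]) simp
      finally show ?thesis .
    qed
    have "(\<integral>\<^sup>+x. U i x \<partial>Q) = (\<integral>\<^sup>+x. (\<Sum>v\<in>V. ennreal v * indicator (A v) x) \<partial>Q)"
      using rep sets_eq_imp_space_eq[OF sPQ] by (intro nn_integral_cong) auto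
    then have "(\<integral>\<^sup>+x. U i x \<partial>Q)\<^sup>2 \<le> ennreal C * (\<integral>\<^sup>+x. (\<Sum>v\<in>V. ennreal v * indicator (A v) x)\<^sup>2 \<partial>P)"
      using chi_dominated_sets[OF alg P Q sP sQ C, of V A] cyl[of V] V A by simp
    also have "(\<integral>\<^sup>+x. (\<Sum>v\<in>V. ennreal v * indicator (A v) x)\<^sup>2 \<partial>P) = (\<integral>\<^sup>+x. (U i x)\<^sup>2 \<partial>P)"
      using rep by (intro nn_integral_cong) auto
    also have "\<dots> \<le> (\<integral>\<^sup>+x. (F x)\<^sup>2 \<partial>P)"
      unfolding U(4)[symmetric] by (intro nn_integral_mono power_mono SUP_upper) auto
    finally show ?thesis by (simp add: mult_left_mono)
  qed
  define a where "a i = (\<integral>\<^sup>+x. U i x \<partial>Q)" for i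
  have "incseq a" using U(2) by (auto simp: a_def incseq_def le_fun_def intro!: nn_integral_mono)
  have "(\<integral>\<^sup>+x. F x \<partial>Q) = (SUP i. a i)"
    unfolding a_def U(4)[symmetric] using U(1,2) sPQ
    by (intro nn_integral_monotone_convergence_SUP)
       (auto dest!: borel_measurable_simple_function cong: measurable_cong_sets)
  \<comment> \<open>The square of the supremum becomes a double supremum, which monotonicity reduces
    to its diagonal.\<close>
  then have "(\<integral>\<^sup>+x. F x \<partial>Q)\<^sup>2 = (SUP i. SUP j. a i * a j)"
    by (simp add: power2_eq_square SUP_mult_left_ennreal SUP_mult_right_ennreal) (rule SUP_commute)
  also have "\<dots> \<le> ennreal C * (\<integral>\<^sup>+x. (F x)\<^sup>2 \<partial>P)"
  proof (intro SUP_least)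
    fix i j
    have "a i * a j \<le> (a (max i j))\<^sup>2"
      unfolding power2_eq_square using \<open>incseq a\<close> by (intro mult_mono) (auto simp: incseq_def)
    also have "\<dots> \<le> ennreal C * (\<integral>\<^sup>+x. (F x)\<^sup>2 \<partial>P)" unfolding a_def by (rule step)
    finally show "a i * a j \<le> ennreal C * (\<integral>\<^sup>+x. (F x)\<^sup>2 \<partial>P)" .
  qed
  finally show "(\<integral>\<^sup>+x. F x \<partial>Q)\<^sup>2 \<le> ennreal C * (\<integral>\<^sup>+x. (F x)\<^sup>2 \<partial>P)" .
qed (use sP sQ C in auto)

section \<open>Square-integrable functions on intervals\<close>

text \<open>\<open>|t| \<le> 1 + t\<^sup>2\<close>, and the constant 1 is integrable because the
  interval has finite length.\<close>

lemma L2_on_integrable: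
  assumes "L2_on {a..b} f"
  shows "set_integrable lborel {a..b} f"
proof -
  have m: "(\<lambda>x. indicator {a..b} x *\<^sub>R f x) \<in> borel_measurable lborel"
    using assms by (simp add: L2_on_def set_borel_measurable_def)
  have i2: "integrable lborel (\<lambda>x. indicator {a..b} x *\<^sub>R (f x)\<^sup>2)"
    using assms by (simp add: L2_on_def set_integrable_def)
  have i1: "integrable lborel (\<lambda>x. indicator {a..b} x :: real)"
    by (simp add: emeasure_lborel_Icc_eq)
  show ?thesis unfolding set_integrable_def
  proof (rule Bochner_Integration.integrable_bound[OF Bochner_Integration.integrable_add[OF i1 i2] m])
    have "\<bar>t\<bar> \<le> 1 + t\<^sup>2" for t :: real
    proof (cases "\<bar>t\<bar> \<le> 1")
      case False
      then have "\<bar>t\<bar> * 1 \<le> \<bar>t\<bar> * \<bar>t\<bar>" by (intro mult_left_mono) auto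
      then show ?thesis by (simp add: power2_eq_square)
    qed (simp add: add_increasing2)
    then show "AE x in lborel. norm (indicator {a..b} x *\<^sub>R f x)
        \<le> norm (indicator {a..b} x + indicator {a..b} x *\<^sub>R (f x)\<^sup>2)"
      by (intro AE_I2) (auto simp: indicator_def)
  qed
qed

lemma L2_on_subset:
  assumes "L2_on A f" "B \<subseteq> A" "B \<in> sets borel"
  shows "L2_on B f"
  using assms unfolding L2_on_def
  by (auto intro: set_integrable_subset set_borel_measurable_subset)

lemma L2_on_diff:
  assumes "L2_on {a..b} f" "L2_on {a..b} g"
  shows "L2_on {a..b} (\<lambda>x. f x - g x)"
proof -
  have m: "(\<lambda>x. indicator {a..b} x *\<^sub>R f x) \<in> borel_measurable lborel"
          "(\<lambda>x. indicator {a..b} x *\<^sub>R g x) \<in> borel_measurable lborel"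
    using assms by (simp_all add: L2_on_def set_borel_measurable_def)
  have i2: "integrable lborel (\<lambda>x. indicator {a..b} x *\<^sub>R (f x)\<^sup>2)"
           "integrable lborel (\<lambda>x. indicator {a..b} x *\<^sub>R (g x)\<^sup>2)"
    using assms by (simp_all add: L2_on_def set_integrable_def)
  have m': "(\<lambda>x. indicator {a..b} x *\<^sub>R (f x - g x)) \<in> borel_measurable lborel"
    using borel_measurable_diff[OF m] by (simp add: right_diff_distrib)
  have m2: "(\<lambda>x. indicator {a..b} x *\<^sub>R (f x - g x)\<^sup>2) \<in> borel_measurable lborel"
  proof -
    have "(\<lambda>x. indicator {a..b} x *\<^sub>R (f x - g x)\<^sup>2) = (\<lambda>x. (indicator {a..b} x *\<^sub>R (f x - g x))\<^sup>2)"
      by (auto simp: indicator_def)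
    then show ?thesis using m' by simp
  qed
  have "integrable lborel (\<lambda>x. indicator {a..b} x *\<^sub>R (f x - g x)\<^sup>2)"
  proof (rule Bochner_Integration.integrable_bound[OF integrable_mult_right[OF Bochner_Integration.integrable_add[OF i2], of 2] m2])
    have "(s - t)\<^sup>2 \<le> 2 * (s\<^sup>2 + t\<^sup>2)" for s t :: real
    proof -
      have "2 * (s\<^sup>2 + t\<^sup>2) - (s - t)\<^sup>2 = (s + t)\<^sup>2" by (simp add: power2_eq_square algebra_simps)
      then show ?thesis by (metis diff_ge_0_iff_ge zero_le_power2)
    qed
    then show "AE x in lborel. norm (indicator {a..b} x *\<^sub>R (f x - g x)\<^sup>2)
        \<le> norm (2 * (indicator {a..b} x *\<^sub>R (f x)\<^sup>2 + indicator {a..b} x *\<^sub>R (g x)\<^sup>2))"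
      by (intro AE_I2) (auto simp: indicator_def)
  qed
  with m' show ?thesis by (simp add: L2_on_def set_integrable_def set_borel_measurable_def)
qed

text \<open>The integral of \<open>(u x - c)\<^sup>2\<close> with \<open>c\<close> the mean of
  \<open>u\<close> is nonnegative. Summed over a partition, it bounds the squared drifts of the
  increments over their lengths independently of the partition.\<close>

lemma integral_sq_le:
  fixes u :: "real \<Rightarrow> real"
  assumes u: "L2_on {s..t} u" and st: "s < t"
  shows "(LINT x:{s..t}|lborel. u x)\<^sup>2 / (t - s) \<le> (LINT x:{s..t}|lborel. (u x)\<^sup>2)"
proof -
  define c where "c = (LINT x:{s..t}|lborel. u x) / (t - s)"
  have i: "set_integrable lborel {s..t} u" "set_integrable lborel {s..t} (\<lambda>x. (u x)\<^sup>2)"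
    using L2_on_integrable[OF u] u by (auto simp: L2_on_def)
  have i1: "set_integrable lborel {s..t} (\<lambda>x. c\<^sup>2)"
    by (simp add: set_integrable_def emeasure_lborel_Icc_eq)
  have "0 \<le> (LINT x:{s..t}|lborel. (u x - c)\<^sup>2)"
    unfolding set_lebesgue_integral_def by (intro integral_nonneg_AE) auto
  also have "\<dots> = (LINT x:{s..t}|lborel. (u x)\<^sup>2 + c\<^sup>2 - 2 * c * u x)"
    by (simp add: power2_diff mult_ac)
  also have "\<dots> = (LINT x:{s..t}|lborel. (u x)\<^sup>2) + (LINT x:{s..t}|lborel. c\<^sup>2) - 2 * c * (LINT x:{s..t}|lborel. u x)"
    using i i1 by (simp add: set_integral_diff set_integral_add set_integral_mult_right)
  also have "(LINT x:{s..t}|lborel. c\<^sup>2) = c\<^sup>2 * (t - s)"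
    using st by (simp add: set_lebesgue_integral_def measure_def mult.commute)
  also have "c\<^sup>2 * (t - s) = (LINT x:{s..t}|lborel. u x)\<^sup>2 / (t - s)"
    using st by (simp add: c_def power2_eq_square)
  also have "2 * c * (LINT x:{s..t}|lborel. u x) = 2 * ((LINT x:{s..t}|lborel. u x)\<^sup>2 / (t - s))"
    by (simp add: c_def power2_eq_square)
  finally show ?thesis by simp
qed

lemma set_integral_Icc_split:
  fixes f :: "real \<Rightarrow> real"
  assumes "set_integrable lborel {a..c} f" "a \<le> b" "b \<le> c"
  shows "(LINT x:{a..c}|lborel. f x) = (LINT x:{a..b}|lborel. f x) + (LINT x:{b..c}|lborel. f x)"
proof -
  have "set_integrable lborel {a..b} f" "set_integrable lborel {b..c} f"
    using assms by (auto intro: set_integrable_subset)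
  then show ?thesis
    using assms set_borel_integral_eq_integral[of _ f]
      Henstock_Kurzweil_Integration.integral_combine[of a b c f] by simp
qed

lemma sum_set_integral_partition:
  fixes f :: "real \<Rightarrow> real"
  assumes "set_integrable lborel {\<tau> 0..\<tau> k} f" "\<And>i. i < k \<Longrightarrow> \<tau> i \<le> \<tau> (Suc i)"
  shows "(\<Sum>i<k. LINT x:{\<tau> i..\<tau> (Suc i)}|lborel. f x) = (LINT x:{\<tau> 0..\<tau> k}|lborel. f x)"
  using assms
proof (induction k)
  case 0
  \<comment> \<open>The empty sum is compared with an integral over one point, a null set.\<close>
  have "AE x in lborel. x \<notin> {\<tau> 0}" by (rule AE_lborel_singleton[THEN AE_mp]) auto
  then have "(LINT x:{\<tau> 0..\<tau> 0}|lborel. f x) = 0"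
  proof -
    have "AE x in lborel. indicator {\<tau> 0..\<tau> 0} x *\<^sub>R f x = 0"
      using \<open>AE x in lborel. x \<notin> {\<tau> 0}\<close> by (rule eventually_mono) auto
    then show ?thesis unfolding set_lebesgue_integral_def by (rule integral_eq_zero_AE)
  qed
  then show ?case by simp
next
  case (Suc k)
  have "\<tau> 0 \<le> \<tau> i" if "i \<le> k" for i
    using that
  proof (induction i)
    case (Suc i)
    then show ?case using Suc.prems \<open>\<And>i. i < Suc k \<Longrightarrow> \<tau> i \<le> \<tau> (Suc i)\<close>[of i] by simp
  qed simp
  then have le: "\<tau> 0 \<le> \<tau> k" "\<tau> k \<le> \<tau> (Suc k)" using Suc.prems by auto
  have "set_integrable lborel {\<tau> 0..\<tau> k} f"
    using Suc.prems(1) le by (auto intro: set_integrable_subset)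
  then show ?case using Suc set_integral_Icc_split[OF Suc.prems(1) le] by simp
qed

lemma continuous_indefinite_integral:
  fixes f :: "real \<Rightarrow> real"
  assumes "set_integrable lborel {a..b} f"
  shows "continuous_on {a..b} (\<lambda>x. LINT t:{a..x}|lborel. f t)"
proof -
  have "continuous_on {a..b} (\<lambda>x. integral {a..x} f)"
    using set_borel_integral_eq_integral(1)[OF assms] by (rule indefinite_integral_continuous_1)
  moreover have "integral {a..x} f = (LINT t:{a..x}|lborel. f t)" if "x \<in> {a..b}" for x
    using that by (intro set_borel_integral_eq_integral(2)[symmetric] set_integrable_subset[OF assms]) auto
  ultimately show ?thesis by (rule continuous_on_eq)
qed

section \<open>Chi-square domination in the white noise model\<close>

lemma white_noise_data_measurable:
  assumes bm: "standard_brownian_motion M W" and f: "set_integrable lborel {0..1} f"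
  shows "white_noise_data W n f \<in> measurable M path_space"
proof -
  have W: "\<And>t. t \<in> {0..1} \<Longrightarrow> W t \<in> borel_measurable M"
    and Wc: "\<And>\<omega>. \<omega> \<in> space M \<Longrightarrow> continuous_on {0..1} (\<lambda>t. W t \<omega>)"
    using bm by (auto simp: standard_brownian_motion_def)
  show ?thesis unfolding path_space_def
  proof (rule measurable_restrict_space2)
    show "white_noise_data W n f \<in> space M \<rightarrow> {y. continuous_on {0..1} y}"
    proof
      fix \<omega> assume "\<omega> \<in> space M"
      then have "continuous_on {0..1} (\<lambda>x. (LINT t:{0..x}|lborel. f t) + real n powr (-1/2) * W x \<omega>)"
        by (intro continuous_intros continuous_indefinite_integral[OF f] Wc)
      then have "continuous_on {0..1} (white_noise_data W n f \<omega>)"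
        by (rule continuous_on_eq) (simp add: white_noise_data_def)
      then show "white_noise_data W n f \<omega> \<in> {y. continuous_on {0..1} y}" by simp
    qed
    show "white_noise_data W n f \<in> M \<rightarrow>\<^sub>M (\<Pi>\<^sub>M x\<in>{0..1}. borel)"
      unfolding white_noise_data_def[abs_def] using W by (intro measurable_restrict) simp
  qed
qed

lemma white_noise_increment:
  assumes f: "set_integrable lborel {0..1} f" and st: "0 \<le> s" "s \<le> t" "t \<le> 1"
  shows "white_noise_data W n f \<omega> t - white_noise_data W n f \<omega> s
       = (LINT x:{s..t}|lborel. f x) + real n powr (-1/2) * (W t \<omega> - W s \<omega>)"
proof -
  have "set_integrable lborel {0..t} f" using f st by (auto intro: set_integrable_subset)
  from set_integral_Icc_split[OF this st(1,2)] show ?thesis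
    using st by (simp add: white_noise_data_def algebra_simps)
qed

text \<open>The drift shifts the means, and independence turns the joint law into a product.
  Strictly increasing times keep every standard deviation positive, so the normal densities are not
  degenerate.\<close>

lemma white_noise_increments_law:
  assumes bm: "standard_brownian_motion M W" and f: "set_integrable lborel {0..1} f" and n: "n \<ge> 1"
    and \<tau>: "0 \<le> \<tau> 0" "\<And>i. i < k \<Longrightarrow> \<tau> i < \<tau> (Suc i)" "\<tau> k \<le> 1" and k: "k \<ge> 1"
  shows "distr M (\<Pi>\<^sub>M i\<in>{..<k}. borel)
      (\<lambda>\<omega>. \<lambda>i\<in>{..<k}. white_noise_data W n f \<omega> (\<tau> (Suc i)) - white_noise_data W n f \<omega> (\<tau> i))
    = (\<Pi>\<^sub>M i\<in>{..<k}. density lborel (normal_density (LINT x:{\<tau> i..\<tau> (Suc i)}|lborel. f x)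
         (real n powr (-1/2) * sqrt (\<tau> (Suc i) - \<tau> i))))"
proof -
  interpret prob_space M using bm by (simp add: standard_brownian_motion_def)
  define c where "c = real n powr (-1/2)"
  have c: "c > 0" using n by (simp add: c_def)
  have \<tau>m: "\<tau> i \<le> \<tau> j" if "i \<le> j" "j \<le> k" for i j
    using that
  proof (induction j rule: dec_induct)
    case (step j) then show ?case using \<tau>(2)[of j] by simp
  qed simp
  have \<tau>b: "0 \<le> \<tau> i" "\<tau> i \<le> 1" if "i \<le> k" for i
    using \<tau>m[of 0 i] \<tau>m[of i k] \<tau> that by auto
  define Z where "Z i \<omega> = W (\<tau> (Suc i)) \<omega> - W (\<tau> i) \<omega>" for i \<omega>
  define \<mu> where "\<mu> i = (LINT x:{\<tau> i..\<tau> (Suc i)}|lborel. f x)" for i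
  define X where "X i \<omega> = \<mu> i + c * Z i \<omega>" for i \<omega>
  have X: "white_noise_data W n f \<omega> (\<tau> (Suc i)) - white_noise_data W n f \<omega> (\<tau> i) = X i \<omega>" if "i < k" for i \<omega>
    unfolding X_def \<mu>_def Z_def c_def using that \<tau>b[of i] \<tau>b[of "Suc i"] \<tau>(2)[of i]
    by (intro white_noise_increment[OF f]) auto
  have indZ: "indep_vars (\<lambda>_. borel) Z {..<k}"
    unfolding Z_def[abs_def] using bm \<tau> by (auto simp: standard_brownian_motion_def less_imp_le)
  then have indX: "indep_vars (\<lambda>_. borel) X {..<k}"
    unfolding X_def[abs_def] by (rule indep_vars_compose2) auto
  have rv: "random_variable borel (X i)" if "i \<in> {..<k}" for i
    using indX that by (auto simp: indep_vars_def)
  have dX: "distr M borel (X i) = density lborel (normal_density (\<mu> i) (c * sqrt (\<tau> (Suc i) - \<tau> i)))" if "i < k" for i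
  proof -
    have "distributed M lborel (Z i) (normal_density 0 (sqrt (\<tau> (Suc i) - \<tau> i)))"
      unfolding Z_def[abs_def] using bm that \<tau>b[of i] \<tau>b[of "Suc i"] \<tau>(2)[of i]
      by (auto simp: standard_brownian_motion_def)
    then have "distributed M lborel (X i) (normal_density (\<mu> i + c * 0) (\<bar>c\<bar> * sqrt (\<tau> (Suc i) - \<tau> i)))"
      unfolding X_def[abs_def] using c \<tau>(2)[OF that] by (intro normal_density_affine) auto
    then have "distr M lborel (X i) = density lborel (normal_density (\<mu> i) (c * sqrt (\<tau> (Suc i) - \<tau> i)))"
      using c by (simp add: distributed_distr_eq_density)
    then show ?thesis by (metis distr_cong sets_lborel)
  qed
  have "distr M (\<Pi>\<^sub>M i\<in>{..<k}. borel)
      (\<lambda>\<omega>. \<lambda>i\<in>{..<k}. white_noise_data W n f \<omega> (\<tau> (Suc i)) - white_noise_data W n f \<omega> (\<tau> i))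
     = distr M (\<Pi>\<^sub>M i\<in>{..<k}. borel) (\<lambda>\<omega>. \<lambda>i\<in>{..<k}. X i \<omega>)"
    using X by (intro distr_cong) (auto simp: restrict_def fun_eq_iff)
  also have "\<dots> = (\<Pi>\<^sub>M i\<in>{..<k}. distr M borel (X i))"
  proof -
    have "{..<k} \<noteq> {}" using k by (auto simp: lessThan_empty_iff)
    then show ?thesis using indep_vars_iff_distr_eq_PiM'[where I = "{..<k}" and M' = "\<lambda>_. borel" and X = X] indX rv by auto
  qed
  also have "\<dots> = (\<Pi>\<^sub>M i\<in>{..<k}. density lborel (normal_density (\<mu> i) (c * sqrt (\<tau> (Suc i) - \<tau> i))))"
    using dX by (intro PiM_cong) auto
  finally show ?thesis by (simp add: \<mu>_def c_def)
qed

text \<open>An increment has variance \<open>(\<tau> (Suc i) - \<tau> i) / n\<close>, so its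
  exponent is \<open>n\<close> times the squared drift difference over the length of the interval.
  By \<open>integral_sq_le\<close> and additivity of the integral these sum to a bound that no
  longer depends on the partition.\<close>

lemma chi_dominated_increments:
  assumes bm: "standard_brownian_motion M W" and f: "L2_on {0..1} f" and g: "L2_on {0..1} g" and n: "n \<ge> 1"
    and \<tau>: "\<tau> 0 = 0" "\<And>i. i < k \<Longrightarrow> \<tau> i < \<tau> (Suc i)" "\<tau> k = 1" and k: "k \<ge> 1"
  defines "D \<equiv> \<lambda>f \<omega>. \<lambda>i\<in>{..<k}. white_noise_data W n f \<omega> (\<tau> (Suc i)) - white_noise_data W n f \<omega> (\<tau> i)"
  shows "chi_dominated (distr M (\<Pi>\<^sub>M i\<in>{..<k}. borel) (D f)) (distr M (\<Pi>\<^sub>M i\<in>{..<k}. borel) (D g))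
    (exp (real n * (LINT x:{0..1}|lborel. (g x - f x)\<^sup>2)))"
proof -
  \<comment> \<open>The value 1 beyond the partition makes \<open>N f i\<close> a probability
    measure for every index, as \<open>chi_dominated_PiM\<close> asks.\<close>
  define \<sigma> where "\<sigma> i = (if i < k then real n powr (-1/2) * sqrt (\<tau> (Suc i) - \<tau> i) else 1)" for i
  define \<mu> where "\<mu> f i = (LINT x:{\<tau> i..\<tau> (Suc i)}|lborel. f x)" for f :: "real \<Rightarrow> real" and i
  define N where "N f i = density lborel (normal_density (\<mu> f i) (\<sigma> i))" for f i
  have \<sigma>: "\<sigma> i > 0" for i using \<tau>(2) n by (simp add: \<sigma>_def)
  have fi: "set_integrable lborel {0..1} f" "set_integrable lborel {0..1} g"
    using f g by (auto intro: L2_on_integrable)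
  have law: "distr M (\<Pi>\<^sub>M i\<in>{..<k}. borel) (D h) = PiM {..<k} (N h)" if "set_integrable lborel {0..1} h" for h
  proof -
    have "0 \<le> \<tau> 0" "\<tau> k \<le> 1" using \<tau> by simp_all
    from white_noise_increments_law[OF bm that n this(1) \<tau>(2) this(2) k] show ?thesis
      unfolding D_def by (simp only:) (intro PiM_cong refl, simp add: N_def \<mu>_def \<sigma>_def)
  qed
  have \<tau>m: "\<tau> i \<le> \<tau> j" if "i \<le> j" "j \<le> k" for i j
    using that
  proof (induction j rule: dec_induct)
    case (step j) then show ?case using \<tau>(2)[of j] by simp
  qed simp
  have dom: "chi_dominated (PiM {..<k} (N f)) (PiM {..<k} (N g)) (\<Prod>i<k. exp ((\<mu> g i - \<mu> f i)\<^sup>2 / (\<sigma> i)\<^sup>2))"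
    unfolding N_def using \<sigma>
    by (intro chi_dominated_PiM chi_dominated_normal prob_space_normal_density) auto
  define u where "u = (\<lambda>x. g x - f x)"
  have u: "L2_on {0..1} u" unfolding u_def by (rule L2_on_diff[OF g f])
  have "(\<mu> g i - \<mu> f i)\<^sup>2 / (\<sigma> i)\<^sup>2 \<le> real n * (LINT x:{\<tau> i..\<tau> (Suc i)}|lborel. (u x)\<^sup>2)" if i: "i < k" for i
  proof -
    have sub: "{\<tau> i..\<tau> (Suc i)} \<subseteq> {0..1}"
      using \<tau>m[of 0 i] \<tau>m[of "Suc i" k] \<tau>(1,3) i by auto
    have "\<mu> g i - \<mu> f i = (LINT x:{\<tau> i..\<tau> (Suc i)}|lborel. u x)"
      unfolding \<mu>_def u_def using fi sub by (subst set_integral_diff) (auto intro: set_integrable_subset)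
    moreover have "(\<sigma> i)\<^sup>2 = (\<tau> (Suc i) - \<tau> i) / real n"
    proof -
      have "(real n powr (-1/2))\<^sup>2 = 1 / real n"
        using n by (simp add: powr_minus_divide powr_half_sqrt power_divide)
      then show ?thesis using i \<tau>(2)[OF i] by (simp add: \<sigma>_def power_mult_distrib)
    qed
    moreover have "(LINT x:{\<tau> i..\<tau> (Suc i)}|lborel. u x)\<^sup>2 / (\<tau> (Suc i) - \<tau> i) \<le> (LINT x:{\<tau> i..\<tau> (Suc i)}|lborel. (u x)\<^sup>2)"
      using L2_on_subset[OF u sub] \<tau>(2)[OF i] by (intro integral_sq_le) auto
    then have "real n * ((LINT x:{\<tau> i..\<tau> (Suc i)}|lborel. u x)\<^sup>2 / (\<tau> (Suc i) - \<tau> i)) \<le> real n * (LINT x:{\<tau> i..\<tau> (Suc i)}|lborel. (u x)\<^sup>2)"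
      by (rule mult_left_mono) simp
    ultimately show ?thesis by (simp add: mult_ac)
  qed
  then have "(\<Sum>i<k. (\<mu> g i - \<mu> f i)\<^sup>2 / (\<sigma> i)\<^sup>2) \<le> (\<Sum>i<k. real n * (LINT x:{\<tau> i..\<tau> (Suc i)}|lborel. (u x)\<^sup>2))"
    by (intro sum_mono) auto
  also have "\<dots> = real n * (LINT x:{0..1}|lborel. (u x)\<^sup>2)"
  proof -
    have "set_integrable lborel {\<tau> 0..\<tau> k} (\<lambda>x. (u x)\<^sup>2)" using u \<tau> by (simp add: L2_on_def)
    from sum_set_integral_partition[OF this] show ?thesis
      using \<tau> by (simp add: sum_distrib_left[symmetric] less_imp_le)
  qed
  finally have "(\<Prod>i<k. exp ((\<mu> g i - \<mu> f i)\<^sup>2 / (\<sigma> i)\<^sup>2)) \<le> exp (real n * (LINT x:{0..1}|lborel. (u x)\<^sup>2))"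
    by (simp add: exp_sum[symmetric])
  with dom show ?thesis unfolding law[OF fi(1)] law[OF fi(2)] u_def by (rule chi_dominated_mono)
qed

text \<open>Values at finitely many times are partial sums of increments, so the marginal is an
  image of the increment law under the measurable map \<open>\<phi>\<close>, and domination passes
  to images.\<close>

lemma chi_dominated_marginals:
  assumes bm: "standard_brownian_motion M W" and f: "L2_on {0..1} f" and g: "L2_on {0..1} g" and n: "n \<ge> 1"
    and J: "finite J" "J \<subseteq> {0..1}"
  shows "chi_dominated (distr M (\<Pi>\<^sub>M t\<in>J. borel) (\<lambda>\<omega>. restrict (white_noise_data W n f \<omega>) J))
     (distr M (\<Pi>\<^sub>M t\<in>J. borel) (\<lambda>\<omega>. restrict (white_noise_data W n g \<omega>) J))
    (exp (real n * (LINT x:{0..1}|lborel. (g x - f x)\<^sup>2)))"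
proof -
  \<comment> \<open>Adding 0 and 1 makes the sorted list a partition of the whole interval with at
    least one increment, even for empty \<open>J\<close>.\<close>
  define xs where "xs = sorted_list_of_set (insert 0 (insert 1 J))"
  define \<tau> where "\<tau> i = xs ! i" for i
  define k where "k = length xs - 1"
  have xs: "sorted_wrt (<) xs" "set xs = insert 0 (insert 1 J)"
    using J unfolding xs_def by (simp_all only: strict_sorted_list_of_set set_sorted_list_of_set finite_insert)
  have "card (set xs) = length xs" using xs(1) by (simp add: strict_sorted_iff distinct_card)
  moreover have "card {0, 1::real} \<le> card (set xs)" using J xs(2) by (intro card_mono) auto
  ultimately have len: "length xs \<ge> 2" by simp
  then have k: "k \<ge> 1" "length xs = Suc k" by (auto simp: k_def)
  have \<tau>2: "\<tau> i < \<tau> (Suc i)" if "i < k" for i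
    using sorted_wrt_nth_less[OF xs(1), of i "Suc i"] that k by (simp add: \<tau>_def)
  have mono: "\<tau> i \<le> \<tau> j" if "i \<le> j" "j \<le> k" for i j
    using sorted_wrt_nth_less[OF xs(1), of i j] that k by (cases "i = j") (auto simp: \<tau>_def)
  have range: "x \<in> {0..1}" if "x \<in> set xs" for x using that xs(2) J by auto
  have ex: "\<exists>i\<le>k. t = \<tau> i" if "t \<in> set xs" for t
    using that k by (metis \<tau>_def in_set_conv_nth less_Suc_eq_le)
  have \<tau>0: "\<tau> 0 = 0"
  proof -
    obtain i where "i \<le> k" "0 = \<tau> i" using ex[of 0] xs(2) by auto
    then have "\<tau> 0 \<le> 0" using mono[of 0 i] by simp
    moreover have "\<tau> 0 \<in> set xs" using k by (simp add: \<tau>_def)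
    then have "0 \<le> \<tau> 0" using range by simp
    ultimately show ?thesis by simp
  qed
  have \<tau>k: "\<tau> k = 1"
  proof -
    obtain i where "i \<le> k" "1 = \<tau> i" using ex[of 1] xs(2) by auto
    then have "1 \<le> \<tau> k" using mono[of i k] by simp
    moreover have "\<tau> k \<in> set xs" using k by (simp add: \<tau>_def)
    then have "\<tau> k \<le> 1" using range by simp
    ultimately show ?thesis by simp
  qed
  obtain idx where idx: "\<And>t. t \<in> J \<Longrightarrow> idx t \<le> k \<and> t = \<tau> (idx t)" using ex xs(2) by (metis insertCI)
  define \<phi> where "\<phi> d = (\<lambda>t\<in>J. \<Sum>i<idx t. d i)" for d :: "nat \<Rightarrow> real"
  have \<phi>: "\<phi> \<in> (\<Pi>\<^sub>M i\<in>{..<k}. borel) \<rightarrow>\<^sub>M (\<Pi>\<^sub>M t\<in>J. borel)"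
    unfolding \<phi>_def[abs_def] using idx
    by (intro measurable_restrict borel_measurable_sum measurable_component_singleton) fastforce
  define D where "D f \<omega> = (\<lambda>i\<in>{..<k}. white_noise_data W n f \<omega> (\<tau> (Suc i)) - white_noise_data W n f \<omega> (\<tau> i))" for f \<omega>
  have \<tau>J: "\<tau> i \<in> {0..1}" if "i \<le> k" for i using range that k by (simp add: \<tau>_def)
  have law: "distr M (\<Pi>\<^sub>M t\<in>J. borel) (\<lambda>\<omega>. restrict (white_noise_data W n h \<omega>) J)
      = distr (distr M (\<Pi>\<^sub>M i\<in>{..<k}. borel) (D h)) (\<Pi>\<^sub>M t\<in>J. borel) \<phi>" if h: "L2_on {0..1} h" for h
  proof -
    have Y: "white_noise_data W n h \<in> measurable M path_space"
      by (rule white_noise_data_measurable[OF bm L2_on_integrable[OF h]])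
    have ev: "(\<lambda>\<omega>. white_noise_data W n h \<omega> t) \<in> borel_measurable M" if "t \<in> {0..1}" for t
    proof (rule measurable_compose[OF Y])
      show "(\<lambda>y. y t) \<in> borel_measurable path_space"
        unfolding path_space_def using that by (intro measurable_restrict_space1 measurable_component_singleton)
    qed
    have Dm: "D h \<in> M \<rightarrow>\<^sub>M (\<Pi>\<^sub>M i\<in>{..<k}. borel)"
      unfolding D_def[abs_def] using \<tau>J by (intro measurable_restrict borel_measurable_diff ev) auto
    have "restrict (white_noise_data W n h \<omega>) J = \<phi> (D h \<omega>)" if "\<omega> \<in> space M" for \<omega>
    proof
      fix t
      \<comment> \<open>The data start at 0, so sums of increments recover the values and not merely
        their differences.\<close>
      have "white_noise_data W n h \<omega> 0 = 0"
      proof -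
        have "(LINT t:{0..0}|lborel. h t) = 0"
          using sum_set_integral_partition[of "\<lambda>_. 0" 0 h] L2_on_integrable[OF h]
          by (simp add: set_integrable_subset[of lborel "{0..1}" h "{0..0}"])
        moreover have "W 0 \<omega> = 0" using bm \<open>\<omega> \<in> space M\<close> by (simp add: standard_brownian_motion_def)
        ultimately show ?thesis by (simp add: white_noise_data_def)
      qed
      moreover have "(\<Sum>i<idx t. D h \<omega> i) = white_noise_data W n h \<omega> (\<tau> (idx t)) - white_noise_data W n h \<omega> (\<tau> 0)"
        if "t \<in> J"
      proof -
        have "(\<Sum>i<idx t. D h \<omega> i) = (\<Sum>i<idx t. white_noise_data W n h \<omega> (\<tau> (Suc i)) - white_noise_data W n h \<omega> (\<tau> i))"
          using idx[OF that] by (intro sum.cong) (auto simp: D_def)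
        also have "\<dots> = white_noise_data W n h \<omega> (\<tau> (idx t)) - white_noise_data W n h \<omega> (\<tau> 0)"
          by (rule sum_lessThan_telescope)
        finally show ?thesis .
      qed
      ultimately show "restrict (white_noise_data W n h \<omega>) J t = \<phi> (D h \<omega>) t"
        using idx[of t] \<tau>0 by (auto simp: \<phi>_def restrict_def)
    qed
    then show ?thesis
      using \<phi> Dm by (subst distr_distr) (auto intro!: distr_cong)
  qed
  have "chi_dominated (distr M (\<Pi>\<^sub>M i\<in>{..<k}. borel) (D f)) (distr M (\<Pi>\<^sub>M i\<in>{..<k}. borel) (D g))
    (exp (real n * (LINT x:{0..1}|lborel. (g x - f x)\<^sup>2)))"
    unfolding D_def by (rule chi_dominated_increments[OF bm f g n \<tau>0 \<tau>2 \<tau>k k(1)])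
  then show ?thesis unfolding law[OF f] law[OF g] using \<phi> by (intro chi_dominated_distr) simp_all
qed

section \<open>Cylinder sets and the law on path space\<close>

definition cylinders :: "(real \<Rightarrow> real) set set" where
  "cylinders = {{y \<in> space path_space. restrict y J \<in> B} | J B.
     finite J \<and> J \<subseteq> {0..1} \<and> B \<in> sets (\<Pi>\<^sub>M t\<in>J. borel)}"

lemma restrict_path_measurable:
  assumes "J \<subseteq> {0..1}"
  shows "(\<lambda>y. restrict y J) \<in> path_space \<rightarrow>\<^sub>M (\<Pi>\<^sub>M t\<in>J. borel)"
  unfolding path_space_def using assms by (intro measurable_restrict_space1 measurable_restrict_subset)

lemma cylindersI:
  "finite J \<Longrightarrow> J \<subseteq> {0..1} \<Longrightarrow> B \<in> sets (\<Pi>\<^sub>M t\<in>J. borel) \<Longrightarrow> {y \<in> space path_space. restrict y J \<in> B} \<in> cylinders"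
  unfolding cylinders_def by blast

text \<open>Cylinders over \<open>J\<close> and \<open>J'\<close> are brought to the common index
  set \<open>J \<union> J'\<close> by pulling their bases back along the restriction maps.\<close>

lemma algebra_cylinders: "algebra (space path_space) cylinders"
  unfolding algebra_iff_Un
proof (intro conjI ballI)
  show "cylinders \<subseteq> Pow (space path_space)" by (auto simp: cylinders_def)
  show "{} \<in> cylinders" using cylindersI[of "{}" "{}"] by simp
next
  fix a assume "a \<in> cylinders"
  then obtain J B where J: "finite J" "J \<subseteq> {0..1}" "B \<in> sets (\<Pi>\<^sub>M t\<in>J. (borel :: real measure))"
    "a = {y \<in> space path_space. restrict y J \<in> B}"
    by (auto simp: cylinders_def)
  have "space path_space - a = {y \<in> space path_space. restrict y J \<in> space (\<Pi>\<^sub>M t\<in>J. borel) - B}"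
    using measurable_space[OF restrict_path_measurable[OF J(2)]] by (auto simp: J(4))
  also have "\<dots> \<in> cylinders" using J by (intro cylindersI sets.compl_sets) auto
  finally show "space path_space - a \<in> cylinders" .
next
  fix a b assume "a \<in> cylinders" "b \<in> cylinders"
  then obtain J B J' B' where J: "finite J" "J \<subseteq> {0..1}" "B \<in> sets (\<Pi>\<^sub>M t\<in>J. (borel :: real measure))"
    "a = {y \<in> space path_space. restrict y J \<in> B}"
    and J': "finite J'" "J' \<subseteq> {0..1}" "B' \<in> sets (\<Pi>\<^sub>M t\<in>J'. (borel :: real measure))"
    "b = {y \<in> space path_space. restrict y J' \<in> B'}"
    by (auto simp: cylinders_def)
  let ?S = "\<Pi>\<^sub>M t\<in>J \<union> J'. (borel :: real measure)"
  define E where "E = ((\<lambda>z. restrict z J) -` B \<inter> space ?S) \<union> ((\<lambda>z. restrict z J') -` B' \<inter> space ?S)"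
  have E: "E \<in> sets ?S"
    unfolding E_def using J(3) J'(3)
    by (intro sets.Un measurable_sets[OF measurable_restrict_subset]) auto
  have "a \<union> b = {y \<in> space path_space. restrict y (J \<union> J') \<in> E}"
    using measurable_space[OF restrict_path_measurable[of "J \<union> J'"]] J(2) J'(2)
    by (auto simp: J(4) J'(4) E_def restrict_restrict Int_absorb1)
  also have "\<dots> \<in> cylinders" using J J' E by (intro cylindersI) auto
  finally show "a \<union> b \<in> cylinders" .
qed

text \<open>For the harder inclusion it is enough that the identity is measurable from the
  \<sigma>-algebra generated by the cylinders; this is checked on single evaluations, which yield
  cylinders over one time.\<close>

lemma sets_path_space: "sets path_space = sigma_sets (space path_space) cylinders"
proof
  show "sigma_sets (space path_space) cylinders \<subseteq> sets path_space"
  proof (rule sets.sigma_sets_subset, rule subsetI)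
    fix a assume "a \<in> cylinders"
    then obtain J B where J: "J \<subseteq> {0..1}" "B \<in> sets (\<Pi>\<^sub>M t\<in>J. (borel :: real measure))"
      "a = {y \<in> space path_space. restrict y J \<in> B}"
      by (auto simp: cylinders_def)
    have "a = (\<lambda>y. restrict y J) -` B \<inter> space path_space" by (auto simp: J(3))
    then show "a \<in> sets path_space" using measurable_sets[OF restrict_path_measurable[OF J(1)] J(2)] by simp
  qed
  define S where "S = sigma (space path_space) cylinders"
  have cyl: "cylinders \<subseteq> Pow (space path_space)" by (auto simp: cylinders_def)
  have S: "space S = space path_space" "sets S = sigma_sets (space path_space) cylinders"
    using cyl by (simp_all add: S_def)
  have "(\<lambda>y. y) \<in> S \<rightarrow>\<^sub>M path_space"
    unfolding path_space_def
  proof (rule measurable_restrict_space2)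
    show "(\<lambda>y. y) \<in> space S \<rightarrow> {y. continuous_on {0..1} y}"
      by (auto simp: S path_space_def space_restrict_space)
    show "(\<lambda>y. y) \<in> S \<rightarrow>\<^sub>M (\<Pi>\<^sub>M t\<in>{0..1}. (borel :: real measure))"
    proof (rule measurable_PiM_single)
      show "(\<lambda>y. y) \<in> space S \<rightarrow> (\<Pi>\<^sub>E t\<in>{0..1}. space borel)"
        by (auto simp: S path_space_def space_restrict_space space_PiM)
      fix A :: "real set" and t :: real assume A: "A \<in> sets borel" and t: "t \<in> {0..1}"
      let ?B = "{z \<in> space (\<Pi>\<^sub>M t\<in>{t}. (borel :: real measure)). z t \<in> A}"
      have "?B = (\<lambda>z. z t) -` A \<inter> space (\<Pi>\<^sub>M t\<in>{t}. (borel :: real measure))" by auto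
      moreover have c: "(\<lambda>z. z t) \<in> (\<Pi>\<^sub>M t\<in>{t}. (borel :: real measure)) \<rightarrow>\<^sub>M borel"
        by (intro measurable_component_singleton) simp
      ultimately have "?B \<in> sets (\<Pi>\<^sub>M t\<in>{t}. borel)"
        using measurable_sets[OF c A] by simp
      then have "{y \<in> space path_space. restrict y {t} \<in> ?B} \<in> cylinders"
        using t by (intro cylindersI) auto
      moreover have "{y \<in> space path_space. restrict y {t} \<in> ?B} = {y \<in> space S. y t \<in> A}"
        by (auto simp: S space_PiM)
      ultimately show "{y \<in> space S. y t \<in> A} \<in> sets S" by (auto simp: S)
    qed
  qed
  then show "sets path_space \<subseteq> sigma_sets (space path_space) cylinders"
    using measurable_sets[of "\<lambda>y. y" S path_space] sets.sets_into_space[of _ path_space]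
    by (auto simp: S Int_absorb2)
qed

text \<open>Finitely many cylinders depend on one finite set \<open>K\<close> of times, so the
  inequality for their combinations concerns a finite-dimensional marginal. The constant does not
  involve \<open>K\<close>, hence \<open>chi_dominated_generator\<close> extends it to all
  measurable functions of the path.\<close>

lemma chi_dominated_white_noise:
  assumes bm: "standard_brownian_motion M W" and f: "L2_on {0..1} f" and g: "L2_on {0..1} g" and n: "n \<ge> 1"
  shows "chi_dominated (white_noise_law M W n f) (white_noise_law M W n g)
    (exp (real n * (LINT x:{0..1}|lborel. (g x - f x)\<^sup>2)))"
proof (rule chi_dominated_generator[OF algebra_cylinders])
  interpret prob_space M using bm by (simp add: standard_brownian_motion_def)
  have Y: "white_noise_data W n h \<in> measurable M path_space" if "L2_on {0..1} h" for h
    by (rule white_noise_data_measurable[OF bm L2_on_integrable[OF that]])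
  show "prob_space (white_noise_law M W n f)" "prob_space (white_noise_law M W n g)"
    unfolding white_noise_law_def using Y f g by (auto intro: prob_space_distr)
  show "sets (white_noise_law M W n f) = sigma_sets (space path_space) cylinders"
    "sets (white_noise_law M W n g) = sigma_sets (space path_space) cylinders"
    by (simp_all add: white_noise_law_def sets_path_space)
  fix V :: "real set" and B
  assume V: "finite V" and B: "\<And>v. v \<in> V \<Longrightarrow> 0 \<le> v \<and> B v \<in> cylinders"
  define R where "R v J E \<longleftrightarrow> finite J \<and> J \<subseteq> {0..1} \<and> E \<in> sets (\<Pi>\<^sub>M t\<in>J. (borel :: real measure))
      \<and> B v = {y \<in> space path_space. restrict y J \<in> E}" for v J E
  have "\<exists>J E. R v J E" if "v \<in> V" for v
    using B[OF that] by (auto simp: cylinders_def R_def)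
  then obtain J E where "\<And>v. v \<in> V \<Longrightarrow> R v (J v) (E v)" by metis
  then have JE: "finite (J v)" "J v \<subseteq> {0..1}" "E v \<in> sets (\<Pi>\<^sub>M t\<in>J v. (borel :: real measure))"
      "B v = {y \<in> space path_space. restrict y (J v) \<in> E v}" if "v \<in> V" for v
    using that by (auto simp: R_def)
  define K where "K = (\<Union>v\<in>V. J v)"
  have K: "finite K" "K \<subseteq> {0..1}" "\<And>v. v \<in> V \<Longrightarrow> J v \<subseteq> K" using V JE by (auto simp: K_def)
  define G where "G z = (\<Sum>v\<in>V. ennreal v * indicator (E v) (restrict z (J v)))" for z :: "real \<Rightarrow> real"
  have G: "G \<in> borel_measurable (\<Pi>\<^sub>M t\<in>K. borel)"
    unfolding G_def[abs_def]
  proof (intro borel_measurable_sum)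
    fix v assume "v \<in> V"
    then have "(\<lambda>z. indicator (E v) (restrict z (J v)) :: ennreal) \<in> borel_measurable (\<Pi>\<^sub>M t\<in>K. borel)"
      by (intro measurable_compose[OF measurable_restrict_subset[OF K(3)] borel_measurable_indicator[OF JE(3)]])
    then show "(\<lambda>z. ennreal v * indicator (E v) (restrict z (J v))) \<in> borel_measurable (\<Pi>\<^sub>M t\<in>K. borel)"
      by simp
  qed
  define F where "F y = (\<Sum>v\<in>V. ennreal v * indicator (B v) y)" for y
  have FG: "F y = G (restrict y K)" if "y \<in> space path_space" for y
    unfolding F_def G_def using JE K that
    by (intro sum.cong) (auto simp: indicator_def restrict_restrict Int_absorb1)
  have F: "F \<in> borel_measurable path_space"
    using measurable_compose[OF restrict_path_measurable[OF K(2)] G] FG by (simp cong: measurable_cong)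
  have int: "(\<integral>\<^sup>+y. H (F y) \<partial>white_noise_law M W n h)
      = (\<integral>\<^sup>+z. H (G z) \<partial>distr M (\<Pi>\<^sub>M t\<in>K. borel) (\<lambda>\<omega>. restrict (white_noise_data W n h \<omega>) K))"
    if "L2_on {0..1} h" "H \<in> borel_measurable borel" for h and H :: "ennreal \<Rightarrow> ennreal"
    unfolding white_noise_law_def
    using that F G measurable_compose[OF Y[OF that(1)] restrict_path_measurable[OF K(2)]] Y[OF that(1)]
      measurable_space[OF Y[OF that(1)]] FG
    by (subst (1 2) nn_integral_distr) (auto intro!: nn_integral_cong)
  have "(\<integral>\<^sup>+y. F y \<partial>white_noise_law M W n g)\<^sup>2
      \<le> ennreal (exp (real n * (LINT x:{0..1}|lborel. (g x - f x)\<^sup>2))) * (\<integral>\<^sup>+y. (F y)\<^sup>2 \<partial>white_noise_law M W n f)"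
    using chi_dominatedD[OF chi_dominated_marginals[OF bm f g n K(1,2)], of G] G
      int[OF g, of "\<lambda>x. x"] int[OF f, of "\<lambda>x. x\<^sup>2"] by simp
  then show "(\<integral>\<^sup>+y. (\<Sum>v\<in>V. ennreal v * indicator (B v) y) \<partial>white_noise_law M W n g)\<^sup>2
      \<le> ennreal (exp (real n * (LINT x:{0..1}|lborel. (g x - f x)\<^sup>2))) *
        (\<integral>\<^sup>+y. (\<Sum>v\<in>V. ennreal v * indicator (B v) y)\<^sup>2 \<partial>white_noise_law M W n f)"
    by (simp add: F_def)
qed simp

section \<open>From chi-square domination to differences of means\<close>

text \<open>Domination applied to \<open>|X - p + s|\<close> gives
  \<open>(\<Delta> + s)\<^sup>2 \<le> C * (v + s\<^sup>2)\<close> for every real \<open>s\<close>.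
  With \<open>s = 0\<close> the factor would be \<open>C\<close>; the best shift improves it to
  \<open>C - 1\<close>, which tends to 0 as the two laws merge and so makes a bound on difference
  quotients possible.\<close>

lemma chi_dominated_variance:
  assumes P: "prob_space P" and Q: "prob_space Q" and PQ: "chi_dominated P Q C"
    and XP: "integrable P X" and XQ: "integrable Q X" and V: "ext_variance P X \<le> ennreal v" "v \<ge> 0"
    and C: "C \<ge> 1"
  shows "((\<integral>y. X y \<partial>Q) - (\<integral>y. X y \<partial>P))\<^sup>2 \<le> (C - 1) * v"
proof -
  interpret P: prob_space P by fact
  interpret Q: prob_space Q by fact
  define p where "p = (\<integral>y. X y \<partial>P)"
  define \<Delta> where "\<Delta> = (\<integral>y. X y \<partial>Q) - p"
  have Xm [measurable]: "X \<in> borel_measurable P" using XP by auto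
  have "(\<integral>\<^sup>+y. ennreal ((X y - p)\<^sup>2) \<partial>P) \<le> ennreal v" using V by (simp add: ext_variance_def p_def)
  then have int2: "integrable P (\<lambda>y. (X y - p)\<^sup>2)"
    by (intro integrableI_nonneg) (auto simp: top.not_eq_extremum intro: order_le_less_trans)
  have v: "(\<integral>y. (X y - p)\<^sup>2 \<partial>P) \<le> v"
    using V nn_integral_eq_integral[OF int2] by (simp add: ext_variance_def p_def)
  have key: "(\<Delta> + s)\<^sup>2 \<le> C * (v + s\<^sup>2)" for s
  proof -
    define Z where "Z y = X y - p + s" for y
    have iZ: "integrable P (\<lambda>y. (Z y)\<^sup>2)" and eZ: "(\<integral>y. (Z y)\<^sup>2 \<partial>P) = (\<integral>y. (X y - p)\<^sup>2 \<partial>P) + s\<^sup>2"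
    proof -
      have eq: "(Z y)\<^sup>2 = (X y - p)\<^sup>2 + (2 * s * (X y - p) + s\<^sup>2)" for y
        by (simp add: Z_def power2_eq_square algebra_simps)
      have i: "integrable P (\<lambda>y. 2 * s * (X y - p) + s\<^sup>2)" using XP by auto
      show "integrable P (\<lambda>y. (Z y)\<^sup>2)" unfolding eq using int2 i by (rule Bochner_Integration.integrable_add)
      have "(\<integral>y. 2 * s * (X y - p) + s\<^sup>2 \<partial>P) = s\<^sup>2" using XP by (simp add: p_def P.prob_space)
      then show "(\<integral>y. (Z y)\<^sup>2 \<partial>P) = (\<integral>y. (X y - p)\<^sup>2 \<partial>P) + s\<^sup>2"
        unfolding eq using int2 i by (simp del: integral_add add: Bochner_Integration.integral_add)
    qed
    have iZQ: "integrable Q Z" unfolding Z_def[abs_def] using XQ by auto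
    have "\<Delta> + s = (\<integral>y. Z y \<partial>Q)" using XQ by (simp add: Z_def[abs_def] \<Delta>_def Q.prob_space)
    then have "\<bar>\<Delta> + s\<bar> \<le> (\<integral>y. \<bar>Z y\<bar> \<partial>Q)" by simp
    moreover have "ennreal ((\<integral>y. \<bar>Z y\<bar> \<partial>Q)\<^sup>2) \<le> ennreal (C * (v + s\<^sup>2))"
    proof -
      have "ennreal ((\<integral>y. \<bar>Z y\<bar> \<partial>Q)\<^sup>2) = (\<integral>\<^sup>+y. ennreal \<bar>Z y\<bar> \<partial>Q)\<^sup>2"
        using iZQ by (subst nn_integral_eq_integral) (auto simp: ennreal_power)
      also have "\<dots> \<le> ennreal C * (\<integral>\<^sup>+y. (ennreal \<bar>Z y\<bar>)\<^sup>2 \<partial>P)"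
        by (rule chi_dominatedD[OF PQ]) (simp add: Z_def[abs_def])
      also have "(\<integral>\<^sup>+y. (ennreal \<bar>Z y\<bar>)\<^sup>2 \<partial>P) = ennreal (\<integral>y. (Z y)\<^sup>2 \<partial>P)"
        using nn_integral_eq_integral[OF iZ] by (simp add: ennreal_power)
      also have "ennreal C * ennreal (\<integral>y. (Z y)\<^sup>2 \<partial>P) \<le> ennreal C * ennreal (v + s\<^sup>2)"
        using v eZ by (intro mult_left_mono ennreal_leI) auto
      finally show ?thesis using C by (simp add: ennreal_mult'[symmetric])
    qed
    then have "(\<integral>y. \<bar>Z y\<bar> \<partial>Q)\<^sup>2 \<le> C * (v + s\<^sup>2)" using C V(2) by (simp add: ennreal_le_iff)
    ultimately show ?thesis by (metis abs_ge_zero order_trans power2_abs power_mono)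
  qed
  show ?thesis
  proof (cases "C = 1")
    case True
    have "\<Delta> = 0"
    proof (rule ccontr)
      assume d: "\<Delta> \<noteq> 0"
      \<comment> \<open>For \<open>C = 1\<close> the inequality reads
        \<open>\<Delta>\<^sup>2 + 2 * \<Delta> * s \<le> v\<close>, which
        \<open>s = v / \<Delta>\<close> violates.\<close>
      have "(\<Delta> + v / \<Delta>)\<^sup>2 \<le> v + (v / \<Delta>)\<^sup>2" using key[of "v / \<Delta>"] True by simp
      moreover have "(\<Delta> + v / \<Delta>)\<^sup>2 = \<Delta>\<^sup>2 + 2 * v + (v / \<Delta>)\<^sup>2" using d by (simp add: power2_sum)
      moreover have "\<Delta>\<^sup>2 > 0" using d by simp
      ultimately show False using V(2) by linarith
    qed
    then show ?thesis using True by (simp add: \<Delta>_def p_def)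
  next
    case False
    then have c: "C - 1 > 0" using C by simp
    \<comment> \<open>This \<open>s\<close> minimises
      \<open>C * (v + s\<^sup>2) - (\<Delta> + s)\<^sup>2\<close>.\<close>
    define s where "s = \<Delta> / (C - 1)"
    have D: "\<Delta> = (C - 1) * s" using c by (simp add: s_def)
    have "(C * s)\<^sup>2 \<le> C * (v + s\<^sup>2)" using key[of s] by (simp add: D algebra_simps)
    then have "C * (C * s\<^sup>2) \<le> C * (v + s\<^sup>2)" by (simp add: power2_eq_square algebra_simps)
    then have "C * s\<^sup>2 \<le> v + s\<^sup>2" using C by simp
    then have "(C - 1) * ((C - 1) * s\<^sup>2) \<le> (C - 1) * v" using c by (intro mult_left_mono) (auto simp: algebra_simps)
    then show ?thesis unfolding \<Delta>_def[unfolded p_def, symmetric] unfolding D by (simp add: power2_eq_square mult_ac)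
  qed
qed

section \<open>Smooth functions and weak derivatives\<close>

definition smooth_real :: "(real \<Rightarrow> real) \<Rightarrow> bool" where
  "smooth_real f \<longleftrightarrow> (\<forall>k x. (deriv ^^ k) f differentiable (at x))"

text \<open>Coinduction replaces the computation of all iterated derivatives by exhibiting a class
  that is closed under differentiation.\<close>

lemma smooth_real_coinduct:
  assumes "f \<in> S" "\<And>g. g \<in> S \<Longrightarrow> \<exists>g'\<in>S. \<forall>x. (g has_real_derivative g' x) (at x)"
  shows "smooth_real f"
proof -
  have S: "(\<forall>x. g differentiable (at x)) \<and> deriv g \<in> S" if g: "g \<in> S" for g
  proof -
    obtain g' where g': "g' \<in> S" "\<And>x. (g has_real_derivative g' x) (at x)" using assms(2)[OF g] by blast
    have "deriv g = g'" using g'(2) by (intro ext DERIV_imp_deriv)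
    then show ?thesis using g' by (auto simp: real_differentiable_def)
  qed
  have "(deriv ^^ k) f \<in> S" for k
  proof (induction k)
    case (Suc k)
    then show ?case using S[of "(deriv ^^ k) f"] by simp
  qed (simp add: assms(1))
  then show ?thesis using S by (auto simp: smooth_real_def)
qed

lemma smooth_real_DERIV: "smooth_real f \<Longrightarrow> ((deriv ^^ k) f has_real_derivative (deriv ^^ Suc k) f x) (at x)"
proof -
  assume "smooth_real f"
  then have "(deriv ^^ k) f differentiable (at x)" unfolding smooth_real_def by blast
  then have "((deriv ^^ k) f has_real_derivative deriv ((deriv ^^ k) f) x) (at x)"
    by (rule DERIV_deriv_iff_real_differentiable[THEN iffD2])
  then show ?thesis by (simp only: funpow.simps o_apply)
qed

lemma smooth_real_deriv: "smooth_real f \<Longrightarrow> smooth_real (deriv f)"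
proof -
  assume f: "smooth_real f"
  have "(deriv ^^ k) (deriv f) = (deriv ^^ Suc k) f" for k by (simp only: funpow_Suc_right o_apply)
  then show ?thesis using f unfolding smooth_real_def by metis
qed

text \<open>The Leibniz rule turns a product into a sum of products, so sums are added to obtain a
  class closed under differentiation, as \<open>smooth_real_coinduct\<close> needs.\<close>

inductive_set smooth_products :: "(real \<Rightarrow> real) set" where
  mult: "smooth_real f \<Longrightarrow> smooth_real g \<Longrightarrow> (\<lambda>x. f x * g x) \<in> smooth_products"
| add: "f \<in> smooth_products \<Longrightarrow> g \<in> smooth_products \<Longrightarrow> (\<lambda>x. f x + g x) \<in> smooth_products"

lemma smooth_real_mult:
  assumes "smooth_real f" "smooth_real g"
  shows "smooth_real (\<lambda>x. f x * g x)"
proof (rule smooth_real_coinduct)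
  show "(\<lambda>x. f x * g x) \<in> smooth_products" using assms by (rule smooth_products.mult)
  fix h assume "h \<in> smooth_products"
  then show "\<exists>h'\<in>smooth_products. \<forall>x. (h has_real_derivative h' x) (at x)"
  proof induction
    case (mult f g)
    have "((\<lambda>x. f x * g x) has_real_derivative (deriv f x * g x + f x * deriv g x)) (at x)" for x
      using smooth_real_DERIV[OF mult(1), of 0] smooth_real_DERIV[OF mult(2), of 0]
      by (auto intro!: derivative_eq_intros)
    moreover have "(\<lambda>x. deriv f x * g x + f x * deriv g x) \<in> smooth_products"
      using mult by (intro smooth_products.add smooth_products.mult smooth_real_deriv)
    ultimately show ?case by (intro bexI[of _ "\<lambda>x. deriv f x * g x + f x * deriv g x"]) auto
  next
    case (add f g)
    then obtain f' g' where "f' \<in> smooth_products" "g' \<in> smooth_products"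
      "\<And>x. (f has_real_derivative f' x) (at x)" "\<And>x. (g has_real_derivative g' x) (at x)" by blast
    then show ?case
      by (intro bexI[of _ "\<lambda>x. f' x + g' x"]) (auto intro: smooth_products.add DERIV_add)
  qed
qed

lemma deriv_funpow_affine:
  assumes "smooth_real f"
  shows "(deriv ^^ k) (\<lambda>x. f (c * x + d)) = (\<lambda>x. c ^ k * (deriv ^^ k) f (c * x + d))"
proof (induction k)
  case (Suc k)
  have "((\<lambda>x. c ^ k * (deriv ^^ k) f (c * x + d)) has_real_derivative
        (c ^ Suc k * (deriv ^^ Suc k) f (c * x + d))) (at x)" for x
  proof -
    have "((deriv ^^ k) f has_real_derivative (deriv ^^ Suc k) f (c * x + d)) (at (c * x + d))"
      by (rule smooth_real_DERIV[OF assms])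
    moreover have "((\<lambda>x. c * x + d) has_real_derivative c) (at x)" by (auto intro!: derivative_eq_intros)
    ultimately have "((\<lambda>x. (deriv ^^ k) f (c * x + d)) has_real_derivative (deriv ^^ Suc k) f (c * x + d) * c) (at x)"
      by (rule DERIV_chain2)
    then have "((\<lambda>x. c ^ k * (deriv ^^ k) f (c * x + d)) has_real_derivative c ^ k * ((deriv ^^ Suc k) f (c * x + d) * c)) (at x)"
      by (rule DERIV_cmult)
    then show ?thesis by (simp add: mult_ac)
  qed
  then have "deriv (\<lambda>x. c ^ k * (deriv ^^ k) f (c * x + d)) = (\<lambda>x. c ^ Suc k * (deriv ^^ Suc k) f (c * x + d))"
    by (intro ext DERIV_imp_deriv)
  then show ?case using Suc by simp
qed simp

lemma smooth_real_affine:
  assumes "smooth_real f"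
  shows "smooth_real (\<lambda>x. f (c * x + d))"
  unfolding smooth_real_def deriv_funpow_affine[OF assms]
proof (intro allI)
  fix k x
  have "((deriv ^^ k) f has_real_derivative (deriv ^^ Suc k) f (c * x + d)) (at (c * x + d))"
    by (rule smooth_real_DERIV[OF assms])
  moreover have "((\<lambda>x. c * x + d) has_real_derivative c) (at x)" by (auto intro!: derivative_eq_intros)
  ultimately have "((\<lambda>x. (deriv ^^ k) f (c * x + d)) has_real_derivative (deriv ^^ Suc k) f (c * x + d) * c) (at x)"
    by (rule DERIV_chain2)
  from DERIV_cmult[OF this, of "c ^ k"] show "(\<lambda>x. c ^ k * (deriv ^^ k) f (c * x + d)) differentiable (at x)"
    by (auto simp: real_differentiable_def)
qed

section \<open>Smooth bump functions\<close>

text \<open>The classical flat function \<open>exp (- 1 / x)\<close> with a polynomial factor in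
  \<open>1 / x\<close>; such factors are what differentiation produces, so the family is closed
  under it.\<close>

definition poly_flat :: "real poly \<Rightarrow> real \<Rightarrow> real" where
  "poly_flat p x = (if x > 0 then poly p (1 / x) * exp (- (1 / x)) else 0)"

lemma poly_exp_neg_tendsto_0: "((\<lambda>y. poly p y * exp (- y)) \<longlongrightarrow> (0::real)) at_top"
proof -
  have "((\<lambda>y. \<Sum>i\<le>degree p. coeff p i * (y ^ i / exp y)) \<longlongrightarrow> (\<Sum>i\<le>degree p. coeff p i * 0)) at_top"
    by (intro tendsto_sum tendsto_mult tendsto_const tendsto_power_div_exp_0)
  then show ?thesis
    by (simp add: poly_altdef exp_minus field_simps sum_distrib_right sum_divide_distrib)
qed

text \<open>In the variable \<open>y = 1 / x\<close> differentiation is \<open>- y\<^sup>2\<close>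
  times the derivative in \<open>y\<close>, which sends \<open>p * exp (- y)\<close> to
  \<open>y\<^sup>2 * (p - pderiv p) * exp (- y)\<close>.\<close>

lemma poly_flat_DERIV:
  "(poly_flat p has_real_derivative poly_flat ([:0, 0, 1:] * (p - pderiv p)) x) (at x)"
proof -
  let ?q = "[:0, 0, 1:] * (p - pderiv p)"
  consider "x > 0" | "x < 0" | "x = 0" by linarith
  then show ?thesis
  proof cases
    case 1
    have "((\<lambda>x. poly p (1 / x) * exp (- (1 / x))) has_real_derivative poly_flat ?q x) (at x)"
      using 1 by (auto intro!: derivative_eq_intros simp: poly_flat_def field_simps power2_eq_square)
    then show ?thesis
      by (rule has_field_derivative_transform_within_open[where S = "{0<..}"]) (use 1 in \<open>auto simp: poly_flat_def\<close>)
  next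
    case 2
    have "((\<lambda>x. 0) has_real_derivative poly_flat ?q x) (at x)"
      using 2 by (simp add: poly_flat_def)
    then show ?thesis
      by (rule has_field_derivative_transform_within_open[where S = "{..<0}"]) (use 2 in \<open>auto simp: poly_flat_def\<close>)
  next
    case 3
    \<comment> \<open>With \<open>y = 1 / h\<close> the right difference quotient at 0 is
      \<open>y\<close> times the value of the function, hence the extra factor
      \<open>[:0, 1:]\<close>; the exponential beats the polynomial.\<close>
    have "((\<lambda>y. poly ([:0, 1:] * p) y * exp (- y)) \<longlongrightarrow> 0) at_top" by (rule poly_exp_neg_tendsto_0)
    then have "((\<lambda>h. poly ([:0, 1:] * p) (inverse h) * exp (- inverse h)) \<longlongrightarrow> 0) (at_right 0)"
      by (rule filterlim_compose[OF _ filterlim_inverse_at_top_right])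
    then have r: "((\<lambda>h. (poly_flat p h - poly_flat p 0) / (h - 0)) \<longlongrightarrow> 0) (at_right 0)"
    proof (rule Lim_transform_eventually)
      show "\<forall>\<^sub>F h in at_right 0. poly ([:0, 1:] * p) (inverse h) * exp (- inverse h)
          = (poly_flat p h - poly_flat p 0) / (h - 0)"
        using eventually_at_right_less[of "0::real"]
        by eventually_elim (simp add: poly_flat_def field_simps)
    qed
    have l: "((\<lambda>h. (poly_flat p h - poly_flat p 0) / (h - 0)) \<longlongrightarrow> 0) (at_left 0)"
    proof (rule Lim_transform_eventually[OF tendsto_const])
      show "\<forall>\<^sub>F h in at_left 0. 0 = (poly_flat p h - poly_flat p 0) / (h - 0)"
        unfolding eventually_at_filter by (intro always_eventually) (auto simp: poly_flat_def)
    qed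
    have "((\<lambda>h. (poly_flat p h - poly_flat p 0) / (h - 0)) \<longlongrightarrow> 0) (at 0)"
      using l r by (simp add: filterlim_at_split)
    then show ?thesis using 3 by (simp add: has_field_derivative_iff poly_flat_def)
  qed
qed

lemma smooth_real_poly_flat: "smooth_real (poly_flat p)"
proof (rule smooth_real_coinduct[of _ "range poly_flat"])
  fix g assume "g \<in> range poly_flat"
  then obtain p where "g = poly_flat p" by blast
  then show "\<exists>g'\<in>range poly_flat. \<forall>x. (g has_real_derivative g' x) (at x)"
    by (intro bexI[of _ "poly_flat ([:0, 0, 1:] * (p - pderiv p))"] allI) (simp_all only: poly_flat_DERIV rangeI)
qed simp

text \<open>The steepness \<open>j\<close> is there for a limit: as \<open>j\<close> tends to
  infinity the bumps tend pointwise to the indicator of \<open>{c<..<d}\<close>.\<close>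

definition bump :: "real \<Rightarrow> real \<Rightarrow> real \<Rightarrow> real \<Rightarrow> real" where
  "bump j c d x = poly_flat 1 (j * (x - c)) * poly_flat 1 (j * (d - x))"

lemma poly_flat_1_bounds: "0 \<le> poly_flat 1 x" "poly_flat 1 x \<le> 1"
  unfolding poly_flat_def by (cases "x > 0"; simp)+

lemma bump_bounds: "0 \<le> bump j c d x" "bump j c d x \<le> 1"
  unfolding bump_def by (intro mult_nonneg_nonneg poly_flat_1_bounds, intro mult_le_one poly_flat_1_bounds)

lemma smooth_real_bump: "smooth_real (bump j c d)"
proof -
  have "smooth_real (\<lambda>x. poly_flat 1 (j * x + (- j * c)) * poly_flat 1 ((- j) * x + j * d))"
    by (intro smooth_real_mult smooth_real_affine smooth_real_poly_flat)
  then show ?thesis by (simp add: bump_def[abs_def] algebra_simps)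
qed

lemma bump_eq_0: "j > 0 \<Longrightarrow> x \<notin> {c<..<d} \<Longrightarrow> bump j c d x = 0"
proof -
  assume "j > 0" "x \<notin> {c<..<d}"
  then have "\<not> j * (x - c) > 0 \<or> \<not> j * (d - x) > 0" by (simp add: zero_less_mult_iff)
  then show ?thesis unfolding bump_def poly_flat_def by (elim disjE) simp_all
qed

lemma test_function_bump:
  assumes j: "j > 0" and cd: "{c..d} \<subseteq> U"
  shows "test_function U (bump j c d)"
proof -
  have "{x. bump j c d x \<noteq> 0} \<subseteq> {c..d}"
  proof (rule subsetI, rule ccontr)
    fix x assume "x \<in> {x. bump j c d x \<noteq> 0}" "x \<notin> {c..d}"
    moreover from this(2) have "x \<notin> {c<..<d}" by auto
    ultimately show False using bump_eq_0[OF j] by blast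
  qed
  then have cl: "closure {x. bump j c d x \<noteq> 0} \<subseteq> {c..d}" by (intro closure_minimal) auto
  moreover have "compact (closure {x. bump j c d x \<noteq> 0})"
    using cl bounded_subset[OF bounded_closed_interval] unfolding compact_eq_bounded_closed by blast
  ultimately show ?thesis
    using smooth_real_bump cd unfolding test_function_def smooth_real_def by blast
qed

lemma test_function_smooth: "test_function U \<phi> \<Longrightarrow> smooth_real \<phi>"
  unfolding test_function_def smooth_real_def by blast

lemma poly_flat_1_at_top: "(poly_flat 1 \<longlongrightarrow> 1) at_top"
proof (rule Lim_transform_eventually)
  have "((\<lambda>y::real. exp (- inverse y)) \<longlongrightarrow> exp (- 0)) at_top"
    by (intro tendsto_intros tendsto_inverse_0_at_top filterlim_ident)
  then show "((\<lambda>y::real. exp (- inverse y)) \<longlongrightarrow> 1) at_top" by simp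
  show "\<forall>\<^sub>F y in at_top. exp (- inverse y) = poly_flat 1 y"
    using eventually_gt_at_top[of "0::real"] by eventually_elim (simp add: poly_flat_def inverse_eq_divide)
qed

section \<open>The fundamental lemma and uniqueness of weak derivatives\<close>

text \<open>The positive and negative parts of \<open>H\<close> are densities of measures that agree
  on open intervals, a generator stable under intersection. So the parts agree almost everywhere,
  and as one of them is always 0, both vanish.\<close>

lemma AE_zero_of_integral_intervals_zero:
  fixes H :: "real \<Rightarrow> real"
  assumes H: "integrable lborel H" and z: "\<And>c d. (\<integral>x. H x * indicator {c<..<d} x \<partial>lborel) = 0"
  shows "AE x in lborel. H x = 0"
proof -
  define P where "P x = ennreal (max 0 (H x))" for x
  define N where "N x = ennreal (max 0 (- H x))" for x
  have Hm: "H \<in> borel_measurable borel" using H by simp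
  have m: "P \<in> borel_measurable borel" "N \<in> borel_measurable borel"
    using Hm by (auto simp: P_def[abs_def] N_def[abs_def])
  have iH: "integrable lborel (\<lambda>x. max 0 (H x))" "integrable lborel (\<lambda>x. max 0 (- H x))"
    using H by auto
  have i: "integrable lborel (\<lambda>x. max 0 (H x) * indicator A x)" "integrable lborel (\<lambda>x. max 0 (- H x) * indicator A x)"
    if "A \<in> sets borel" for A
    using that iH by (auto intro!: integrable_real_mult_indicator)
  have e: "emeasure (density lborel P) A = ennreal (\<integral>x. max 0 (H x) * indicator A x \<partial>lborel)"
    "emeasure (density lborel N) A = ennreal (\<integral>x. max 0 (- H x) * indicator A x \<partial>lborel)"
    if A: "A \<in> sets borel" for A
  proof -
    have ind: "ennreal t * indicator A x = ennreal (t * indicator A x)" for t x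
      by (cases "x \<in> A") auto
    show "emeasure (density lborel P) A = ennreal (\<integral>x. max 0 (H x) * indicator A x \<partial>lborel)"
    proof -
      have "emeasure (density lborel P) A = (\<integral>\<^sup>+x. P x * indicator A x \<partial>lborel)"
        using A m by (subst emeasure_density) auto
      also have "\<dots> = (\<integral>\<^sup>+x. ennreal (max 0 (H x) * indicator A x) \<partial>lborel)"
        unfolding P_def ind ..
      also have "\<dots> = ennreal (\<integral>x. max 0 (H x) * indicator A x \<partial>lborel)"
        by (intro nn_integral_eq_integral i A AE_I2 mult_nonneg_nonneg) auto
      finally show ?thesis .
    qed
    show "emeasure (density lborel N) A = ennreal (\<integral>x. max 0 (- H x) * indicator A x \<partial>lborel)"
    proof -
      have "emeasure (density lborel N) A = (\<integral>\<^sup>+x. N x * indicator A x \<partial>lborel)"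
        using A m by (subst emeasure_density) auto
      also have "\<dots> = (\<integral>\<^sup>+x. ennreal (max 0 (- H x) * indicator A x) \<partial>lborel)"
        unfolding N_def ind ..
      also have "\<dots> = ennreal (\<integral>x. max 0 (- H x) * indicator A x \<partial>lborel)"
        by (intro nn_integral_eq_integral i A AE_I2 mult_nonneg_nonneg) auto
      finally show ?thesis .
    qed
  qed
  have eq: "(\<integral>x. max 0 (H x) * indicator {c<..<d} x \<partial>lborel) = (\<integral>x. max 0 (- H x) * indicator {c<..<d} x \<partial>lborel)" for c d
  proof -
    have "(\<integral>x. max 0 (H x) * indicator {c<..<d} x - max 0 (- H x) * indicator {c<..<d} x \<partial>lborel)
        = (\<integral>x. H x * indicator {c<..<d} x \<partial>lborel)"
      by (intro Bochner_Integration.integral_cong) (auto simp: max_def indicator_def)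
    then show ?thesis using z[of c d] i[of "{c<..<d}"] by simp
  qed
  have "density lborel P = density lborel N"
  proof (rule measure_eqI_generator_eq[where E = "range (\<lambda>(c, d). {c<..<d})" and \<Omega> = UNIV and A = "\<lambda>i. {- real i<..<real i}"])
    show "Int_stable (range (\<lambda>(c::real, d). {c<..<d}))"
    proof (rule Int_stableI)
      fix A B assume "A \<in> range (\<lambda>(c::real, d). {c<..<d})" "B \<in> range (\<lambda>(c::real, d). {c<..<d})"
      then obtain a b c d where "A = {a<..<b}" "B = {c<..<d}" by auto
      then have "A \<inter> B = (\<lambda>(c, d). {c<..<d}) (max a c, min b d)" by auto
      then show "A \<inter> B \<in> range (\<lambda>(c, d). {c<..<d})" by blast
    qed
    show "sets (density lborel P) = sigma_sets UNIV (range (\<lambda>(c, d). {c<..<d}))"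
      "sets (density lborel N) = sigma_sets UNIV (range (\<lambda>(c, d). {c<..<d}))"
      by (simp_all add: borel_eq_box)
    show "(\<Union>i. {- real i<..<real i}) = UNIV"
    proof (intro equalityI subsetI UNIV_I)
      fix x :: real
      obtain n where "\<bar>x\<bar> < real n" using reals_Archimedean2 by blast
      then have "x \<in> {- real n<..<real n}" by (simp add: abs_less_iff)
      then show "x \<in> (\<Union>i. {- real i<..<real i})" by blast
    qed
    show "emeasure (density lborel P) {- real i<..<real i} \<noteq> \<infinity>" for i by (simp add: e)
    show "emeasure (density lborel P) X = emeasure (density lborel N) X" if "X \<in> range (\<lambda>(c, d). {c<..<d})" for X
      using that eq by (auto simp: e)
  qed auto
  then have "AE x in lborel. P x = N x"
    using m by (intro sigma_finite_measure.density_unique[OF lborel.sigma_finite_measure_axioms]) auto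
  then show ?thesis
    by (rule eventually_mono) (auto simp: P_def N_def max_def split: if_splits)
qed

text \<open>Ever steeper bumps tend to the indicator of \<open>{c<..<d}\<close> on
  \<open>{a<..<b}\<close>; dominated convergence with bound \<open>|H|\<close> then shows that
  \<open>H\<close> has integral 0 over every interval.\<close>

lemma fundamental_lemma_calculus_of_variations:
  assumes h: "set_integrable lborel {a<..<b} h"
    and z: "\<And>\<phi>. test_function {a<..<b} \<phi> \<Longrightarrow> (LINT x:{a<..<b}|lborel. h x * \<phi> x) = 0"
  shows "AE x in lborel. x \<in> {a<..<b} \<longrightarrow> h x = 0"
proof -
  define H where "H x = indicator {a<..<b} x * h x" for x
  have H: "integrable lborel H" using h by (simp add: set_integrable_def H_def[abs_def])
  have "(\<integral>x. H x * indicator {c<..<d} x \<partial>lborel) = 0" for c d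
  proof -
    \<comment> \<open>Moving the ends inwards keeps the closed support of the bump inside
      \<open>{a<..<b}\<close>. If \<open>u j \<ge> v j\<close>, the bump is identically 0.\<close>
    define u where "u j = max c (a + 1 / real (Suc j))" for j
    define v where "v j = min d (b - 1 / real (Suc j))" for j
    define \<phi> where "\<phi> j = bump (real (Suc j)) (u j) (v j)" for j
    have test: "test_function {a<..<b} (\<phi> j)" for j
      unfolding \<phi>_def
    proof (rule test_function_bump)
      have t: "1 / real (Suc j) > 0" by simp
      have "a + 1 / real (Suc j) \<le> u j" "v j \<le> b - 1 / real (Suc j)" unfolding u_def v_def by simp_all
      with t have "a < u j" "v j < b" by linarith+
      then show "{u j..v j} \<subseteq> {a<..<b}" by auto
    qed simp
    have i0: "(\<integral>x. H x * \<phi> j x \<partial>lborel) = 0" for j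
      using z[OF test[of j]] by (simp add: set_lebesgue_integral_def H_def mult_ac)
    have \<phi>m: "\<phi> j \<in> borel_measurable borel" for j
    proof -
      have "smooth_real (\<phi> j)" unfolding \<phi>_def by (rule smooth_real_bump)
      from smooth_real_DERIV[OF this, of 0] have "continuous_on UNIV (\<phi> j)"
        by (intro continuous_at_imp_continuous_on) (auto intro: DERIV_isCont)
      then show ?thesis by (rule borel_measurable_continuous_onI)
    qed
    have lim: "(\<lambda>j. H x * \<phi> j x) \<longlonglongrightarrow> H x * indicator {c<..<d} x" for x
    proof (cases "x \<in> {a<..<b} \<and> x \<in> {c<..<d}")
      case True
      have n: "filterlim (\<lambda>j. real (Suc j)) at_top sequentially"
        by (rule filterlim_compose[OF filterlim_real_sequentially filterlim_Suc])
      have "(\<lambda>j. 1 / real (Suc j)) \<longlonglongrightarrow> 0" by (rule LIMSEQ_Suc[OF lim_1_over_n])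
      then have uv: "(\<lambda>j. x - u j) \<longlonglongrightarrow> x - max c (a + 0)" "(\<lambda>j. v j - x) \<longlonglongrightarrow> min d (b - 0) - x"
        unfolding u_def v_def by (intro tendsto_intros; assumption)+
      have "filterlim (\<lambda>j. (x - u j) * real (Suc j)) at_top sequentially"
        using True by (intro filterlim_tendsto_pos_mult_at_top[OF uv(1) _ n]) auto
      moreover have "filterlim (\<lambda>j. (v j - x) * real (Suc j)) at_top sequentially"
        using True by (intro filterlim_tendsto_pos_mult_at_top[OF uv(2) _ n]) auto
      ultimately have "(\<lambda>j. poly_flat 1 ((x - u j) * real (Suc j)) * poly_flat 1 ((v j - x) * real (Suc j))) \<longlonglongrightarrow> 1 * 1"
        by (intro tendsto_mult filterlim_compose[OF poly_flat_1_at_top])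
      then have "(\<lambda>j. \<phi> j x) \<longlonglongrightarrow> 1" by (simp add: \<phi>_def bump_def mult.commute)
      then have "(\<lambda>j. H x * \<phi> j x) \<longlonglongrightarrow> H x * 1" by (intro tendsto_mult tendsto_const)
      then show ?thesis using True by simp
    next
      case False
      have "H x * \<phi> j x = H x * indicator {c<..<d} x" for j
      proof (cases "x \<in> {a<..<b}")
        case True
        then have "x \<notin> {c<..<d}" using False by simp
        then have "x \<notin> {u j<..<v j}" by (auto simp: u_def v_def)
        then show ?thesis using \<open>x \<notin> {c<..<d}\<close> by (simp add: \<phi>_def bump_eq_0)
      qed (simp add: H_def)
      then have "(\<lambda>j. H x * \<phi> j x) = (\<lambda>_. H x * indicator {c<..<d} x)" by (rule ext)
      then show ?thesis by (simp only: tendsto_const)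
    qed
    have "(\<lambda>j. \<integral>x. H x * \<phi> j x \<partial>lborel) \<longlonglongrightarrow> (\<integral>x. H x * indicator {c<..<d} x \<partial>lborel)"
    proof (rule integral_dominated_convergence[where w = "\<lambda>x. \<bar>H x\<bar>"])
      show "AE x in lborel. norm (H x * \<phi> j x) \<le> \<bar>H x\<bar>" for j
        using bump_bounds by (intro AE_I2) (simp add: abs_mult \<phi>_def mult_left_le)
    qed (use H \<phi>m lim in auto)
    then show ?thesis using i0 by (simp add: LIMSEQ_const_iff)
  qed
  from AE_zero_of_integral_intervals_zero[OF H this] show ?thesis
    by (rule eventually_mono) (auto simp: H_def)
qed

lemma smooth_real_continuous: "smooth_real f \<Longrightarrow> continuous_on S ((deriv ^^ k) f)"
  by (intro continuous_at_imp_continuous_on ballI DERIV_isCont[OF smooth_real_DERIV])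

lemma set_integrable_mult_continuous:
  assumes "set_integrable lborel {a..b} g" "continuous_on UNIV (\<phi> :: real \<Rightarrow> real)"
  shows "set_integrable lborel {a..b} (\<lambda>x. g x * \<phi> x)"
proof -
  have "compact (\<phi> ` {a..b})"
    using assms(2) by (intro compact_continuous_image) (auto intro: continuous_on_subset)
  then have "bounded (\<phi> ` {a..b})" by (rule compact_imp_bounded)
  then obtain B where B: "\<And>x. x \<in> {a..b} \<Longrightarrow> \<bar>\<phi> x\<bar> \<le> B"
    unfolding bounded_iff real_norm_def by blast
  have \<phi>: "\<phi> \<in> borel_measurable borel" using assms(2) by (rule borel_measurable_continuous_onI)
  have i: "integrable lborel (\<lambda>x. indicator {a..b} x *\<^sub>R g x)" using assms(1) by (simp add: set_integrable_def)
  show ?thesis unfolding set_integrable_def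
  proof (rule Bochner_Integration.integrable_bound[OF integrable_mult_right[OF i, of B]])
    have "(\<lambda>x. (indicator {a..b} x *\<^sub>R g x) * \<phi> x) \<in> borel_measurable lborel"
      using i \<phi> by (intro borel_measurable_times) auto
    then show "(\<lambda>x. indicator {a..b} x *\<^sub>R (g x * \<phi> x)) \<in> borel_measurable lborel" by (simp add: mult_ac)
    show "AE x in lborel. norm (indicator {a..b} x *\<^sub>R (g x * \<phi> x)) \<le> norm (B * (indicator {a..b} x *\<^sub>R g x))"
    proof (intro AE_I2)
      fix x show "norm (indicator {a..b} x *\<^sub>R (g x * \<phi> x)) \<le> norm (B * (indicator {a..b} x *\<^sub>R g x))"
      proof (cases "x \<in> {a..b}")
        case True
        have "\<bar>\<phi> x\<bar> * \<bar>g x\<bar> \<le> \<bar>B\<bar> * \<bar>g x\<bar>" using B[OF True] by (intro mult_right_mono) auto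
        then show ?thesis using True by (simp add: abs_mult mult.commute)
      qed simp
    qed
  qed
qed

lemma test_function_support:
  assumes "test_function U \<phi>" "\<phi> x \<noteq> 0"
  shows "x \<in> U"
proof -
  have "x \<in> closure {x. \<phi> x \<noteq> 0}" using assms(2) by (intro subsetD[OF closure_subset]) simp
  then show ?thesis using assms(1) by (auto simp: test_function_def)
qed

lemma test_function_mono: "test_function U \<phi> \<Longrightarrow> U \<subseteq> V \<Longrightarrow> test_function V \<phi>"
  unfolding test_function_def by (elim conjE) (intro conjI, assumption+, rule order_trans)

text \<open>Both functions have the same integral against every test function; these live on the
  interior, so the endpoints stay undetermined.\<close>

lemma weak_derivative_AE_unique:
  assumes g: "L2_on {a..b} g" "L2_on {a..b} h"
    and w: "is_weak_derivative {a..b} k f g" "is_weak_derivative {a..b} k f h"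
  shows "AE x in lborel. x \<in> {a<..<b} \<longrightarrow> g x = h x"
proof -
  have i: "set_integrable lborel {a..b} g" "set_integrable lborel {a..b} h"
    using g by (auto intro: L2_on_integrable)
  have "AE x in lborel. x \<in> {a<..<b} \<longrightarrow> g x - h x = 0"
  proof (rule fundamental_lemma_calculus_of_variations)
    have "set_integrable lborel {a..b} (\<lambda>x. g x - h x)" using i by (rule set_integral_diff)
    then show "set_integrable lborel {a<..<b} (\<lambda>x. g x - h x)" by (rule set_integrable_subset) auto
    fix \<phi> assume \<phi>: "test_function {a<..<b} \<phi>"
    have c: "continuous_on UNIV \<phi>" using smooth_real_continuous[OF test_function_smooth[OF \<phi>], of UNIV 0] by simp
    have "(LINT x:{a..b}|lborel. g x * \<phi> x) = (LINT x:{a..b}|lborel. h x * \<phi> x)"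
      using w \<phi> by (simp add: is_weak_derivative_def interior_atLeastAtMost_real)
    then have "(LINT x:{a..b}|lborel. g x * \<phi> x - h x * \<phi> x) = 0"
      using set_integrable_mult_continuous[OF i(1) c] set_integrable_mult_continuous[OF i(2) c]
      by (simp add: set_integral_diff)
    moreover have "(LINT x:{a<..<b}|lborel. (g x - h x) * \<phi> x) = (LINT x:{a..b}|lborel. g x * \<phi> x - h x * \<phi> x)"
      unfolding set_lebesgue_integral_def
    proof (intro Bochner_Integration.integral_cong refl)
      fix x show "indicator {a<..<b} x *\<^sub>R ((g x - h x) * \<phi> x) = indicator {a..b} x *\<^sub>R (g x * \<phi> x - h x * \<phi> x)"
        using test_function_support[OF \<phi>, of x] by (cases "x \<in> {a<..<b}") (auto simp: algebra_simps)
    qed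
    ultimately show "(LINT x:{a<..<b}|lborel. (g x - h x) * \<phi> x) = 0" by simp
  qed
  then show ?thesis by simp
qed

lemma deriv_funpow_eq_0:
  assumes "open S" "\<And>x. x \<in> S \<Longrightarrow> f x = 0" "x \<in> S"
  shows "(deriv ^^ k) f x = (0 :: real)"
  using assms(3)
proof (induction k arbitrary: x)
  case (Suc k)
  have "((\<lambda>x. 0) has_real_derivative 0) (at x)" by simp
  then have "((deriv ^^ k) f has_real_derivative 0) (at x)"
    by (rule has_field_derivative_transform_within_open[OF _ assms(1) Suc.prems]) (simp add: Suc.IH)
  then show ?case by (simp add: DERIV_imp_deriv)
qed (simp add: assms(2))

lemma L2_on_UNIV: "L2_on UNIV f \<longleftrightarrow> f \<in> borel_measurable borel \<and> integrable lborel (\<lambda>x. (f x)\<^sup>2)"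
  by (simp add: L2_on_def set_borel_measurable_def set_integrable_def)

lemma L2_norm_on_sq: "(L2_norm_on D f)\<^sup>2 = (LINT x:D|lborel. (f x)\<^sup>2)"
proof -
  have "(LINT x:D|lborel. (f x)\<^sup>2) \<ge> 0"
    unfolding set_lebesgue_integral_def by (intro integral_nonneg_AE) auto
  then show ?thesis by (simp add: L2_norm_on_def)
qed

lemma integrable_mult_compact:
  assumes "L2_on UNIV k" "\<And>x. x \<notin> {c..d} \<Longrightarrow> k x = 0" "continuous_on UNIV (\<psi> :: real \<Rightarrow> real)"
  shows "integrable lborel (\<lambda>x. k x * \<psi> x)"
proof -
  have "set_integrable lborel {c..d} k"
    by (rule L2_on_integrable[OF L2_on_subset[OF assms(1)]]) auto
  then have "set_integrable lborel {c..d} (\<lambda>x. k x * \<psi> x)"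
    using assms(3) by (rule set_integrable_mult_continuous)
  moreover have "indicator {c..d} x *\<^sub>R (k x * \<psi> x) = k x * \<psi> x" for x
    using assms(2)[of x] by (cases "x \<in> {c..d}") auto
  ultimately show ?thesis unfolding set_integrable_def by (simp only:)
qed

section \<open>Classical derivatives as weak derivatives, and an admissible kernel\<close>

lemma is_weak_derivative_UNIV:
  "is_weak_derivative UNIV k f g \<longleftrightarrow> (\<forall>\<phi>. test_function UNIV \<phi> \<longrightarrow>
     (\<integral>x. f x * (deriv ^^ k) \<phi> x \<partial>lborel) = (-1) ^ k * (\<integral>x. g x * \<phi> x \<partial>lborel))"
  by (simp add: is_weak_derivative_def set_lebesgue_integral_def)

lemma smooth_integration_by_parts:
  assumes u: "smooth_real u" and v: "smooth_real v" and ab: "a \<le> b"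
    and z: "\<And>x. x \<notin> {a<..<b} \<Longrightarrow> u x = 0"
  shows "(\<integral>x. u x * deriv v x \<partial>lborel) = - (\<integral>x. deriv u x * v x \<partial>lborel)"
proof -
  have du: "(u has_real_derivative deriv u x) (at x)" and dv: "(v has_real_derivative deriv v x) (at x)" for x
    using smooth_real_DERIV[OF u, of 0] smooth_real_DERIV[OF v, of 0] by simp_all
  have c: "isCont (deriv u) x" "isCont (deriv v) x" for x
    using DERIV_isCont[OF smooth_real_DERIV[OF u, of 1]] DERIV_isCont[OF smooth_real_DERIV[OF v, of 1]] by simp_all
  define a' b' where "a' = a - 1" and "b' = b + 1"
  have "(\<integral>x. (u x * deriv v x) * indicator {a'..b'} x \<partial>lborel)
     = u b' * v b' - u a' * v a' - (\<integral>x. (deriv u x * v x) * indicator {a'..b'} x \<partial>lborel)"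
    using ab c du dv unfolding a'_def b'_def by (intro integral_by_parts) auto
  moreover have "u b' = 0" "u a' = 0" by (auto intro!: z simp: a'_def b'_def)
  moreover have "u x * deriv v x * indicator {a'..b'} x = u x * deriv v x" for x
    using z[of x] by (cases "x \<in> {a'..b'}") (auto simp: a'_def b'_def)
  moreover have "deriv u x * v x * indicator {a'..b'} x = deriv u x * v x" for x
  proof (cases "x \<in> {a'..b'}")
    case False
    have "(deriv ^^ 1) u x = 0"
      by (rule deriv_funpow_eq_0[of "- {a..b}"]) (use z False in \<open>auto simp: a'_def b'_def\<close>)
    then show ?thesis by simp
  qed simp
  ultimately show ?thesis by simp
qed

lemma smooth_real_funpow: "smooth_real f \<Longrightarrow> smooth_real ((deriv ^^ k) f)"
  by (induction k) (simp_all add: smooth_real_deriv)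

text \<open>Derivatives are moved from the test function to \<open>u\<close> one at a time;
  \<open>i\<close> counts those already moved.\<close>

lemma smooth_weak_derivative:
  assumes u: "smooth_real u" and ab: "a \<le> b" and z: "\<And>x. x \<notin> {a<..<b} \<Longrightarrow> u x = 0"
  shows "is_weak_derivative UNIV k u ((deriv ^^ k) u)"
  unfolding is_weak_derivative_UNIV
proof (intro allI impI)
  fix \<phi> assume "test_function UNIV \<phi>"
  then have \<phi>: "smooth_real \<phi>" by (rule test_function_smooth)
  \<comment> \<open>Derivatives of \<open>u\<close> are known to vanish only off the closed
    interval; enlarging it restores the open form that \<open>smooth_integration_by_parts\<close>
    asks for.\<close>
  have z': "(deriv ^^ i) u x = 0" if "x \<notin> {a - 1<..<b + 1}" for i x
    by (rule deriv_funpow_eq_0[of "- {a..b}"]) (use z that in auto)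
  have "(\<integral>x. u x * (deriv ^^ k) \<phi> x \<partial>lborel) = (-1) ^ i * (\<integral>x. (deriv ^^ i) u x * (deriv ^^ (k - i)) \<phi> x \<partial>lborel)"
    if "i \<le> k" for i
    using that
  proof (induction i)
    case (Suc i)
    have "k - i = Suc (k - Suc i)" using Suc.prems by simp
    then have "(deriv ^^ (k - i)) \<phi> = deriv ((deriv ^^ (k - Suc i)) \<phi>)" by simp
    moreover have "(\<integral>x. (deriv ^^ i) u x * deriv ((deriv ^^ (k - Suc i)) \<phi>) x \<partial>lborel)
      = - (\<integral>x. deriv ((deriv ^^ i) u) x * (deriv ^^ (k - Suc i)) \<phi> x \<partial>lborel)"
      using ab z' by (intro smooth_integration_by_parts[of _ _ "a - 1" "b + 1"] smooth_real_funpow u \<phi>) auto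
    ultimately show ?case using Suc by simp
  qed simp
  from this[of k] show "(\<integral>x. u x * (deriv ^^ k) \<phi> x \<partial>lborel) = (-1) ^ k * (\<integral>x. (deriv ^^ k) u x * \<phi> x \<partial>lborel)"
    by simp
qed

lemma L2_on_continuous_compact:
  assumes "continuous_on UNIV f" "\<And>x. x \<notin> {c..d} \<Longrightarrow> f x = 0"
  shows "L2_on UNIV f"
proof -
  have "set_integrable lborel {c..d} (\<lambda>x. (f x)\<^sup>2)"
    unfolding set_integrable_def
    by (intro borel_integrable_compact continuous_intros continuous_on_subset[OF assms(1)]) auto
  moreover have "indicator {c..d} x *\<^sub>R (f x)\<^sup>2 = (f x)\<^sup>2" for x
    using assms(2)[of x] by (cases "x \<in> {c..d}") auto
  ultimately have "integrable lborel (\<lambda>x. (f x)\<^sup>2)" unfolding set_integrable_def by (simp only:)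
  then show ?thesis
    using borel_measurable_continuous_onI[OF assms(1)] by (simp add: L2_on_UNIV)
qed

text \<open>The real infimum of an empty set would say nothing about its members, so an admissible
  kernel has to be exhibited: a bump divided by its norm.\<close>

lemma Gamma_const_nonempty:
  "\<exists>K. K \<in> sobolev_space \<beta> UNIV \<and> L2_norm_on UNIV K = 1 \<and> closure {x. K x \<noteq> 0} \<subseteq> {-1/2..1/2}"
proof -
  define b where "b = bump 1 (-1/2) (1/2)"
  have b: "smooth_real b" unfolding b_def by (rule smooth_real_bump)
  have bc: "continuous_on UNIV b" using smooth_real_continuous[OF b, of UNIV 0] by simp
  have bz: "b x = 0" if "x \<notin> {-1/2<..<1/2}" for x unfolding b_def by (rule bump_eq_0[OF _ that]) simp
  have L2b: "L2_on UNIV b" by (rule L2_on_continuous_compact[OF bc, of "-1/2" "1/2"]) (use bz in auto)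
  define I where "I = (\<integral>x. (b x)\<^sup>2 \<partial>lborel)"
  have "I \<noteq> 0"
  proof
    assume "I = 0"
    then have ae: "AE x in lborel. (b x)\<^sup>2 = 0"
      using L2b integral_nonneg_eq_0_iff_AE[of lborel "\<lambda>x. (b x)\<^sup>2"] by (simp add: I_def L2_on_UNIV)
    have "b x \<noteq> 0" if "x \<in> {-1/2<..<1/2}" for x
      using that by (simp add: b_def bump_def poly_flat_def)
    then have "AE x in lborel. x \<notin> {-1/2<..<1/2::real}"
      using ae by (elim eventually_mono) force
    then have "{-1/2<..<1/2::real} \<in> null_sets lborel" by (subst AE_iff_null_sets) simp_all
    then have "emeasure lborel {-1/2<..<1/2::real} = 0" by (rule null_setsD1)
    then show False by simp
  qed
  moreover have "I \<ge> 0" unfolding I_def by simp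
  ultimately have I: "I > 0" by simp
  define K where "K x = b x * (1 / sqrt I)" for x
  have "smooth_real (\<lambda>x. 1 / sqrt I)"
    by (rule smooth_real_coinduct[of _ "range (\<lambda>c x. c)"]) (auto intro!: exI[of _ 0])
  then have K: "smooth_real K" unfolding K_def[abs_def] by (rule smooth_real_mult[OF b])
  have Kz: "K x = 0" if "x \<notin> {-1/2<..<1/2}" for x using bz[OF that] by (simp add: K_def)
  have dz: "(deriv ^^ k) K x = 0" if "x \<notin> {-1/2..1/2}" for k x
    by (rule deriv_funpow_eq_0[of "- {-1/2..1/2}"]) (use Kz that in auto)
  have L2: "L2_on UNIV ((deriv ^^ k) K)" for k
    by (rule L2_on_continuous_compact[OF smooth_real_continuous[OF K] dz])
  have w: "is_weak_derivative UNIV k K ((deriv ^^ k) K)" for k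
    by (rule smooth_weak_derivative[of _ "-1/2" "1/2"]) (use K Kz in auto)
  have "K \<in> sobolev_space \<beta> UNIV"
    unfolding sobolev_space_def using L2[of 0] L2 w by auto
  moreover have "L2_norm_on UNIV K = 1"
  proof -
    have "(\<lambda>x. (K x)\<^sup>2) = (\<lambda>x. (b x)\<^sup>2 * (1 / I))" using I by (auto simp: K_def power_mult_distrib power_divide)
    then have "(\<integral>x. (K x)\<^sup>2 \<partial>lborel) = 1"
      using I by (simp add: I_def)
    then show ?thesis by (simp add: L2_norm_on_def set_lebesgue_integral_def)
  qed
  moreover have "closure {x. K x \<noteq> 0} \<subseteq> {-1/2..1/2}"
  proof (rule closure_minimal)
    show "{x. K x \<noteq> 0} \<subseteq> {-1/2..1/2}"
    proof (rule subsetI, rule ccontr)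
      fix x assume "x \<in> {x. K x \<noteq> 0}" "x \<notin> {-1/2..1/2}"
      moreover from this(2) have "x \<notin> {-1/2<..<1/2}" by auto
      ultimately show False using Kz by blast
    qed
  qed simp
  ultimately show ?thesis by blast
qed

text \<open>A weak derivative vanishes almost everywhere off the support, so it may be cut off there;
  translated copies on neighbouring cells then do not overlap.\<close>

lemma localized_weak_derivative:
  assumes g: "L2_on UNIV g" and w: "is_weak_derivative UNIV k K g" and K: "\<And>x. x \<notin> {c..d} \<Longrightarrow> K x = 0"
  defines "g' \<equiv> \<lambda>x. indicator {c..d} x * g x"
  shows "L2_on UNIV g'" "is_weak_derivative UNIV k K g'"
    "(\<integral>x. (g' x)\<^sup>2 \<partial>lborel) \<le> (\<integral>x. (g x)\<^sup>2 \<partial>lborel)"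
proof -
  have gi: "set_integrable lborel {s<..<t} g" for s t
  proof (rule set_integrable_subset)
    show "set_integrable lborel {s..t} g" by (rule L2_on_integrable[OF L2_on_subset[OF g]]) auto
  qed auto
  \<comment> \<open>A test function supported away from \<open>{c..d}\<close> has derivatives that
    vanish wherever \<open>K\<close> may be nonzero, so the defining identity makes \<open>g\<close>
    integrate to 0 against it.\<close>
  have off: "AE x in lborel. x \<in> {s<..<t} \<longrightarrow> g x = 0" if st: "{s<..<t} \<inter> {c..d} = {}" for s t
  proof (rule fundamental_lemma_calculus_of_variations[OF gi])
    fix \<phi> assume \<phi>: "test_function {s<..<t} \<phi>"
    have K0: "K x * (deriv ^^ k) \<phi> x = 0" for x
    proof (cases "x \<in> {c..d}")
      case True
      have cl: "closure {x. \<phi> x \<noteq> 0} \<subseteq> {s<..<t}" using \<phi> by (simp add: test_function_def)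
      have "(deriv ^^ k) \<phi> x = 0"
      proof (rule deriv_funpow_eq_0[of "- closure {x. \<phi> x \<noteq> 0}"])
        show "x \<in> - closure {x. \<phi> x \<noteq> 0}" using True st cl by blast
        show "\<phi> y = 0" if "y \<in> - closure {x. \<phi> x \<noteq> 0}" for y
          using that closure_subset[of "{x. \<phi> x \<noteq> 0}"] by auto
      qed auto
      then show ?thesis by simp
    qed (simp add: K)
    have "(\<integral>x. K x * (deriv ^^ k) \<phi> x \<partial>lborel) = 0" unfolding K0 by simp
    then have "(\<integral>x. g x * \<phi> x \<partial>lborel) = 0"
      using w test_function_mono[OF \<phi>, of UNIV] by (simp add: is_weak_derivative_UNIV)
    moreover have "indicator {s<..<t} x *\<^sub>R (g x * \<phi> x) = g x * \<phi> x" for x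
      using test_function_support[OF \<phi>, of x] by (cases "x \<in> {s<..<t}") auto
    ultimately show "(LINT x:{s<..<t}|lborel. g x * \<phi> x) = 0"
      unfolding set_lebesgue_integral_def by (simp only:)
  qed
  \<comment> \<open>The fundamental lemma is for bounded intervals, so each half-line is exhausted
    by countably many of them.\<close>
  have "AE x in lborel. \<forall>N::nat. x \<in> {d<..<d + real N} \<longrightarrow> g x = 0"
    unfolding AE_all_countable by (intro allI off) auto
  moreover have "AE x in lborel. \<forall>N::nat. x \<in> {c - real N<..<c} \<longrightarrow> g x = 0"
    unfolding AE_all_countable by (intro allI off) auto
  ultimately have ae: "AE x in lborel. g' x = g x"
  proof eventually_elim
    case (elim x)
    show ?case
    proof (cases "x \<in> {c..d}")
      case False
      obtain N :: nat where N: "\<bar>x - c\<bar> + \<bar>x - d\<bar> < real N" using reals_Archimedean2 by blast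
      consider "x < c" | "x > d" using False by force
      then have "g x = 0"
      proof cases
        case 1
        with N have "x \<in> {c - real N<..<c}" by auto
        then show ?thesis using elim(2) by blast
      next
        case 2
        with N have "x \<in> {d<..<d + real N}" by auto
        then show ?thesis using elim(1) by blast
      qed
      then show ?thesis by (simp add: g'_def)
    qed (simp add: g'_def)
  qed
  have gm: "g \<in> borel_measurable borel" "integrable lborel (\<lambda>x. (g x)\<^sup>2)" using g by (simp_all add: L2_on_UNIV)
  have gm': "g' \<in> borel_measurable borel" unfolding g'_def using gm by simp
  have ae2: "AE x in lborel. (g' x)\<^sup>2 = (g x)\<^sup>2" using ae by (rule eventually_mono) simp
  have "integrable lborel (\<lambda>x. (g' x)\<^sup>2) \<longleftrightarrow> integrable lborel (\<lambda>x. (g x)\<^sup>2)"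
    using gm gm' ae2 by (intro integrable_cong_AE) auto
  then show "L2_on UNIV g'" using gm gm' by (simp add: L2_on_UNIV)
  have "(\<integral>x. (g' x)\<^sup>2 \<partial>lborel) = (\<integral>x. (g x)\<^sup>2 \<partial>lborel)"
    using gm gm' ae2 by (intro integral_cong_AE) auto
  then show "(\<integral>x. (g' x)\<^sup>2 \<partial>lborel) \<le> (\<integral>x. (g x)\<^sup>2 \<partial>lborel)" by simp
  show "is_weak_derivative UNIV k K g'"
    unfolding is_weak_derivative_UNIV
  proof (intro allI impI)
    fix \<phi> assume \<phi>: "test_function UNIV \<phi>"
    have "continuous_on UNIV \<phi>" using smooth_real_continuous[OF test_function_smooth[OF \<phi>], of UNIV 0] by simp
    then have "\<phi> \<in> borel_measurable borel" by (rule borel_measurable_continuous_onI)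
    then have "(\<integral>x. g' x * \<phi> x \<partial>lborel) = (\<integral>x. g x * \<phi> x \<partial>lborel)"
      using gm gm' ae by (intro integral_cong_AE) (auto elim: eventually_mono)
    then show "(\<integral>x. K x * (deriv ^^ k) \<phi> x \<partial>lborel) = (-1) ^ k * (\<integral>x. g' x * \<phi> x \<partial>lborel)"
      using w \<phi> by (simp add: is_weak_derivative_UNIV)
  qed
qed

section \<open>Rescaled copies of a kernel\<close>

text \<open>Copy \<open>i\<close> lives on the interval from \<open>i / m\<close> to
  \<open>(i + 1) / m\<close> around the midpoint \<open>(i + 1 / 2) / m\<close>. The factor
  \<open>sqrt m\<close> preserves the \<open>L\<^sup>2\<close> norm, so a normalised kernel yields
  orthonormal copies.\<close>

definition cell :: "nat \<Rightarrow> nat \<Rightarrow> (real \<Rightarrow> real) \<Rightarrow> real \<Rightarrow> real" where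
  "cell m i k x = sqrt m * k (real m * x - real i - 1 / 2)"

definition cell_sum :: "nat \<Rightarrow> (real \<Rightarrow> real) \<Rightarrow> (nat \<Rightarrow> real) \<Rightarrow> real \<Rightarrow> real" where
  "cell_sum m k \<theta> x = (\<Sum>i<m. \<theta> i * cell m i k x)"

text \<open>Covers kernels, their localised weak derivatives and their absolute values
  alike.\<close>

definition L2_unit_cell :: "(real \<Rightarrow> real) \<Rightarrow> bool" where
  "L2_unit_cell k \<longleftrightarrow> L2_on UNIV k \<and> (\<forall>x. x \<notin> {-1/2..1/2} \<longrightarrow> k x = 0)"

lemma cell_eq_0:
  assumes "m \<ge> 1" "L2_unit_cell k" "x \<notin> {real i / m..(real i + 1) / m}"
  shows "cell m i k x = 0"
proof -
  have "real m * x - real i - 1 / 2 \<notin> {-1/2..1/2}"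
    using assms(1,3) by (auto simp: field_simps)
  moreover have "\<forall>y. y \<notin> {-1/2..1/2} \<longrightarrow> k y = 0" using assms(2) unfolding L2_unit_cell_def by (elim conjE)
  ultimately have "k (real m * x - real i - 1 / 2) = 0" by (elim allE impE)
  then show ?thesis by (simp add: cell_def)
qed

lemma cell_sum_eq_0:
  assumes m: "m \<ge> 1" and k: "L2_unit_cell k" and x: "x \<notin> {0..1}"
  shows "cell_sum m k \<theta> x = 0"
  unfolding cell_sum_def
proof (intro sum.neutral ballI)
  fix i assume i: "i \<in> {..<m}"
  have "{real i / m..(real i + 1) / m} \<subseteq> {0..1}" using m i by (auto simp: field_simps)
  then have "x \<notin> {real i / m..(real i + 1) / m}" using x by blast
  then show "\<theta> i * cell m i k x = 0" using cell_eq_0[OF m k] by simp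
qed

lemma cell_borel: "L2_unit_cell k \<Longrightarrow> cell m i k \<in> borel_measurable borel"
proof -
  assume "L2_unit_cell k"
  then have [measurable]: "k \<in> borel_measurable borel" by (simp add: L2_unit_cell_def L2_on_UNIV)
  show ?thesis unfolding cell_def[abs_def] by measurable
qed

lemma cell_integral_mult:
  assumes m: "m \<ge> 1"
  shows "(\<integral>x. cell m i k x * u x \<partial>lborel) = 1 / sqrt m * (\<integral>y. k y * u ((real i + 1 / 2) / m + 1 / m * y) \<partial>lborel)"
proof -
  have "(\<integral>x. cell m i k x * u x \<partial>lborel) = \<bar>1 / real m\<bar> *\<^sub>R
     (\<integral>y. cell m i k ((real i + 1 / 2) / m + 1 / m * y) * u ((real i + 1 / 2) / m + 1 / m * y) \<partial>lborel)"
    using m by (intro lborel_integral_real_affine) simp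
  also have "\<dots> = 1 / real m * (\<integral>y. sqrt m * (k y * u ((real i + 1 / 2) / m + 1 / m * y)) \<partial>lborel)"
  proof -
    have "real m * ((real i + 1 / 2) / m + 1 / m * y) - real i - 1 / 2 = y" for y
      using m by (simp add: field_simps)
    then show ?thesis by (simp add: cell_def mult.assoc)
  qed
  also have "\<dots> = 1 / real m * (sqrt m * (\<integral>y. k y * u ((real i + 1 / 2) / m + 1 / m * y) \<partial>lborel))"
    by simp
  also have "1 / real m * (sqrt m * z) = 1 / sqrt m * z" for z
    using m by (simp add: field_simps)
  finally show ?thesis .
qed

lemma cell_sq:
  assumes m: "m \<ge> 1" and k: "L2_unit_cell k"
  shows "integrable lborel (\<lambda>x. (cell m i k x)\<^sup>2)" "(\<integral>x. (cell m i k x)\<^sup>2 \<partial>lborel) = (\<integral>x. (k x)\<^sup>2 \<partial>lborel)"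
proof -
  have k2: "integrable lborel (\<lambda>x. (k x)\<^sup>2)" using k by (simp add: L2_unit_cell_def L2_on_UNIV)
  have "integrable lborel (\<lambda>x. (k ((- real i - 1 / 2) + real m * x))\<^sup>2)"
    using m k2 by (subst lborel_integrable_real_affine_iff[where f = "\<lambda>x. (k x)\<^sup>2"]) auto
  then have "integrable lborel (\<lambda>x. real m * (k ((- real i - 1 / 2) + real m * x))\<^sup>2)" by simp
  moreover have "real m * (k ((- real i - 1 / 2) + real m * x))\<^sup>2 = (cell m i k x)\<^sup>2" for x
    by (simp add: cell_def power_mult_distrib algebra_simps)
  ultimately show "integrable lborel (\<lambda>x. (cell m i k x)\<^sup>2)" by (simp only:)
  have cy: "cell m i k ((real i + 1 / 2) / m + 1 / m * y) = sqrt m * k y" for y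
  proof -
    have "real m * ((real i + 1 / 2) / m + 1 / m * y) - real i - 1 / 2 = y"
      using m by (simp add: field_simps)
    then show ?thesis by (simp add: cell_def)
  qed
  have "(\<integral>x. (cell m i k x)\<^sup>2 \<partial>lborel) = 1 / sqrt m * (\<integral>y. k y * cell m i k ((real i + 1 / 2) / m + 1 / m * y) \<partial>lborel)"
    using cell_integral_mult[OF m, of i k "cell m i k"] by (simp add: power2_eq_square)
  also have "\<dots> = 1 / sqrt m * (\<integral>y. k y * (sqrt m * k y) \<partial>lborel)" unfolding cy ..
  also have "(\<integral>y. k y * (sqrt m * k y) \<partial>lborel) = sqrt m * (\<integral>x. (k x)\<^sup>2 \<partial>lborel)"
  proof -
    have eq: "k y * (sqrt m * k y) = sqrt m * (k y)\<^sup>2" for y by (simp add: power2_eq_square)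
    show ?thesis unfolding eq by simp
  qed
  finally show "(\<integral>x. (cell m i k x)\<^sup>2 \<partial>lborel) = (\<integral>x. (k x)\<^sup>2 \<partial>lborel)" using m by simp
qed

text \<open>Closed neighbouring cells share an endpoint, the point \<open>max i j / m\<close>; hence
  almost everywhere and not everywhere.\<close>

lemma cell_disjoint:
  assumes m: "m \<ge> 1" and k: "L2_unit_cell k" and ij: "i \<noteq> j"
  shows "AE x in lborel. cell m i k x * cell m j k x = 0"
proof -
  have "AE x in lborel. x \<noteq> real (max i j) / real m" by (rule AE_lborel_singleton)
  then show ?thesis
  proof (rule eventually_mono)
    fix x assume x: "x \<noteq> real (max i j) / real m"
    have "x \<notin> {real i / m..(real i + 1) / m} \<or> x \<notin> {real j / m..(real j + 1) / m}"
    proof (rule ccontr)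
      assume "\<not> ?thesis"
      then have *: "real i \<le> m * x" "m * x \<le> real i + 1" "real j \<le> m * x" "m * x \<le> real j + 1"
        using m by (auto simp: field_simps)
      have "real m * x = real (max i j)"
      proof (cases "i < j")
        case True
        then have "real i + 1 \<le> real j" by linarith
        with * True show ?thesis by simp
      next
        case False
        then have "real j + 1 \<le> real i" using ij by linarith
        with * False show ?thesis by simp
      qed
      then have "x = real (max i j) / real m" using m by (simp add: field_simps)
      with x show False by simp
    qed
    then show "cell m i k x * cell m j k x = 0"
      using cell_eq_0[OF m k, of x i] cell_eq_0[OF m k, of x j] by auto
  qed
qed

lemma cell_orthogonal:
  assumes m: "m \<ge> 1" and k: "L2_unit_cell k"
  shows "integrable lborel (\<lambda>x. cell m i k x * cell m j k x)"
    "(\<integral>x. cell m i k x * cell m j k x \<partial>lborel) = (if i = j then (\<integral>x. (k x)\<^sup>2 \<partial>lborel) else 0)"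
proof -
  have meas: "(\<lambda>x. cell m i k x * cell m j k x) \<in> borel_measurable lborel"
    using cell_borel[OF k] by simp
  have "integrable lborel (\<lambda>x. cell m i k x * cell m j k x) \<and>
    (\<integral>x. cell m i k x * cell m j k x \<partial>lborel) = (if i = j then (\<integral>x. (k x)\<^sup>2 \<partial>lborel) else 0)"
  proof (cases "i = j")
    case True
    then show ?thesis using cell_sq[OF m k, of i] by (simp add: power2_eq_square)
  next
    case False
    note ae = cell_disjoint[OF m k False]
    have "integrable lborel (\<lambda>x. cell m i k x * cell m j k x)"
      using ae meas by (subst integrable_cong_AE[where g = "\<lambda>_. 0"]) auto
    then show ?thesis using False integral_eq_zero_AE[OF ae] by simp
  qed
  then show "integrable lborel (\<lambda>x. cell m i k x * cell m j k x)"
    "(\<integral>x. cell m i k x * cell m j k x \<partial>lborel) = (if i = j then (\<integral>x. (k x)\<^sup>2 \<partial>lborel) else 0)"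
    by blast+
qed

lemma cell_sum_sq:
  assumes m: "m \<ge> 1" and k: "L2_unit_cell k"
  shows "L2_on UNIV (cell_sum m k \<theta>)"
    "(\<integral>x. (cell_sum m k \<theta> x)\<^sup>2 \<partial>lborel) = (\<Sum>i<m. (\<theta> i)\<^sup>2) * (\<integral>x. (k x)\<^sup>2 \<partial>lborel)"
proof -
  have eq: "(cell_sum m k \<theta> x)\<^sup>2 = (\<Sum>i<m. \<Sum>j<m. \<theta> i * \<theta> j * (cell m i k x * cell m j k x))" for x
    unfolding cell_sum_def power2_eq_square sum_product by (simp add: mult_ac)
  have i: "integrable lborel (\<lambda>x. \<theta> i * \<theta> j * (cell m i k x * cell m j k x))" for i j
    by (intro integrable_mult_right cell_orthogonal[OF m k])
  have "integrable lborel (\<lambda>x. (cell_sum m k \<theta> x)\<^sup>2)"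
    unfolding eq by (intro Bochner_Integration.integrable_sum i)
  moreover have "cell_sum m k \<theta> \<in> borel_measurable borel"
    unfolding cell_sum_def[abs_def] using cell_borel[OF k]
    by (intro borel_measurable_sum borel_measurable_times borel_measurable_const)
  ultimately show "L2_on UNIV (cell_sum m k \<theta>)" by (simp add: L2_on_UNIV)
  have "(\<integral>x. (cell_sum m k \<theta> x)\<^sup>2 \<partial>lborel) = (\<Sum>i<m. \<Sum>j<m. \<integral>x. \<theta> i * \<theta> j * (cell m i k x * cell m j k x) \<partial>lborel)"
    unfolding eq using i by (simp add: Bochner_Integration.integral_sum Bochner_Integration.integrable_sum)
  also have "\<dots> = (\<Sum>i<m. \<Sum>j<m. if i = j then (\<theta> i)\<^sup>2 * (\<integral>x. (k x)\<^sup>2 \<partial>lborel) else 0)"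
    using cell_orthogonal[OF m k] by (intro sum.cong refl) (simp add: power2_eq_square)
  also have "\<dots> = (\<Sum>i<m. (\<theta> i)\<^sup>2) * (\<integral>x. (k x)\<^sup>2 \<partial>lborel)"
    by (simp add: sum_distrib_right)
  finally show "(\<integral>x. (cell_sum m k \<theta> x)\<^sup>2 \<partial>lborel) = (\<Sum>i<m. (\<theta> i)\<^sup>2) * (\<integral>x. (k x)\<^sup>2 \<partial>lborel)" .
qed

section \<open>Weak derivatives and Sobolev norms of the copies\<close>

lemma test_function_affine:
  assumes \<phi>: "test_function UNIV \<phi>" and c: "c > 0"
  shows "test_function UNIV (\<lambda>x. \<phi> (c * x + d))"
proof -
  have "bounded {x. \<phi> x \<noteq> 0}" using \<phi> by (simp add: test_function_def compact_closure)
  then obtain B where B: "\<And>x. \<phi> x \<noteq> 0 \<Longrightarrow> \<bar>x\<bar> \<le> B" unfolding bounded_iff by auto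
  have "\<bar>x\<bar> \<le> (B + \<bar>d\<bar>) / c" if "\<phi> (c * x + d) \<noteq> 0" for x
  proof -
    have "c * \<bar>x\<bar> = \<bar>(c * x + d) - d\<bar>" using c by (simp add: abs_mult)
    also have "\<dots> \<le> B + \<bar>d\<bar>" using B[OF that] abs_triangle_ineq4[of "c * x + d" d] by linarith
    finally show ?thesis using c by (simp add: pos_le_divide_eq mult.commute)
  qed
  then have "bounded {x. \<phi> (c * x + d) \<noteq> 0}" unfolding bounded_iff by auto
  then show ?thesis
    using smooth_real_affine[OF test_function_smooth[OF \<phi>], of c d]
    unfolding test_function_def smooth_real_def by (simp add: compact_closure)
qed

text \<open>The rescaling is shifted to the test function: \<open>\<psi>\<close> is
  \<open>\<phi>\<close> read in the coordinate of the unit cell, and each of its \<open>l\<close>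
  derivatives carries a factor \<open>1 / m\<close>.\<close>

lemma cell_weak_derivative:
  assumes m: "m \<ge> 1" and w: "is_weak_derivative UNIV l K g" and \<phi>: "test_function UNIV \<phi>"
  shows "(\<integral>x. cell m i K x * (deriv ^^ l) \<phi> x \<partial>lborel) = (-1) ^ l * (real m ^ l * (\<integral>x. cell m i g x * \<phi> x \<partial>lborel))"
proof -
  define t where "t = (real i + 1 / 2) / real m"
  define \<psi> where "\<psi> y = \<phi> (1 / real m * y + t)" for y
  have \<psi>: "test_function UNIV \<psi>" unfolding \<psi>_def using m by (intro test_function_affine \<phi>) simp
  have d: "(deriv ^^ l) \<phi> (t + 1 / real m * y) = real m ^ l * (deriv ^^ l) \<psi> y" for y
    unfolding \<psi>_def deriv_funpow_affine[OF test_function_smooth[OF \<phi>]]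
    using m by (simp add: power_divide add.commute)
  have "(\<integral>x. cell m i K x * (deriv ^^ l) \<phi> x \<partial>lborel) = 1 / sqrt m * (\<integral>y. real m ^ l * (K y * (deriv ^^ l) \<psi> y) \<partial>lborel)"
    unfolding cell_integral_mult[OF m] t_def[symmetric] d by (simp add: mult.left_commute)
  also have "\<dots> = 1 / sqrt m * (real m ^ l * ((-1) ^ l * (\<integral>y. g y * \<psi> y \<partial>lborel)))"
    using w \<psi> by (simp add: is_weak_derivative_UNIV)
  also have "\<dots> = (-1) ^ l * (real m ^ l * (\<integral>x. cell m i g x * \<phi> x \<partial>lborel))"
    unfolding cell_integral_mult[OF m] t_def[symmetric] by (simp add: \<psi>_def add.commute)
  finally show ?thesis .
qed

lemma cell_integrable_mult:
  assumes m: "m \<ge> 1" and k: "L2_unit_cell k" and \<psi>: "continuous_on UNIV \<psi>"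
  shows "integrable lborel (\<lambda>x. cell m i k x * \<psi> x)"
proof (rule integrable_mult_compact)
  show "L2_on UNIV (cell m i k)" using cell_sq[OF m k] cell_borel[OF k] by (simp add: L2_on_UNIV)
  show "cell m i k x = 0" if "x \<notin> {real i / m..(real i + 1) / m}" for x by (rule cell_eq_0[OF m k that])
qed (rule \<psi>)

lemma cell_sum_weak_derivative:
  assumes m: "m \<ge> 1" and K: "L2_unit_cell K" and g: "L2_unit_cell g" and w: "is_weak_derivative UNIV l K g"
  shows "is_weak_derivative UNIV l (cell_sum m K \<theta>) (\<lambda>x. real m ^ l * cell_sum m g \<theta> x)"
  unfolding is_weak_derivative_UNIV
proof (intro allI impI)
  fix \<phi> assume \<phi>: "test_function UNIV \<phi>"
  have c: "continuous_on UNIV ((deriv ^^ j) \<phi>)" for j by (rule smooth_real_continuous[OF test_function_smooth[OF \<phi>]])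
  have i1: "integrable lborel (\<lambda>x. \<theta> i * (cell m i K x * (deriv ^^ l) \<phi> x))" for i
    by (intro integrable_mult_right cell_integrable_mult[OF m K c])
  have i2: "integrable lborel (\<lambda>x. \<theta> i * (cell m i g x * \<phi> x))" for i
    using c[of 0] by (intro integrable_mult_right cell_integrable_mult[OF m g]) simp
  have "(\<integral>x. cell_sum m K \<theta> x * (deriv ^^ l) \<phi> x \<partial>lborel) = (\<integral>x. (\<Sum>i<m. \<theta> i * (cell m i K x * (deriv ^^ l) \<phi> x)) \<partial>lborel)"
    by (simp add: cell_sum_def sum_distrib_right mult.assoc)
  also have "\<dots> = (\<Sum>i<m. \<theta> i * (\<integral>x. cell m i K x * (deriv ^^ l) \<phi> x \<partial>lborel))"
    using i1 by (simp add: Bochner_Integration.integral_sum)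
  also have "\<dots> = (-1) ^ l * (real m ^ l * (\<Sum>i<m. \<theta> i * (\<integral>x. cell m i g x * \<phi> x \<partial>lborel)))"
    unfolding cell_weak_derivative[OF m w \<phi>] by (simp add: sum_distrib_left mult_ac)
  also have "(\<Sum>i<m. \<theta> i * (\<integral>x. cell m i g x * \<phi> x \<partial>lborel)) = (\<integral>x. (\<Sum>i<m. \<theta> i * (cell m i g x * \<phi> x)) \<partial>lborel)"
    using i2 by (simp add: Bochner_Integration.integral_sum)
  also have "\<dots> = (\<integral>x. cell_sum m g \<theta> x * \<phi> x \<partial>lborel)"
    by (simp add: cell_sum_def sum_distrib_right mult.assoc)
  also have "real m ^ l * \<dots> = (\<integral>x. real m ^ l * cell_sum m g \<theta> x * \<phi> x \<partial>lborel)"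
    by (simp add: mult.assoc)
  finally show "(\<integral>x. cell_sum m K \<theta> x * (deriv ^^ l) \<phi> x \<partial>lborel) = (-1) ^ l * (\<integral>x. real m ^ l * cell_sum m g \<theta> x * \<phi> x \<partial>lborel)" .
qed

lemma is_weak_derivative_restrict:
  assumes w: "is_weak_derivative UNIV l f g" and z: "\<And>x. x \<notin> {a..b} \<Longrightarrow> f x = 0" "\<And>x. x \<notin> {a..b} \<Longrightarrow> g x = 0"
  shows "is_weak_derivative {a..b} l f g"
  unfolding is_weak_derivative_def
proof (intro allI impI)
  fix \<phi> assume "test_function (interior {a..b}) \<phi>"
  then have "test_function UNIV \<phi>" by (rule test_function_mono) simp
  moreover have "indicator {a..b} x *\<^sub>R (f x * u x) = f x * u x" "indicator {a..b} x *\<^sub>R (g x * u x) = g x * u x" for x u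
    using z[of x] by (cases "x \<in> {a..b}"; simp)+
  ultimately show "(LINT x:{a..b}|lborel. f x * (deriv ^^ l) \<phi> x) = (- 1) ^ l * (LINT x:{a..b}|lborel. g x * \<phi> x)"
    using w unfolding set_lebesgue_integral_def is_weak_derivative_UNIV by (simp only:)
qed

lemma set_integral_eq_integral_support:
  assumes "\<And>x. x \<notin> A \<Longrightarrow> f x = (0 :: real)"
  shows "(LINT x:A|lborel. f x) = (\<integral>x. f x \<partial>lborel)"
proof -
  have "indicator A x *\<^sub>R f x = f x" for x using assms[of x] by (cases "x \<in> A") auto
  then show ?thesis unfolding set_lebesgue_integral_def by (simp only:)
qed

lemma L2_on_UNIV_restrict: "L2_on UNIV f \<Longrightarrow> L2_on {a..b} f"
  by (erule L2_on_subset) simp_all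

text \<open>By orthogonality the squared norms of the sum and of its weak derivative are bounded by
  \<open>|\<theta>|\<^sup>2\<close> times those of the kernel, for the derivative with a factor
  \<open>m ^ (2 * \<beta>)\<close> from rescaling. The same factor, at least 1, is spent on the
  first norm to reach a multiple of the full Sobolev norm.\<close>

lemma cell_sum_sobolev:
  assumes m: "m \<ge> 1" and \<beta>: "\<beta> \<ge> 1" and K: "K \<in> sobolev_space \<beta> UNIV" and Kz: "\<And>x. x \<notin> {-1/2..1/2} \<Longrightarrow> K x = 0"
  shows "cell_sum m K \<theta> \<in> sobolev_space \<beta> {0..1}"
    "(sobolev_norm \<beta> {0..1} (cell_sum m K \<theta>))\<^sup>2 \<le> (\<Sum>i<m. (\<theta> i)\<^sup>2) * (real m ^ \<beta> * sobolev_norm \<beta> UNIV K)\<^sup>2"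
proof -
  define f where "f = cell_sum m K \<theta>"
  have KL: "L2_unit_cell K" using K Kz by (simp add: L2_unit_cell_def sobolev_space_def)
  have fL: "L2_on UNIV f" and f2: "(\<integral>x. (f x)\<^sup>2 \<partial>lborel) = (\<Sum>i<m. (\<theta> i)\<^sup>2) * (\<integral>x. (K x)\<^sup>2 \<partial>lborel)"
    unfolding f_def by (rule cell_sum_sq[OF m KL])+
  have fz: "f x = 0" if "x \<notin> {0..1}" for x unfolding f_def by (rule cell_sum_eq_0[OF m KL that])
  have der: "L2_on {0..1} (\<lambda>x. real m ^ l * cell_sum m g' \<theta> x)
      \<and> is_weak_derivative {0..1} l f (\<lambda>x. real m ^ l * cell_sum m g' \<theta> x)
      \<and> (LINT x:{0..1}|lborel. (real m ^ l * cell_sum m g' \<theta> x)\<^sup>2) \<le> (\<Sum>i<m. (\<theta> i)\<^sup>2) * (real m ^ l)\<^sup>2 * (\<integral>x. (g x)\<^sup>2 \<partial>lborel)"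
    if g: "L2_on UNIV g" "is_weak_derivative UNIV l K g" and g': "g' = (\<lambda>x. indicator {-1/2..1/2} x * g x)" for l g g'
  proof -
    have loc: "L2_on UNIV g'" "is_weak_derivative UNIV l K g'" "(\<integral>x. (g' x)\<^sup>2 \<partial>lborel) \<le> (\<integral>x. (g x)\<^sup>2 \<partial>lborel)"
      unfolding g' by (rule localized_weak_derivative[OF g Kz]; assumption)+
    have gL: "L2_unit_cell g'" using loc by (simp add: L2_unit_cell_def g')
    have s: "L2_on UNIV (cell_sum m g' \<theta>)" "(\<integral>x. (cell_sum m g' \<theta> x)\<^sup>2 \<partial>lborel) = (\<Sum>i<m. (\<theta> i)\<^sup>2) * (\<integral>x. (g' x)\<^sup>2 \<partial>lborel)"
      by (rule cell_sum_sq[OF m gL])+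
    have z: "real m ^ l * cell_sum m g' \<theta> x = 0" if "x \<notin> {0..1}" for x
      using cell_sum_eq_0[OF m gL that] by simp
    have "L2_on UNIV (\<lambda>x. real m ^ l * cell_sum m g' \<theta> x)"
      using s(1) by (auto simp: L2_on_UNIV power_mult_distrib)
    moreover have "is_weak_derivative {0..1} l f (\<lambda>x. real m ^ l * cell_sum m g' \<theta> x)"
      unfolding f_def using loc z fz[unfolded f_def]
      by (intro is_weak_derivative_restrict cell_sum_weak_derivative[OF m KL gL])
    moreover have "(LINT x:{0..1}|lborel. (real m ^ l * cell_sum m g' \<theta> x)\<^sup>2)
        = (\<integral>x. (real m ^ l * cell_sum m g' \<theta> x)\<^sup>2 \<partial>lborel)"
      using z by (intro set_integral_eq_integral_support) simp
    moreover have "\<dots> = (real m ^ l)\<^sup>2 * ((\<Sum>i<m. (\<theta> i)\<^sup>2) * (\<integral>x. (g' x)\<^sup>2 \<partial>lborel))"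
      using s(2) by (simp add: power_mult_distrib)
    moreover have "\<dots> \<le> (real m ^ l)\<^sup>2 * ((\<Sum>i<m. (\<theta> i)\<^sup>2) * (\<integral>x. (g x)\<^sup>2 \<partial>lborel))"
      using loc(3) by (intro mult_left_mono sum_nonneg) simp_all
    ultimately show ?thesis by (simp add: mult_ac L2_on_UNIV_restrict)
  qed
  have "\<exists>h. L2_on {0..1} h \<and> is_weak_derivative {0..1} l f h" if "l \<in> {1..\<beta>}" for l
  proof -
    have "\<exists>g. L2_on UNIV g \<and> is_weak_derivative UNIV l K g"
      using K that unfolding sobolev_space_def mem_Collect_eq by blast
    then obtain g where "L2_on UNIV g" "is_weak_derivative UNIV l K g" by (elim exE conjE)
    from der[OF this refl] show ?thesis by blast
  qed
  then show "cell_sum m K \<theta> \<in> sobolev_space \<beta> {0..1}"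
    using L2_on_UNIV_restrict[OF fL] by (simp add: sobolev_space_def f_def)
  \<comment> \<open>The very weak derivative that enters \<open>sobolev_norm \<beta> UNIV K\<close>,
    so that its norm appears in the bound.\<close>
  define g where "g = weak_derivative UNIV \<beta> K"
  have "\<exists>g. L2_on UNIV g \<and> is_weak_derivative UNIV \<beta> K g" using K \<beta> by (simp add: sobolev_space_def)
  from someI_ex[OF this] have g: "L2_on UNIV g" "is_weak_derivative UNIV \<beta> K g"
    unfolding g_def weak_derivative_def by simp_all
  define g' where "g' = (\<lambda>x. indicator {-1/2..1/2} x * g x)"
  define G where "G x = real m ^ \<beta> * cell_sum m g' \<theta> x" for x
  have G: "L2_on {0..1} G" "is_weak_derivative {0..1} \<beta> f G"
    "(LINT x:{0..1}|lborel. (G x)\<^sup>2) \<le> (\<Sum>i<m. (\<theta> i)\<^sup>2) * (real m ^ \<beta>)\<^sup>2 * (\<integral>x. (g x)\<^sup>2 \<partial>lborel)"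
    using der[OF g g'_def] by (simp_all add: G_def[abs_def])
  \<comment> \<open>The norm on \<open>{0..1}\<close> uses an unspecified choice \<open>H\<close>;
    uniqueness identifies it almost everywhere with the explicit \<open>G\<close>, the two endpoints
    being null.\<close>
  define H where "H = weak_derivative {0..1} \<beta> f"
  have H: "L2_on {0..1} H" "is_weak_derivative {0..1} \<beta> f H"
    using someI[of "\<lambda>h. L2_on {0..1} h \<and> is_weak_derivative {0..1} \<beta> f h" G] G(1,2)
    unfolding H_def weak_derivative_def by simp_all
  have "AE x in lborel. x \<in> {0<..<1} \<longrightarrow> G x = H x"
    by (rule weak_derivative_AE_unique[OF G(1) H(1) G(2) H(2)])
  moreover have "AE x in lborel. x \<noteq> (0 :: real)" "AE x in lborel. x \<noteq> (1 :: real)" by (rule AE_lborel_singleton)+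
  ultimately have ae: "AE x in lborel. indicator {0..1} x *\<^sub>R (H x)\<^sup>2 = indicator {0..1} x *\<^sub>R (G x)\<^sup>2"
    by eventually_elim (auto simp: indicator_def)
  have HG: "(LINT x:{0..1}|lborel. (H x)\<^sup>2) = (LINT x:{0..1}|lborel. (G x)\<^sup>2)"
    unfolding set_lebesgue_integral_def using H(1) G(1) ae
    by (intro integral_cong_AE) (auto simp: L2_on_def set_integrable_def)
  have "(sobolev_norm \<beta> {0..1} f)\<^sup>2 = (LINT x:{0..1}|lborel. (f x)\<^sup>2) + (LINT x:{0..1}|lborel. (H x)\<^sup>2)"
    unfolding sobolev_norm_def H_def[symmetric] by (simp add: L2_norm_on_sq[symmetric])
  also have "\<dots> \<le> (\<Sum>i<m. (\<theta> i)\<^sup>2) * (\<integral>x. (K x)\<^sup>2 \<partial>lborel) + (\<Sum>i<m. (\<theta> i)\<^sup>2) * (real m ^ \<beta>)\<^sup>2 * (\<integral>x. (g x)\<^sup>2 \<partial>lborel)"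
  proof -
    have "(LINT x:{0..1}|lborel. (f x)\<^sup>2) = (\<integral>x. (f x)\<^sup>2 \<partial>lborel)"
      by (rule set_integral_eq_integral_support) (simp add: fz)
    then show ?thesis using f2 G(3) HG by linarith
  qed
  also have "\<dots> \<le> (\<Sum>i<m. (\<theta> i)\<^sup>2) * (real m ^ \<beta>)\<^sup>2 * (\<integral>x. (K x)\<^sup>2 \<partial>lborel) + (\<Sum>i<m. (\<theta> i)\<^sup>2) * (real m ^ \<beta>)\<^sup>2 * (\<integral>x. (g x)\<^sup>2 \<partial>lborel)"
  proof -
    have "1 \<le> (real m ^ \<beta>)\<^sup>2" using m by (simp add: one_le_power)
    then have "(\<Sum>i<m. (\<theta> i)\<^sup>2) * 1 \<le> (\<Sum>i<m. (\<theta> i)\<^sup>2) * (real m ^ \<beta>)\<^sup>2"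
      by (intro mult_left_mono sum_nonneg) auto
    then have "(\<Sum>i<m. (\<theta> i)\<^sup>2) * 1 * (\<integral>x. (K x)\<^sup>2 \<partial>lborel) \<le> (\<Sum>i<m. (\<theta> i)\<^sup>2) * (real m ^ \<beta>)\<^sup>2 * (\<integral>x. (K x)\<^sup>2 \<partial>lborel)"
      by (intro mult_right_mono) auto
    then show ?thesis by simp
  qed
  also have "\<dots> = (\<Sum>i<m. (\<theta> i)\<^sup>2) * (real m ^ \<beta>)\<^sup>2 * (sobolev_norm \<beta> UNIV K)\<^sup>2"
    unfolding sobolev_norm_def g_def[symmetric] L2_norm_on_sq by (simp add: set_lebesgue_integral_def algebra_simps)
  finally show "(sobolev_norm \<beta> {0..1} (cell_sum m K \<theta>))\<^sup>2 \<le> (\<Sum>i<m. (\<theta> i)\<^sup>2) * (real m ^ \<beta> * sobolev_norm \<beta> UNIV K)\<^sup>2"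
    by (simp add: f_def power_mult_distrib mult.assoc)
qed

section \<open>The variance bound\<close>

lemma L2_mult_integrable:
  fixes a b :: "'a \<Rightarrow> real"
  assumes [measurable]: "a \<in> borel_measurable M" "b \<in> borel_measurable M"
    and i: "integrable M (\<lambda>x. (a x)\<^sup>2)" "integrable M (\<lambda>x. (b x)\<^sup>2)"
  shows "integrable M (\<lambda>x. a x * b x)"
proof (rule Bochner_Integration.integrable_bound[OF Bochner_Integration.integrable_add[OF i]])
  have "\<bar>s * t\<bar> \<le> s\<^sup>2 + t\<^sup>2" for s t :: real
  proof -
    have "2 * (\<bar>s\<bar> * \<bar>t\<bar>) \<le> \<bar>s\<bar>\<^sup>2 + \<bar>t\<bar>\<^sup>2"
      using sum_squares_bound[of "\<bar>s\<bar>" "\<bar>t\<bar>"] by (simp add: mult.assoc)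
    moreover have "0 \<le> \<bar>s\<bar> * \<bar>t\<bar>" by simp
    ultimately have "\<bar>s\<bar> * \<bar>t\<bar> \<le> \<bar>s\<bar>\<^sup>2 + \<bar>t\<bar>\<^sup>2" by linarith
    then show ?thesis by (simp add: abs_mult)
  qed
  then show "AE x in M. norm (a x * b x) \<le> norm ((a x)\<^sup>2 + (b x)\<^sup>2)" by (intro AE_I2) simp
qed measurable

lemma Cauchy_Schwarz_integral:
  fixes a b :: "'a \<Rightarrow> real"
  assumes [measurable]: "a \<in> borel_measurable M" "b \<in> borel_measurable M"
    and i: "integrable M (\<lambda>x. (a x)\<^sup>2)" "integrable M (\<lambda>x. (b x)\<^sup>2)"
    and nn: "\<And>x. 0 \<le> a x" "\<And>x. 0 \<le> b x"
  shows "(\<integral>x. a x * b x \<partial>M) \<le> sqrt (\<integral>x. (a x)\<^sup>2 \<partial>M) * sqrt (\<integral>x. (b x)\<^sup>2 \<partial>M)"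
proof -
  have "ennreal ((\<integral>x. a x * b x \<partial>M)\<^sup>2) = (\<integral>\<^sup>+x. ennreal (a x) * ennreal (b x) \<partial>M)\<^sup>2"
    using nn nn_integral_eq_integral[OF L2_mult_integrable[OF assms(1-4)]]
    by (simp add: ennreal_mult[symmetric] ennreal_power)
  also have "\<dots> \<le> (\<integral>\<^sup>+x. (ennreal (a x))\<^sup>2 \<partial>M) * (\<integral>\<^sup>+x. (ennreal (b x))\<^sup>2 \<partial>M)"
    by (intro Cauchy_Schwarz_nn_integral) auto
  also have "\<dots> = ennreal ((\<integral>x. (a x)\<^sup>2 \<partial>M) * (\<integral>x. (b x)\<^sup>2 \<partial>M))"
    using nn nn_integral_eq_integral[OF i(1)] nn_integral_eq_integral[OF i(2)]
    by (simp add: ennreal_power ennreal_mult)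
  finally have "(\<integral>x. a x * b x \<partial>M)\<^sup>2 \<le> (\<integral>x. (a x)\<^sup>2 \<partial>M) * (\<integral>x. (b x)\<^sup>2 \<partial>M)"
    by (simp add: ennreal_le_iff)
  then show ?thesis by (metis real_le_rsqrt real_sqrt_mult)
qed

lemma cell_sum_mult_integral:
  assumes m: "m \<ge> 1" and K: "L2_unit_cell K"
    and u: "u \<in> borel_measurable borel" "integrable lborel (\<lambda>x. (u x)\<^sup>2)"
  shows "integrable lborel (\<lambda>x. u x * cell m i K x)"
    "(\<integral>x. u x * cell_sum m K c x \<partial>lborel) = (\<Sum>i<m. c i * (\<integral>x. u x * cell m i K x \<partial>lborel))"
proof -
  show i: "integrable lborel (\<lambda>x. u x * cell m i K x)" for i
    using u cell_sq[OF m K] cell_borel[OF K] by (intro L2_mult_integrable) auto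
  have "u x * cell_sum m K c x = (\<Sum>i<m. c i * (u x * cell m i K x))" for x
    by (simp add: cell_sum_def sum_distrib_left mult.left_commute)
  then show "(\<integral>x. u x * cell_sum m K c x \<partial>lborel) = (\<Sum>i<m. c i * (\<integral>x. u x * cell m i K x \<partial>lborel))"
    using i by (simp add: Bochner_Integration.integral_sum)
qed

text \<open>Expand the squared distance of \<open>u\<close> from its projection \<open>S\<close>
  onto the span of the cells.\<close>

lemma cell_Bessel:
  assumes m: "m \<ge> 1" and K: "L2_unit_cell K" "(\<integral>x. (K x)\<^sup>2 \<partial>lborel) = 1"
    and u: "u \<in> borel_measurable borel" "integrable lborel (\<lambda>x. (u x)\<^sup>2)"
  shows "(\<Sum>i<m. (\<integral>x. u x * cell m i K x \<partial>lborel)\<^sup>2) \<le> (\<integral>x. (u x)\<^sup>2 \<partial>lborel)"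
proof -
  define c where "c i = (\<integral>x. u x * cell m i K x \<partial>lborel)" for i
  define S where "S = cell_sum m K c"
  have S: "S \<in> borel_measurable borel" "integrable lborel (\<lambda>x. (S x)\<^sup>2)" "(\<integral>x. (S x)\<^sup>2 \<partial>lborel) = (\<Sum>i<m. (c i)\<^sup>2)"
    using cell_sum_sq[OF m K(1), of c] K(2) by (simp_all add: S_def L2_on_UNIV)
  have uS: "(\<integral>x. u x * S x \<partial>lborel) = (\<Sum>i<m. (c i)\<^sup>2)"
    unfolding S_def cell_sum_mult_integral(2)[OF m K(1) u] by (simp add: c_def power2_eq_square)
  have iuS: "integrable lborel (\<lambda>x. u x * S x)" using u S by (intro L2_mult_integrable) auto
  have "0 \<le> (\<integral>x. (u x - S x)\<^sup>2 \<partial>lborel)" by simp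
  also have "\<dots> = (\<integral>x. ((u x)\<^sup>2 + (S x)\<^sup>2) - 2 * (u x * S x) \<partial>lborel)"
    by (simp add: power2_diff mult.assoc)
  also have "\<dots> = (\<integral>x. (u x)\<^sup>2 \<partial>lborel) + (\<Sum>i<m. (c i)\<^sup>2) - 2 * (\<Sum>i<m. (c i)\<^sup>2)"
    using u(2) S(2,3) iuS uS by simp
  finally show ?thesis by (simp add: c_def)
qed

section \<open>The information bound for an estimator\<close>

text \<open>Joint measurability passes through integration in \<open>y\<close>. The mean comes first
  because it enters the integrand of the variance.\<close>

lemma estimator_mean_measurable:
  fixes fhat :: "(real \<Rightarrow> real) \<Rightarrow> real \<Rightarrow> real"
  assumes fhat: "(\<lambda>(y, x). fhat y x) \<in> borel_measurable (path_space \<Otimes>\<^sub>M restrict_space borel {0..1})"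
    and P: "sigma_finite_measure P" "sets P = sets path_space"
  shows "(\<lambda>x. (\<integral>y. fhat y x \<partial>P)) \<in> borel_measurable (restrict_space borel {0..1})"
    "(\<lambda>x. ext_variance P (\<lambda>y. fhat y x)) \<in> borel_measurable (restrict_space borel {0..1})"
proof -
  interpret P: sigma_finite_measure P by fact
  let ?X = "restrict_space borel {0..1::real}"
  have "(\<lambda>(x, y). fhat y x) \<in> borel_measurable (?X \<Otimes>\<^sub>M path_space)"
    using measurable_pair_swap[OF fhat] by simp
  then have j: "(\<lambda>(x, y). fhat y x) \<in> borel_measurable (?X \<Otimes>\<^sub>M P)"
    using P(2) by (simp cong: measurable_cong_sets sets_pair_measure_cong)
  then show G: "(\<lambda>x. (\<integral>y. fhat y x \<partial>P)) \<in> borel_measurable ?X"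
    by (rule P.borel_measurable_lebesgue_integral)
  have "(\<lambda>p. ennreal (((case p of (x, y) \<Rightarrow> fhat y x) - (\<integral>z. fhat z (fst p) \<partial>P))\<^sup>2)) \<in> borel_measurable (?X \<Otimes>\<^sub>M P)"
    using j measurable_compose[OF measurable_fst G, of P] by measurable
  then have "(\<lambda>(x, y). ennreal ((fhat y x - (\<integral>z. fhat z x \<partial>P))\<^sup>2)) \<in> borel_measurable (?X \<Otimes>\<^sub>M P)"
    by (simp add: case_prod_beta')
  then show "(\<lambda>x. ext_variance P (\<lambda>y. fhat y x)) \<in> borel_measurable ?X"
    unfolding ext_variance_def by (rule P.borel_measurable_nn_integral)
qed

text \<open>\<open>lattice_information_bound\<close> is applied to the coefficients \<open>g\<close>
  of the mean of the estimator, with rate \<open>n\<close> and \<open>S = sqrt (real m * V)\<close>.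
  Its conclusion, that \<open>m / 2\<close> is at most \<open>sqrt (n * m * V)\<close>, squares to
  the claim.\<close>

lemma white_noise_variance_bound:
  fixes M :: "'w measure" and W :: "real \<Rightarrow> 'w \<Rightarrow> real" and n \<beta> m :: nat and R V :: real
  defines "P \<equiv> white_noise_law M W n"
  assumes bm: "standard_brownian_motion M W" and n: "n \<ge> 1" and \<beta>: "\<beta> \<ge> 1" and m: "m \<ge> 1"
    and R: "R > 2 * Gamma_const \<beta>"
    and fhat: "fhat \<in> estimators (sobolev_ball \<beta> R) P"
    and bias: "\<And>f. f \<in> sobolev_ball \<beta> R \<Longrightarrow> IBias_sq P f fhat \<le> ennreal ((1 / real m ^ \<beta>)\<^sup>2)"
    and var: "\<And>f. f \<in> sobolev_ball \<beta> R \<Longrightarrow> IVar P f fhat \<le> ennreal V" and V: "V \<ge> 0"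
  shows "real m / (4 * real n) \<le> V"
proof -
  \<comment> \<open>The strict inequality \<open>Gamma_const \<beta> < R / 2\<close> yields an
    actual kernel below \<open>R / 2\<close>, whether or not the infimum is attained.\<close>
  have "\<exists>s\<in>{sobolev_norm \<beta> UNIV K | K. K \<in> sobolev_space \<beta> UNIV \<and> L2_norm_on UNIV K = 1 \<and>
     closure {x. K x \<noteq> 0} \<subseteq> {-1/2..1/2}}. s < R / 2"
    using R Gamma_const_nonempty[of \<beta>] unfolding Gamma_const_def by (intro cInf_lessD) auto
  then obtain K where K: "K \<in> sobolev_space \<beta> UNIV" "L2_norm_on UNIV K = 1" "closure {x. K x \<noteq> 0} \<subseteq> {-1/2..1/2}"
    and KR: "sobolev_norm \<beta> UNIV K < R / 2" by blast
  have Kz: "K x = 0" if "x \<notin> {-1/2..1/2}" for x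
  proof (rule ccontr)
    assume "K x \<noteq> 0"
    then have "x \<in> closure {x. K x \<noteq> 0}" by (intro subsetD[OF closure_subset]) simp
    then have "x \<in> {-1/2..1/2}" by (rule subsetD[OF K(3)])
    then show False using that by (rule notE[rotated])
  qed
  have KL: "L2_unit_cell K" using K(1) Kz by (simp add: L2_unit_cell_def sobolev_space_def)
  have K1: "(\<integral>x. (K x)\<^sup>2 \<partial>lborel) = 1"
    using L2_norm_on_sq[of UNIV K] K(2) by (simp add: set_lebesgue_integral_def)
  define \<kappa> where "\<kappa> = sobolev_norm \<beta> UNIV K"
  have \<kappa>: "\<kappa> > 0" unfolding \<kappa>_def sobolev_norm_def K(2) by (simp add: add_pos_nonneg)
  define r where "r = 1 / real m ^ \<beta>"
  \<comment> \<open>The coefficient norm up to which \<open>cell_sum_sobolev\<close> guarantees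
    membership in the ball of radius \<open>R\<close>.\<close>
  define \<rho> where "\<rho> = R / (real m ^ \<beta> * \<kappa>)"
  have mb: "real m ^ \<beta> > 0" using m by simp
  have r: "r > 0" using mb by (simp add: r_def)
  have R0: "R > 0" using KR \<kappa> by (simp add: \<kappa>_def)
  have r\<rho>: "2 * r < \<rho>" using KR \<kappa> mb by (simp add: r_def \<rho>_def \<kappa>_def[symmetric] field_simps)

  define F where "F \<theta> = cell_sum m K \<theta>" for \<theta>
  have FL: "L2_on UNIV (F \<theta>)" for \<theta> unfolding F_def by (rule cell_sum_sq(1)[OF m KL])
  have FL01: "L2_on {0..1} (F \<theta>)" for \<theta> by (rule L2_on_UNIV_restrict[OF FL])
  have Fz: "F \<theta> x = 0" if "x \<notin> {0..1}" for \<theta> x unfolding F_def by (rule cell_sum_eq_0[OF m KL that])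
  have ball: "F \<theta> \<in> sobolev_ball \<beta> R" if "(\<Sum>i<m. (\<theta> i)\<^sup>2) \<le> \<rho>\<^sup>2" for \<theta>
  proof -
    have "(sobolev_norm \<beta> {0..1} (F \<theta>))\<^sup>2 \<le> (\<Sum>i<m. (\<theta> i)\<^sup>2) * (real m ^ \<beta> * \<kappa>)\<^sup>2"
      unfolding F_def \<kappa>_def by (rule cell_sum_sobolev(2)[OF m \<beta> K(1) Kz])
    also have "\<dots> \<le> \<rho>\<^sup>2 * (real m ^ \<beta> * \<kappa>)\<^sup>2" using that by (rule mult_right_mono) simp
    also have "\<dots> = R\<^sup>2" using mb \<kappa> by (simp add: \<rho>_def power_mult_distrib[symmetric])
    finally have "(sobolev_norm \<beta> {0..1} (F \<theta>))\<^sup>2 \<le> R\<^sup>2" .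
    then have "sobolev_norm \<beta> {0..1} (F \<theta>) \<le> R" by (rule power2_le_imp_le) (use R0 in simp)
    moreover have "F \<theta> \<in> sobolev_space \<beta> {0..1}" unfolding F_def by (rule cell_sum_sobolev(1)[OF m \<beta> K(1) Kz])
    ultimately show ?thesis by (simp add: sobolev_ball_def)
  qed

  interpret M: prob_space M using bm by (simp add: standard_brownian_motion_def)
  have Pp: "prob_space (P (F \<theta>))" for \<theta>
    unfolding P_def white_noise_law_def
    by (intro M.prob_space_distr white_noise_data_measurable[OF bm] L2_on_integrable FL01)
  have Ps: "sets (P f) = sets path_space" for f by (simp add: P_def white_noise_law_def)
  have joint: "(\<lambda>(y, x). fhat y x) \<in> borel_measurable (path_space \<Otimes>\<^sub>M restrict_space borel {0..1})"
    and int: "\<And>f x. f \<in> sobolev_ball \<beta> R \<Longrightarrow> x \<in> {0..1} \<Longrightarrow> integrable (P f) (\<lambda>y. fhat y x)"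
    using fhat by (auto simp: estimators_def)
  have em: "(\<lambda>x. (\<integral>y. fhat y x \<partial>(P (F \<theta>)))) \<in> borel_measurable (restrict_space borel {0..1})"
    "(\<lambda>x. ext_variance (P (F \<theta>)) (\<lambda>y. fhat y x)) \<in> borel_measurable (restrict_space borel {0..1})" for \<theta>
    by (rule estimator_mean_measurable[OF joint prob_space_imp_sigma_finite[OF Pp] Ps])+

  define G where "G \<theta> x = (\<integral>y. fhat y x \<partial>(P (F \<theta>))) * indicator {0..1} x" for \<theta> x
  have Gm: "G \<theta> \<in> borel_measurable borel" for \<theta>
    using em(1)[of \<theta>] unfolding G_def[abs_def] by (subst (asm) borel_measurable_restrict_space_iff) (auto simp: mult.commute)
  define B where "B \<theta> x = G \<theta> x - F \<theta> x" for \<theta> x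
  have Fm: "F \<theta> \<in> borel_measurable borel" and F2: "integrable lborel (\<lambda>x. (F \<theta> x)\<^sup>2)" for \<theta>
    using FL by (simp_all add: L2_on_UNIV)
  have Bm: "B \<theta> \<in> borel_measurable borel" for \<theta>
    unfolding B_def[abs_def] using Gm Fm by simp
  have B2: "integrable lborel (\<lambda>x. (B \<theta> x)\<^sup>2)" "(\<integral>x. (B \<theta> x)\<^sup>2 \<partial>lborel) \<le> r\<^sup>2"
    if \<theta>: "(\<Sum>i<m. (\<theta> i)\<^sup>2) \<le> \<rho>\<^sup>2" for \<theta>
  proof -
    have "ennreal ((B \<theta> x)\<^sup>2) = ennreal (((\<integral>y. fhat y x \<partial>(P (F \<theta>))) - F \<theta> x)\<^sup>2) * indicator {0..1} x" for x
      using Fz[of x \<theta>] by (cases "x \<in> {0..1}") (simp_all add: B_def G_def)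
    then have le: "(\<integral>\<^sup>+x. ennreal ((B \<theta> x)\<^sup>2) \<partial>lborel) \<le> ennreal (r\<^sup>2)"
      using bias[OF ball[OF \<theta>]] by (simp add: IBias_sq_def r_def)
    then show i: "integrable lborel (\<lambda>x. (B \<theta> x)\<^sup>2)"
      using Bm by (intro integrableI_nonneg) (auto intro: order_le_less_trans)
    show "(\<integral>x. (B \<theta> x)\<^sup>2 \<partial>lborel) \<le> r\<^sup>2"
      using le nn_integral_eq_integral[OF i] by (simp add: ennreal_le_iff)
  qed
  have G2: "integrable lborel (\<lambda>x. (G \<theta> x)\<^sup>2)" if "(\<Sum>i<m. (\<theta> i)\<^sup>2) \<le> \<rho>\<^sup>2" for \<theta>
  proof -
    have "(G \<theta> x)\<^sup>2 = (B \<theta> x)\<^sup>2 + (2 * (B \<theta> x * F \<theta> x) + (F \<theta> x)\<^sup>2)" for x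
      by (simp add: B_def power2_eq_square algebra_simps)
    then show ?thesis
      using B2[OF that] F2[of \<theta>] L2_mult_integrable[OF _ _ B2(1)[OF that] F2, of \<theta>] Bm Fm by simp
  qed
  define g where "g \<theta> i = (\<integral>x. G \<theta> x * cell m i K x \<partial>lborel)" for \<theta> i
  have g_bias: "(\<Sum>i<m. (g \<theta> i - \<theta> i)\<^sup>2) \<le> r\<^sup>2" if \<theta>: "(\<Sum>i<m. (\<theta> i)\<^sup>2) \<le> \<rho>\<^sup>2" for \<theta>
  proof -
    have "g \<theta> i - \<theta> i = (\<integral>x. B \<theta> x * cell m i K x \<partial>lborel)" if i: "i < m" for i
    proof -
      have "cell m i K \<in> borel_measurable borel" by (rule cell_borel[OF KL])
      from cell_sum_mult_integral(2)[OF m KL this cell_sq(1)[OF m KL], of \<theta>]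
      have "(\<integral>x. F \<theta> x * cell m i K x \<partial>lborel) = (\<Sum>j<m. \<theta> j * (\<integral>x. cell m i K x * cell m j K x \<partial>lborel))"
        by (simp add: F_def mult.commute)
      also have "\<dots> = (\<Sum>j<m. if i = j then \<theta> j else 0)"
        using cell_orthogonal(2)[OF m KL] K1 by (intro sum.cong) auto
      also have "\<dots> = \<theta> i" using i by simp
      finally have "(\<integral>x. F \<theta> x * cell m i K x \<partial>lborel) = \<theta> i" .
      then show ?thesis
        using cell_sum_mult_integral(1)[OF m KL Fm[of \<theta>] F2[of \<theta>], of i] cell_sum_mult_integral(1)[OF m KL Gm G2[OF \<theta>], of i]
        by (simp add: g_def B_def left_diff_distrib)
    qed
    then have "(\<Sum>i<m. (g \<theta> i - \<theta> i)\<^sup>2) = (\<Sum>i<m. (\<integral>x. B \<theta> x * cell m i K x \<partial>lborel)\<^sup>2)" by simp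
    also have "\<dots> \<le> (\<integral>x. (B \<theta> x)\<^sup>2 \<partial>lborel)" by (rule cell_Bessel[OF m KL K1 Bm B2(1)[OF \<theta>]])
    also have "\<dots> \<le> r\<^sup>2" by (rule B2(2)[OF \<theta>])
    finally show ?thesis .
  qed

  define ev where "ev \<theta> x = ext_variance (P (F \<theta>)) (\<lambda>y. fhat y x) * indicator {0..1} x" for \<theta> x
  \<comment> \<open>For admissible \<open>\<theta>\<close> the variance is infinite at most on a
    null set of \<open>x\<close>, where \<open>v\<close> takes the value 0.\<close>
  define v where "v \<theta> x = enn2real (ev \<theta> x)" for \<theta> x
  have v0: "v \<theta> x \<ge> 0" for \<theta> x by (simp add: v_def)
  have evm: "ev \<theta> \<in> borel_measurable borel" for \<theta>
    using em(2)[of \<theta>] unfolding ev_def[abs_def] by (subst (asm) borel_measurable_restrict_space_iff_ennreal) auto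
  have vm: "v \<theta> \<in> borel_measurable borel" for \<theta> unfolding v_def[abs_def] using evm by simp
  have evV: "(\<integral>\<^sup>+x. ev \<theta> x \<partial>lborel) \<le> ennreal V" if "(\<Sum>i<m. (\<theta> i)\<^sup>2) \<le> \<rho>\<^sup>2" for \<theta>
    using var[OF ball[OF that]] by (simp add: IVar_def ev_def)
  have ev_fin: "AE x in lborel. ev \<theta> x = ennreal (v \<theta> x)" if "(\<Sum>i<m. (\<theta> i)\<^sup>2) \<le> \<rho>\<^sup>2" for \<theta>
  proof -
    have "(\<integral>\<^sup>+x. ev \<theta> x \<partial>lborel) \<noteq> \<infinity>" using evV[OF that] by (auto simp: top_unique)
    then have "AE x in lborel. ev \<theta> x \<noteq> \<infinity>" using evm by (intro nn_integral_noteq_infinite) auto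
    then show ?thesis by (rule eventually_mono) (simp add: v_def less_top)
  qed
  have v_int: "integrable lborel (v \<theta>)" "(\<integral>x. v \<theta> x \<partial>lborel) \<le> V" if \<theta>: "(\<Sum>i<m. (\<theta> i)\<^sup>2) \<le> \<rho>\<^sup>2" for \<theta>
  proof -
    have "(\<integral>\<^sup>+x. ennreal (v \<theta> x) \<partial>lborel) = (\<integral>\<^sup>+x. ev \<theta> x \<partial>lborel)"
      using ev_fin[OF \<theta>] by (intro nn_integral_cong_AE) (auto elim: eventually_mono)
    then have le: "(\<integral>\<^sup>+x. ennreal (v \<theta> x) \<partial>lborel) \<le> ennreal V" using evV[OF \<theta>] by simp
    then show i: "integrable lborel (v \<theta>)"
      using vm by (intro integrableI_nonneg) (auto simp: v_def intro: order_le_less_trans)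
    show "(\<integral>x. v \<theta> x \<partial>lborel) \<le> V"
      using le nn_integral_eq_integral[OF i] V by (simp add: v0 ennreal_le_iff)
  qed

  \<comment> \<open>Absolute values give nonnegative cells with the same supports and norms, so one
    Cauchy-Schwarz can serve all directions.\<close>
  define K' where "K' x = \<bar>K x\<bar>" for x
  have K'L: "L2_unit_cell K'" and K'1: "(\<integral>x. (K' x)\<^sup>2 \<partial>lborel) = 1"
    using KL K1 by (auto simp: L2_unit_cell_def L2_on_UNIV K'_def[abs_def])
  have cK': "cell m i K' x = \<bar>cell m i K x\<bar>" for i x by (simp add: cell_def K'_def abs_mult)

  have incr: "(\<Sum>i<m. g (\<theta>(i := \<theta> i + \<delta>)) i - g \<theta> i) \<le> sqrt (exp (real n * \<delta>\<^sup>2) - 1) * sqrt (real m * V)"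
    if \<delta>: "\<delta> > 0" and \<theta>: "(\<Sum>i<m. (\<theta> i)\<^sup>2) \<le> \<rho>\<^sup>2"
      and \<theta>': "\<And>i. i < m \<Longrightarrow> (\<Sum>j<m. ((\<theta>(i := \<theta> i + \<delta>)) j)\<^sup>2) \<le> \<rho>\<^sup>2" for \<theta> \<delta>
  proof -
    define C where "C = exp (real n * \<delta>\<^sup>2)"
    have C: "C \<ge> 1" by (simp add: C_def)
    have sv: "(\<lambda>x. sqrt (v \<theta> x)) \<in> borel_measurable borel" "integrable lborel (\<lambda>x. (sqrt (v \<theta> x))\<^sup>2)"
    proof -
      have [measurable]: "v \<theta> \<in> borel_measurable borel" by (rule vm)
      show "(\<lambda>x. sqrt (v \<theta> x)) \<in> borel_measurable borel" by measurable
      show "integrable lborel (\<lambda>x. (sqrt (v \<theta> x))\<^sup>2)" using v_int(1)[OF \<theta>] by (simp add: v0)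
    qed
    have step: "g (\<theta>(i := \<theta> i + \<delta>)) i - g \<theta> i \<le> (\<integral>x. sqrt (C - 1) * (sqrt (v \<theta> x) * cell m i K' x) \<partial>lborel)"
      if i: "i < m" for i
    proof -
      define \<theta>1 where "\<theta>1 = \<theta>(i := \<theta> i + \<delta>)"
      have \<theta>1: "(\<Sum>j<m. (\<theta>1 j)\<^sup>2) \<le> \<rho>\<^sup>2" unfolding \<theta>1_def by (rule \<theta>'[OF i])
      have Fd: "F \<theta>1 x - F \<theta> x = \<delta> * cell m i K x" for x
      proof -
        have "F \<theta>1 x - F \<theta> x = (\<Sum>j<m. (\<theta>1 j - \<theta> j) * cell m j K x)"
          by (simp add: F_def cell_sum_def sum_subtractf left_diff_distrib)
        also have "\<dots> = (\<Sum>j<m. if j = i then \<delta> * cell m i K x else 0)"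
          by (intro sum.cong) (auto simp: \<theta>1_def)
        finally show ?thesis using i by simp
      qed
      \<comment> \<open>One coordinate step moves the function by \<open>\<delta>\<close> times a
        unit vector, hence the exponent \<open>n * \<delta>\<^sup>2\<close>.\<close>
      have "(LINT x:{0..1}|lborel. (F \<theta>1 x - F \<theta> x)\<^sup>2) = (\<integral>x. (F \<theta>1 x - F \<theta> x)\<^sup>2 \<partial>lborel)"
        by (rule set_integral_eq_integral_support) (simp add: Fz)
      also have "\<dots> = \<delta>\<^sup>2" using cell_sq(2)[OF m KL, of i] K1 by (simp add: Fd power_mult_distrib)
      finally have "chi_dominated (P (F \<theta>)) (P (F \<theta>1)) C"
        using chi_dominated_white_noise[OF bm FL01 FL01 n, of \<theta> \<theta>1] by (simp add: C_def P_def)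
      note dom = this
      have "AE x in lborel. \<bar>G \<theta>1 x - G \<theta> x\<bar> \<le> sqrt (C - 1) * sqrt (v \<theta> x)"
        using ev_fin[OF \<theta>]
      proof eventually_elim
        case (elim x)
        show ?case
        proof (cases "x \<in> {0..1}")
          case True
          have "((\<integral>y. fhat y x \<partial>(P (F \<theta>1))) - (\<integral>y. fhat y x \<partial>(P (F \<theta>))))\<^sup>2 \<le> (C - 1) * v \<theta> x"
            using elim True C
            by (intro chi_dominated_variance[OF Pp Pp dom] int ball \<theta> \<theta>1) (simp_all add: ev_def v_def)
          then have "(G \<theta>1 x - G \<theta> x)\<^sup>2 \<le> (C - 1) * v \<theta> x"
            using True by (simp add: G_def)
          then have "sqrt ((G \<theta>1 x - G \<theta> x)\<^sup>2) \<le> sqrt ((C - 1) * v \<theta> x)"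
            by (rule real_sqrt_le_mono)
          then show ?thesis by (simp add: real_sqrt_mult)
        qed (use C in \<open>simp add: G_def v_def\<close>)
      qed
      then have ae: "AE x in lborel. (G \<theta>1 x - G \<theta> x) * cell m i K x \<le> sqrt (C - 1) * (sqrt (v \<theta> x) * cell m i K' x)"
      proof eventually_elim
        case (elim x)
        have "(G \<theta>1 x - G \<theta> x) * cell m i K x \<le> \<bar>G \<theta>1 x - G \<theta> x\<bar> * \<bar>cell m i K x\<bar>" by (metis abs_ge_self abs_mult)
        also have "\<dots> \<le> (sqrt (C - 1) * sqrt (v \<theta> x)) * \<bar>cell m i K x\<bar>" using elim by (rule mult_right_mono) simp
        finally show ?case by (simp add: cK' mult.assoc)
      qed
      have i1: "integrable lborel (\<lambda>x. G \<theta>1 x * cell m i K x)" "integrable lborel (\<lambda>x. G \<theta> x * cell m i K x)"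
        by (rule cell_sum_mult_integral(1)[OF m KL Gm G2[OF \<theta>1]], rule cell_sum_mult_integral(1)[OF m KL Gm G2[OF \<theta>]])
      have "g \<theta>1 i - g \<theta> i = (\<integral>x. (G \<theta>1 x - G \<theta> x) * cell m i K x \<partial>lborel)"
        using i1 by (simp add: g_def left_diff_distrib)
      also have "\<dots> \<le> (\<integral>x. sqrt (C - 1) * (sqrt (v \<theta> x) * cell m i K' x) \<partial>lborel)"
        using ae i1 cell_sum_mult_integral(1)[OF m K'L sv]
        by (intro integral_mono_AE) (auto simp: left_diff_distrib)
      finally show ?thesis by (simp add: \<theta>1_def)
    qed
    \<comment> \<open>The disjoint absolute cells add up to a function of squared norm only
      \<open>m\<close>.\<close>
    have c1: "(\<integral>x. (cell_sum m K' (\<lambda>_. 1) x)\<^sup>2 \<partial>lborel) = real m"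
      "cell_sum m K' (\<lambda>_. 1) \<in> borel_measurable borel" "integrable lborel (\<lambda>x. (cell_sum m K' (\<lambda>_. 1) x)\<^sup>2)"
      using cell_sum_sq[OF m K'L, of "\<lambda>_. 1"] K'1 by (simp_all add: L2_on_UNIV)
    have "(\<Sum>i<m. g (\<theta>(i := \<theta> i + \<delta>)) i - g \<theta> i) \<le> (\<Sum>i<m. \<integral>x. sqrt (C - 1) * (sqrt (v \<theta> x) * cell m i K' x) \<partial>lborel)"
      using step by (intro sum_mono) auto
    also have "\<dots> = sqrt (C - 1) * (\<integral>x. sqrt (v \<theta> x) * cell_sum m K' (\<lambda>_. 1) x \<partial>lborel)"
      unfolding cell_sum_mult_integral(2)[OF m K'L sv] by (simp add: sum_distrib_left)
    also have "\<dots> \<le> sqrt (C - 1) * (sqrt (\<integral>x. (sqrt (v \<theta> x))\<^sup>2 \<partial>lborel) * sqrt (\<integral>x. (cell_sum m K' (\<lambda>_. 1) x)\<^sup>2 \<partial>lborel))"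
    proof (intro mult_left_mono Cauchy_Schwarz_integral)
      show "0 \<le> cell_sum m K' (\<lambda>_. 1) x" for x unfolding cell_sum_def by (intro sum_nonneg) (simp add: cK')
    qed (use sv c1 C in \<open>auto simp: v0\<close>)
    also have "\<dots> \<le> sqrt (C - 1) * (sqrt V * sqrt (real m))"
      unfolding c1(1) using v_int(2)[OF \<theta>] C
      by (intro mult_left_mono mult_right_mono) (auto simp: v0)
    also have "\<dots> = sqrt (exp (real n * \<delta>\<^sup>2) - 1) * sqrt (real m * V)"
      by (simp add: C_def real_sqrt_mult mult.commute)
    finally show ?thesis .
  qed

  have "real m / 2 \<le> sqrt (real n) * sqrt (real m * V)"
    by (rule lattice_information_bound[OF m r r\<rho> _ _ g_bias incr]) (use V in auto)
  then have "(real m / 2)\<^sup>2 \<le> (sqrt (real n) * sqrt (real m * V))\<^sup>2" by (intro power_mono) auto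
  then have "real m * (real m / 4) \<le> real m * (real n * V)"
    using V by (simp add: power_mult_distrib power2_eq_square mult_ac)
  then have "real m / 4 \<le> real n * V" using m by simp
  then show ?thesis using n by (simp add: field_simps)
qed

section \<open>Choice of the number of cells\<close>

text \<open>With \<open>t\<close> the squared bias, the hypothesis concerns its power
  \<open>1 / (2 * \<beta>)\<close>; raising to \<open>2 * \<beta>\<close> undoes it.\<close>

lemma le_power_of_ennreal_powr_le:
  assumes t: "0 \<le> t" and \<beta>: "\<beta> \<ge> (1::nat)" and le: "(t powr (1/2)) powr (1 / real \<beta>) \<le> s"
  shows "t \<le> (s ^ \<beta>)\<^sup>2"
proof (cases "t = 0")
  case False
  define a where "a = (t powr (1/2)) powr (1 / real \<beta>)"
  have "a = t powr (1 / (2 * real \<beta>))" by (simp add: a_def powr_powr)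
  then have "a ^ (2 * \<beta>) = t powr (1 / (2 * real \<beta>) * real (2 * \<beta>))"
    using t False by (simp add: powr_realpow[symmetric] powr_powr)
  also have "\<dots> = t" using \<beta> t False by simp
  finally have "t = a ^ (2 * \<beta>)" ..
  also have "\<dots> \<le> s ^ (2 * \<beta>)" using le by (intro power_mono) (auto simp: a_def)
  finally show ?thesis by (simp add: power_mult[symmetric] mult.commute)
qed simp

theorem theorem5p1:
  fixes M :: "'w measure" and W :: "real \<Rightarrow> 'w \<Rightarrow> real"
    and n \<beta> :: nat and R :: real
  assumes "standard_brownian_motion M W"
    and "n \<ge> 1" and "\<beta> \<ge> 1"
    and "R > 2 * Gamma_const \<beta>"
  shows "(INF fhat \<in> small_bias_estimators \<beta> R (white_noise_law M W n).
            mult_inf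
              (SUP f\<in>sobolev_ball \<beta> R.
                 ennreal_powr (abs_IBias (white_noise_law M W n) f fhat) (1 / real \<beta>))
              (SUP f\<in>sobolev_ball \<beta> R. IVar (white_noise_law M W n) f fhat))
          \<ge> ennreal (1 / (8 * real n))"
proof (rule INF_greatest)
  fix fhat assume fhat: "fhat \<in> small_bias_estimators \<beta> R (white_noise_law M W n)"
  define P where "P = white_noise_law M W n"
  define S1 where "S1 = (SUP f\<in>sobolev_ball \<beta> R. ennreal_powr (abs_IBias P f fhat) (1 / real \<beta>))"
  define S2 where "S2 = (SUP f\<in>sobolev_ball \<beta> R. IVar P f fhat)"
  have "ennreal (1 / (8 * real n)) \<le> mult_inf S1 S2"
  proof (cases "S1 = \<infinity> \<or> S2 = \<infinity>")
    case True
    \<comment> \<open>Here the convention \<open>0 * \<infinity> = \<infinity>\<close> enters: it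
      settles the case of zero bias and infinite variance.\<close>
    then show ?thesis by (simp add: mult_inf_def)
  next
    case False
    define s V where "s = enn2real S1" and "V = enn2real S2"
    have s: "S1 = ennreal s" "s \<ge> 0" and V: "S2 = ennreal V" "V \<ge> 0"
      using False by (simp_all add: s_def V_def less_top)
    have bias_value: "\<exists>t. IBias_sq P f fhat = ennreal t \<and> 0 \<le> t \<and> t \<le> 1 \<and>
        ennreal_powr (abs_IBias P f fhat) (1 / real \<beta>) = ennreal ((t powr (1/2)) powr (1 / real \<beta>))"
      if f: "f \<in> sobolev_ball \<beta> R" for f
    proof -
      have "IBias_sq P f fhat \<le> (SUP f\<in>sobolev_ball \<beta> R. IBias_sq P f fhat)" using f by (rule SUP_upper)
      also have "\<dots> < ennreal (2 powr (- real \<beta>))" using fhat by (simp add: small_bias_estimators_def P_def)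
      also have "\<dots> \<le> ennreal 1" by (intro ennreal_leI) (simp add: powr_minus_divide ge_one_powr_ge_zero)
      finally have lt: "IBias_sq P f fhat < ennreal 1" .
      define t where "t = enn2real (IBias_sq P f fhat)"
      have "IBias_sq P f fhat < top" using lt by (rule order_less_trans) simp
      then have t: "IBias_sq P f fhat = ennreal t" "0 \<le> t" by (simp_all add: t_def)
      then have "t \<le> 1" using lt by (simp add: ennreal_less_iff)
      moreover have "ennreal_powr (abs_IBias P f fhat) (1 / real \<beta>) = ennreal ((t powr (1/2)) powr (1 / real \<beta>))"
        using t by (simp add: abs_IBias_def ennreal_powr_def)
      ultimately show ?thesis using t by blast
    qed
    have bias: "IBias_sq P f fhat \<le> ennreal ((1 / real m ^ \<beta>)\<^sup>2)"
      if f: "f \<in> sobolev_ball \<beta> R" and m: "s \<le> 1 / real m" for f m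
    proof -
      obtain t where t: "IBias_sq P f fhat = ennreal t" "0 \<le> t"
        "ennreal_powr (abs_IBias P f fhat) (1 / real \<beta>) = ennreal ((t powr (1/2)) powr (1 / real \<beta>))"
        using bias_value[OF f] by blast
      have "ennreal ((t powr (1/2)) powr (1 / real \<beta>)) \<le> ennreal s"
        unfolding s(1)[symmetric] t(3)[symmetric] S1_def using f by (rule SUP_upper)
      then have "(t powr (1/2)) powr (1 / real \<beta>) \<le> s" using s by (simp add: ennreal_le_iff)
      then have "t \<le> (s ^ \<beta>)\<^sup>2" by (rule le_power_of_ennreal_powr_le[OF t(2) assms(3)])
      also have "\<dots> \<le> ((1 / real m) ^ \<beta>)\<^sup>2" using m s by (intro power_mono) auto
      finally show ?thesis unfolding t(1) by (intro ennreal_leI) (simp add: power_one_over)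
    qed
    \<comment> \<open>Any number of cells with \<open>1 / m\<close> at least the normalised bias
      \<open>s\<close> is admissible; a larger \<open>m\<close> gives a stronger bound.\<close>
    have main: "real m / (4 * real n) \<le> V" if "m \<ge> 1" "s \<le> 1 / real m" for m
    proof (rule white_noise_variance_bound[OF assms(1-3) that(1) assms(4)])
      show "fhat \<in> estimators (sobolev_ball \<beta> R) (white_noise_law M W n)"
        using fhat by (simp add: small_bias_estimators_def)
      show "IBias_sq (white_noise_law M W n) f fhat \<le> ennreal ((1 / real m ^ \<beta>)\<^sup>2)" if "f \<in> sobolev_ball \<beta> R" for f
        using bias[OF that \<open>s \<le> 1 / real m\<close>] by (simp add: P_def)
      show "IVar (white_noise_law M W n) f fhat \<le> ennreal V" if "f \<in> sobolev_ball \<beta> R" for f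
        unfolding V(1)[symmetric] S2_def P_def using that by (rule SUP_upper)
    qed (rule V(2))
    \<comment> \<open>For \<open>s = 0\<close> every \<open>m\<close> would be admissible, which no
      finite \<open>V\<close> survives.\<close>
    have "s > 0"
    proof (rule ccontr)
      assume "\<not> s > 0"
      obtain m :: nat where m: "4 * real n * V + 1 < real m" using reals_Archimedean2 by blast
      have "0 \<le> 4 * real n * V" using V by simp
      then have "m \<ge> 1" using m by linarith
      moreover have "s \<le> 1 / real m" using \<open>\<not> s > 0\<close> by (meson divide_nonneg_nonneg linorder_not_le of_nat_0_le_iff order_trans zero_le_one)
      ultimately have "real m / (4 * real n) \<le> V" by (rule main)
      then have "real m \<le> 4 * real n * V" using assms(2) by (simp add: field_simps)
      with m show False by simp
    qed
    \<comment> \<open>The bias restriction on the estimators gives \<open>s \<le> 1\<close>, so at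
      least one cell is admissible.\<close>
    have "S1 \<le> ennreal 1"
      unfolding S1_def
    proof (rule SUP_least)
      fix f assume "f \<in> sobolev_ball \<beta> R"
      then obtain t where t: "0 \<le> t" "t \<le> 1"
        "ennreal_powr (abs_IBias P f fhat) (1 / real \<beta>) = ennreal ((t powr (1/2)) powr (1 / real \<beta>))"
        using bias_value by blast
      show "ennreal_powr (abs_IBias P f fhat) (1 / real \<beta>) \<le> ennreal 1"
        unfolding t(3) using t(1) t(2) powr_le1[of "1 / 2" t]
        by (intro ennreal_leI powr_le1 powr_ge_zero) auto
    qed
    then have s1: "s \<le> 1" using s by (simp add: ennreal_le_iff)
    \<comment> \<open>The largest admissible number of cells. Rounding down costs at most a factor
      2, as \<open>1 / s < m + 1 \<le> 2 * m\<close>; with the \<open>4\<close> of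
      \<open>main\<close> this makes \<open>8\<close>.\<close>
    define m where "m = nat \<lfloor>1 / s\<rfloor>"
    have "1 / s \<ge> 1" using s1 \<open>s > 0\<close> by simp
    then have m: "m \<ge> 1" "real m \<le> 1 / s" "1 / s < real m + 1" unfolding m_def by linarith+
    have "s \<le> 1 / real m" using m \<open>s > 0\<close> by (simp add: field_simps)
    from main[OF m(1) this] have mV: "real m / (4 * real n) \<le> V" .
    have "1 / s < 2 * real m" using m by linarith
    then have "1 \<le> s * (2 * real m)" using \<open>s > 0\<close> by (simp add: field_simps)
    then have "1 / (8 * real n) \<le> s * (2 * real m) / (8 * real n)" using assms(2) by (intro divide_right_mono) auto
    also have "\<dots> = s * (real m / (4 * real n))" by simp
    also have "\<dots> \<le> s * V" using mV s(2) by (rule mult_left_mono)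
    finally have "ennreal (1 / (8 * real n)) \<le> ennreal s * ennreal V"
      using s V by (simp add: ennreal_mult[symmetric] ennreal_leI)
    then show ?thesis using False by (simp add: mult_inf_def s(1)[symmetric] V(1)[symmetric])
  qed
  then show "ennreal (1 / (8 * real n)) \<le> mult_inf
      (SUP f\<in>sobolev_ball \<beta> R. ennreal_powr (abs_IBias (white_noise_law M W n) f fhat) (1 / real \<beta>))
      (SUP f\<in>sobolev_ball \<beta> R. IVar (white_noise_law M W n) f fhat)"
    by (simp add: S1_def S2_def P_def)
qed

end
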